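(* Let $(X,g)$ be a compact connected $n$-dimensional Riemannian manifold, let $\hat\chi$ be a closed $1$-form on $X$ whose graph in $T^*X$ is special Lagrangian, and let $u$ be the solution of the generalized Lagrangian mean curvature flow $\frac{\partial u}{\partial t}=\theta(\hat\chi+du)$ in the setting described in the context. Let $\eta_{ij}=g_{ij}+(\hat\chi_u)_{k,i}g^{kl}(\hat\chi_u)_{l,j}$, where $\hat\chi_u=\hat\chi+du$, and let $v$ be a positive solution of $$\frac{\partial v}{\partial t}=\eta^{ij}v_{ij}.$$ Then there exists a positive constant $C$ depending only on $n$, $g$, $\hat\chi$ and $\|u\|_{C^4(X)}$ such that for any $0<t_1<t_2$, $$\sup_{x\in X}v(x,t_1)\leqslant\inf_{x\in X}v(x,t_2)\left(\frac{t_2}{t_1}\right)^{C}e^{\frac{C}{t_2-t_1}+C(t_2-t_1)}.$$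
   Context: Lower indices on functions denote covariant derivatives with respect to $g$ (so $v_{ij}$ is the Hessian of $v$), $\chi_{j,i}$ is the covariant derivative with respect to $g$ of a $1$-form $\chi$, and $\eta^{ij}$ is the inverse matrix of the time-dependent metric $\eta_{ij}$. For a closed $1$-form $\chi$ on $X$, the Lagrangian angle $\theta(\chi)$ of its graph in $T^*X$ is given by $e^{\sqrt{-1}\theta(\chi)}=\det(g_{ij}+\sqrt{-1}\chi_{j,i})/(\sqrt{\det g_{ij}}\sqrt{\det(g_{ij}+\chi_{k,i}g^{kl}\chi_{l,j})})$; the graph is special Lagrangian if $\theta(\chi)$ is constant. Setting: the initial value $u_0\in C^\infty(X)$ of $u$ satisfies $|D^2u_0|_g^2\leqslant\delta_0$, where $D^2u_0$ is the Hessian with respect to $g$ and $\delta_0>0$ is a sufficiently small constant depending only on $n$, $g$ and $\hat\chi$, for which the flow exists smoothly on $X\times[0,+\infty)$. *)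

theory Defs
  imports "HOL-Analysis.Analysis"
begin

section \<open>Smooth functions on subsets of Euclidean space\<close>

text \<open>
  The sets \<open>S\<close> below are open sets \<open>V\<close> or products \<open>I \<times> V\<close> with \<open>V\<close> open and \<open>I = {0..}\<close> or
  \<open>I = {0<..}\<close>. On these, derivatives within the set are unique, so the witness \<open>f'\<close> is determined
  on \<open>S\<close>, and on \<open>{0..} \<times> V\<close> the notion is smoothness up to the boundary \<open>t = 0\<close>.
\<close>

primrec Ck_on :: "nat \<Rightarrow> 'e::euclidean_space set \<Rightarrow> ('e \<Rightarrow> 'f::real_normed_vector) \<Rightarrow> bool" where
  "Ck_on 0 S f \<longleftrightarrow> continuous_on S f"
| "Ck_on (Suc k) S f \<longleftrightarrow> continuous_on S f \<and>
     (\<exists>f'. (\<forall>x\<in>S. (f has_derivative f' x) (at x within S)) \<and>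
           (\<forall>b\<in>Basis. Ck_on k S (\<lambda>x. f' x b)))"

definition smooth_on :: "'e::euclidean_space set \<Rightarrow> ('e \<Rightarrow> 'f::real_normed_vector) \<Rightarrow> bool" where
  "smooth_on S f \<longleftrightarrow> (\<forall>k. Ck_on k S f)"

definition pderiv_at :: "'n::finite \<Rightarrow> (real^'n \<Rightarrow> real) \<Rightarrow> real^'n \<Rightarrow> real" where
  "pderiv_at i f y = frechet_derivative f (at y) (axis i 1)"


section \<open>Manifolds\<close>

text \<open>
  The manifold \<open>X\<close> is the whole type \<open>'a\<close>, its dimension is \<open>CARD('n)\<close>, and its smooth structure is
  given by an atlas. A chart is a coordinate domain together with its coordinate map. Second
  countability is not required separately, since it follows from compactness.
\<close>

type_synonym ('a, 'n) chart = "'a set \<times> ('a \<Rightarrow> real^'n)"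

definition chart_dom :: "('a, 'n) chart \<Rightarrow> 'a set" where
  "chart_dom c = fst c"

definition coord :: "('a, 'n) chart \<Rightarrow> 'a \<Rightarrow> real^'n" where
  "coord c = snd c"

definition chart_img :: "('a, 'n) chart \<Rightarrow> (real^'n) set" where
  "chart_img c = coord c ` chart_dom c"

definition chart_inv :: "('a, 'n) chart \<Rightarrow> real^'n \<Rightarrow> 'a" where
  "chart_inv c = inv_into (chart_dom c) (coord c)"

definition transition :: "('a, 'n) chart \<Rightarrow> ('a, 'n) chart \<Rightarrow> real^'n \<Rightarrow> real^'n" where
  "transition c d = coord d \<circ> chart_inv c"

definition smooth_atlas :: "('a::topological_space, 'n::finite) chart set \<Rightarrow> bool" where
  "smooth_atlas \<A> \<longleftrightarrow>
     (\<Union>c\<in>\<A>. chart_dom c) = UNIV \<and>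
     (\<forall>c\<in>\<A>. open (chart_dom c) \<and> open (chart_img c) \<and>
        homeomorphism (chart_dom c) (chart_img c) (coord c) (chart_inv c)) \<and>
     (\<forall>c\<in>\<A>. \<forall>d\<in>\<A>. smooth_on (coord c ` (chart_dom c \<inter> chart_dom d)) (transition c d))"

text \<open>The local coordinate expression of a function.\<close>

definition in_chart :: "('a, 'n) chart \<Rightarrow> ('a \<Rightarrow> real) \<Rightarrow> real^'n \<Rightarrow> real" where
  "in_chart c f y = f (chart_inv c y)"

definition smooth_fun :: "('a, 'n::finite) chart set \<Rightarrow> ('a \<Rightarrow> real) \<Rightarrow> bool" where
  "smooth_fun \<A> f \<longleftrightarrow> (\<forall>c\<in>\<A>. smooth_on (chart_img c) (in_chart c f))"

text \<open>Joint smoothness of a time-dependent function on \<open>X \<times> I\<close>.\<close>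

definition smooth_spacetime ::
    "('a, 'n::finite) chart set \<Rightarrow> real set \<Rightarrow> (real \<Rightarrow> 'a \<Rightarrow> real) \<Rightarrow> bool" where
  "smooth_spacetime \<A> I u \<longleftrightarrow>
     (\<forall>c\<in>\<A>. smooth_on (I \<times> chart_img c) (\<lambda>(t, y). in_chart c (u t) y))"


section \<open>Metrics and 1-forms\<close>

text \<open>
  Tensor fields are given by their components in every chart of the atlas, as functions of the
  coordinates, subject to the transformation law under changes of coordinates. Only the values at
  points of \<open>chart_img c\<close> matter.
\<close>

type_synonym ('a, 'n) metric_field = "('a, 'n) chart \<Rightarrow> real^'n \<Rightarrow> real^'n^'n"
type_synonym ('a, 'n) one_form = "('a, 'n) chart \<Rightarrow> real^'n \<Rightarrow> real^'n"

text \<open>\<open>jacobian c d y $ k $ i\<close> is the partial derivative of the \<open>k\<close>-th coordinate of \<open>d\<close> with respect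
  to the \<open>i\<close>-th coordinate of \<open>c\<close>.\<close>

definition jacobian :: "('a, 'n::finite) chart \<Rightarrow> ('a, 'n) chart \<Rightarrow> real^'n \<Rightarrow> real^'n^'n" where
  "jacobian c d y = (\<chi> k i. pderiv_at i (\<lambda>z. transition c d z $ k) y)"

definition riemannian_metric ::
    "('a, 'n::finite) chart set \<Rightarrow> ('a, 'n) metric_field \<Rightarrow> bool" where
  "riemannian_metric \<A> g \<longleftrightarrow>
     (\<forall>c\<in>\<A>. smooth_on (chart_img c) (g c)) \<and>
     (\<forall>c\<in>\<A>. \<forall>y\<in>chart_img c. transpose (g c y) = g c y \<and>
        (\<forall>w. w \<noteq> 0 \<longrightarrow> 0 < w \<bullet> (g c y *v w))) \<and>
     (\<forall>c\<in>\<A>. \<forall>d\<in>\<A>. \<forall>x\<in>chart_dom c \<inter> chart_dom d. \<forall>i j.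
        g c (coord c x) $ i $ j =
          (\<Sum>k\<in>UNIV. \<Sum>l\<in>UNIV. jacobian c d (coord c x) $ k $ i * jacobian c d (coord c x) $ l $ j *
             g d (coord d x) $ k $ l))"

definition closed_one_form ::
    "('a, 'n::finite) chart set \<Rightarrow> ('a, 'n) one_form \<Rightarrow> bool" where
  "closed_one_form \<A> \<xi> \<longleftrightarrow>
     (\<forall>c\<in>\<A>. smooth_on (chart_img c) (\<xi> c)) \<and>
     (\<forall>c\<in>\<A>. \<forall>d\<in>\<A>. \<forall>x\<in>chart_dom c \<inter> chart_dom d. \<forall>i.
        \<xi> c (coord c x) $ i =
          (\<Sum>k\<in>UNIV. jacobian c d (coord c x) $ k $ i * \<xi> d (coord d x) $ k)) \<and>
     (\<forall>c\<in>\<A>. \<forall>y\<in>chart_img c. \<forall>i j.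
        pderiv_at i (\<lambda>z. \<xi> c z $ j) y = pderiv_at j (\<lambda>z. \<xi> c z $ i) y)"

text \<open>The form \<open>\<xi> + df\<close>.\<close>

definition add_differential :: "('a, 'n::finite) one_form \<Rightarrow> ('a \<Rightarrow> real) \<Rightarrow> ('a, 'n) one_form" where
  "add_differential \<xi> f c y = \<xi> c y + (\<chi> i. pderiv_at i (in_chart c f) y)"


section \<open>Covariant derivatives\<close>

text \<open>
  In this section everything is local: \<open>G\<close> is the matrix of the metric in one chart, and the
  components of a covariant \<open>k\<close>-tensor in that chart are indexed by lists of length \<open>k\<close>.
\<close>

definition christoffel ::
    "(real^'n \<Rightarrow> real^'n^'n) \<Rightarrow> 'n::finite \<Rightarrow> 'n \<Rightarrow> 'n \<Rightarrow> real^'n \<Rightarrow> real" where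
  "christoffel G m i j y =
     1/2 * (\<Sum>l\<in>UNIV. matrix_inv (G y) $ m $ l *
       (pderiv_at i (\<lambda>z. G z $ j $ l) y + pderiv_at j (\<lambda>z. G z $ i $ l) y
         - pderiv_at l (\<lambda>z. G z $ i $ j) y))"

text \<open>
  \<open>cov_deriv G T (i # js)\<close> is the component of \<open>\<nabla>\<^sub>i T\<close> with indices \<open>js\<close>: the index of differentiation
  comes first. So \<open>\<chi>\<^bsub>j,i\<^esub>\<close> is obtained at \<open>[i, j]\<close>. The value at \<open>[]\<close> has no meaning.
\<close>

fun cov_deriv ::
    "(real^'n \<Rightarrow> real^'n^'n) \<Rightarrow> ('n::finite list \<Rightarrow> real^'n \<Rightarrow> real) \<Rightarrow> 'n list \<Rightarrow> real^'n \<Rightarrow> real" where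
  "cov_deriv G T [] y = 0"
| "cov_deriv G T (i # js) y =
     pderiv_at i (T js) y -
     (\<Sum>a<length js. \<Sum>m\<in>UNIV. christoffel G m i (js ! a) y * T (js[a := m]) y)"

text \<open>The components of \<open>\<nabla>\<^sup>k f\<close> (at lists of length \<open>k\<close>) for a scalar function \<open>f\<close>.\<close>

definition iter_cov_deriv ::
    "(real^'n \<Rightarrow> real^'n^'n) \<Rightarrow> nat \<Rightarrow> (real^'n \<Rightarrow> real) \<Rightarrow> 'n::finite list \<Rightarrow> real^'n \<Rightarrow> real" where
  "iter_cov_deriv G k f = (cov_deriv G ^^ k) (\<lambda>_. f)"

definition tensor_norm_sq ::
    "(real^'n \<Rightarrow> real^'n^'n) \<Rightarrow> nat \<Rightarrow> ('n::finite list \<Rightarrow> real^'n \<Rightarrow> real) \<Rightarrow> real^'n \<Rightarrow> real" where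
  "tensor_norm_sq G k T y =
     (\<Sum>is | length is = k. \<Sum>js | length js = k.
        (\<Prod>a<k. matrix_inv (G y) $ (is ! a) $ (js ! a)) * T is y * T js y)"

text \<open>The matrix with entries \<open>\<chi>\<^bsub>j,i\<^esub>\<close> in row \<open>i\<close> and column \<open>j\<close>, for a 1-form with components \<open>\<omega>\<close>.\<close>

definition cov_matrix ::
    "(real^'n \<Rightarrow> real^'n^'n) \<Rightarrow> (real^'n \<Rightarrow> real^'n) \<Rightarrow> real^'n \<Rightarrow> real^'n::finite^'n" where
  "cov_matrix G \<omega> y = (\<chi> i j. cov_deriv G (\<lambda>ks z. \<omega> z $ hd ks) [i, j] y)"

text \<open>The induced metric \<open>\<eta>\<^bsub>ij\<^esub> = g\<^bsub>ij\<^esub> + \<chi>\<^bsub>k,i\<^esub> g\<^bsup>kl\<^esup> \<chi>\<^bsub>l,j\<^esub>\<close>.\<close>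

definition graph_metric ::
    "(real^'n \<Rightarrow> real^'n^'n) \<Rightarrow> (real^'n \<Rightarrow> real^'n) \<Rightarrow> real^'n \<Rightarrow> real^'n::finite^'n" where
  "graph_metric G \<omega> y = (\<chi> i j. G y $ i $ j +
     (\<Sum>k\<in>UNIV. \<Sum>l\<in>UNIV.
        cov_matrix G \<omega> y $ i $ k * matrix_inv (G y) $ k $ l * cov_matrix G \<omega> y $ j $ l))"


section \<open>Norms of functions on the manifold\<close>

definition hessian_sq_le ::
    "('a, 'n::finite) chart set \<Rightarrow> ('a, 'n) metric_field \<Rightarrow> ('a \<Rightarrow> real) \<Rightarrow> real \<Rightarrow> bool" where
  "hessian_sq_le \<A> g f \<delta> \<longleftrightarrow>
     (\<forall>c\<in>\<A>. \<forall>y\<in>chart_img c.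
        tensor_norm_sq (g c) 2 (iter_cov_deriv (g c) 2 (in_chart c f)) y \<le> \<delta>)"

text \<open>
  The norm of \<open>C\<^sup>m(X)\<close>, as the sum over \<open>k \<le> m\<close> of the suprema over \<open>X\<close> of the pointwise norm of the
  \<open>k\<close>-th covariant derivative. The pointwise norm does not depend on the chart, and for smooth \<open>f\<close> on
  compact \<open>X\<close> the sets below are bounded.
\<close>

definition Cm_norm ::
    "('a, 'n::finite) chart set \<Rightarrow> ('a, 'n) metric_field \<Rightarrow> nat \<Rightarrow> ('a \<Rightarrow> real) \<Rightarrow> real" where
  "Cm_norm \<A> g m f =
     (\<Sum>k\<le>m. Sup {sqrt (tensor_norm_sq (g c) k (iter_cov_deriv (g c) k (in_chart c f)) y) | c y.
                    c \<in> \<A> \<and> y \<in> chart_img c})"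


section \<open>The flow\<close>

text \<open>
  The defining formula determines the Lagrangian angle only modulo \<open>2\<pi>\<close>, so it is rendered as a
  relation: the real-valued function \<open>\<theta>\<close> is a choice of the Lagrangian angle of the graph of \<open>\<xi>\<close>.
\<close>

definition lagrangian_angle ::
    "('a, 'n::finite) chart set \<Rightarrow> ('a, 'n) metric_field \<Rightarrow> ('a, 'n) one_form \<Rightarrow> ('a \<Rightarrow> real) \<Rightarrow> bool" where
  "lagrangian_angle \<A> g \<xi> \<theta> \<longleftrightarrow>
     (\<forall>c\<in>\<A>. \<forall>y\<in>chart_img c.
        exp (\<i> * complex_of_real (in_chart c \<theta> y)) =
          det (\<chi> i j. complex_of_real (g c y $ i $ j)
                     + \<i> * complex_of_real (cov_matrix (g c) (\<xi> c) y $ i $ j)) /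
          complex_of_real (sqrt (det (g c y)) * sqrt (det (graph_metric (g c) (\<xi> c) y))))"

definition special_lagrangian ::
    "('a, 'n::finite) chart set \<Rightarrow> ('a, 'n) metric_field \<Rightarrow> ('a, 'n) one_form \<Rightarrow> bool" where
  "special_lagrangian \<A> g \<xi> \<longleftrightarrow> (\<exists>\<theta>\<^sub>0. lagrangian_angle \<A> g \<xi> (\<lambda>_. \<theta>\<^sub>0))"

text \<open>
  Smooth solutions on \<open>X \<times> {0..}\<close> of \<open>\<partial>u/\<partial>t = \<theta>(\<xi> + du)\<close>. Since \<open>u\<close> is smooth, the equation forces
  the choice \<open>\<theta>\<close> of the angle to be smooth on \<open>X \<times> {0..}\<close>; as this set is connected, two such choices
  differ by a constant multiple of \<open>2\<pi>\<close>.
\<close>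

definition gLMCF ::
    "('a, 'n::finite) chart set \<Rightarrow> ('a, 'n) metric_field \<Rightarrow> ('a, 'n) one_form \<Rightarrow> (real \<Rightarrow> 'a \<Rightarrow> real) \<Rightarrow> bool"
  where
  "gLMCF \<A> g \<xi> u \<longleftrightarrow>
     smooth_spacetime \<A> {0..} u \<and>
     (\<exists>\<theta>. \<forall>t\<ge>0. lagrangian_angle \<A> g (add_differential \<xi> (u t)) (\<theta> t) \<and>
        (\<forall>x. ((\<lambda>s. u s x) has_real_derivative \<theta> t x) (at t within {0..})))"

text \<open>
  Positive solutions of \<open>\<partial>v/\<partial>t = \<eta>\<^bsup>ij\<^esup> v\<^bsub>ij\<^esub>\<close>, where \<open>\<eta>\<close> is the induced metric of the graph of
  \<open>\<xi> + du\<close>. Nothing is required at \<open>t = 0\<close>.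
\<close>

definition positive_solution ::
    "('a, 'n::finite) chart set \<Rightarrow> ('a, 'n) metric_field \<Rightarrow> ('a, 'n) one_form \<Rightarrow>
     (real \<Rightarrow> 'a \<Rightarrow> real) \<Rightarrow> (real \<Rightarrow> 'a \<Rightarrow> real) \<Rightarrow> bool" where
  "positive_solution \<A> g \<xi> u v \<longleftrightarrow>
     smooth_spacetime \<A> {0<..} v \<and>
     (\<forall>t>0. \<forall>x. 0 < v t x) \<and>
     (\<forall>t>0. \<forall>c\<in>\<A>. \<forall>y\<in>chart_img c.
        ((\<lambda>s. in_chart c (v s) y) has_real_derivative
          (\<Sum>i\<in>UNIV. \<Sum>j\<in>UNIV.
             matrix_inv (graph_metric (g c) (add_differential \<xi> (u t) c) y) $ i $ j *
             iter_cov_deriv (g c) 2 (in_chart c (v t)) [i, j] y)) (at t))"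

end

theory Submission
  imports Defs
begin

text \<open>
  This is the method of Li and Yau, carried out in charts. In a chart \<open>f = ln v\<close> solves
  \<open>f\<^sub>t = a\<^bsup>ij\<^esup> f\<^bsub>ij\<^esub> + b\<^bsup>k\<^esup> f\<^sub>k + a\<^bsup>ij\<^esup> f\<^sub>i f\<^sub>j\<close> with \<open>a = \<eta>\<^bsup>-1\<^esup>\<close>. The function \<open>H = a\<^bsup>ij\<^esup> f\<^sub>i f\<^sub>j - 2 f\<^sub>t\<close>
  does not depend on the chart, and the maximum principle for \<open>(t - \<epsilon>) H\<close> gives
  \<open>H \<le> C (1 + 1 / t)\<close> as \<open>\<epsilon>\<close> tends to \<open>0\<close>. As the Bochner formula is used in coordinates, no curvature
  enters: it only needs bounds on \<open>a\<close>, \<open>b\<close>, two spatial derivatives of \<open>a\<close>, one of \<open>b\<close> and one time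
  derivative of each. Since \<open>u\<^sub>t = \<theta>\<close> is a function of the second derivatives of \<open>u\<close>, all of these
  are controlled by the \<open>C\<^sup>4\<close> norm of \<open>u\<close> modulo constants. Integrating the estimate along straight
  segments in coordinate balls, and along chains of finitely many such balls, gives the theorem.
\<close>

section \<open>Uniform differentiability classes\<close>

text \<open>The constant has to be fixed before \<open>u\<close> and \<open>v\<close>, so the
  coefficients are estimated for the whole family of admissible \<open>u\<close> at once. The family
  carries bounds on covariant derivatives of orders one to four only: \<open>u\<close> itself need
  not stay bounded, and subtracting \<open>b t\<close> does not change those derivatives. A lower
  bound on \<eta> costs nothing, because \<eta> dominates g whatever \<open>u\<close> is. The factor
  2 in H closes the argument. With Q = a^ij f_i f_j and L = a^ij d_ij + b^k d_k the equation reads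
  f_t = L f + Q, so (Q + H)/2 = - L f: a large positive H forces a large Hessian, and the spare Q
  absorbs gradients. The Bochner formula then gives the square of the Hessian, hence a term of order
  H squared, against errors at most linear in the Hessian and the term H/(t - \<epsilon>) coming
  from the weight. The weight vanishes at t = \<epsilon>, so nothing need be known about
  \<open>v\<close> near t = 0. The maximum is sought over finitely many closed coordinate balls and
  may fall on the boundary of one. Since H does not depend on the chart, the point is then examined
  in a ball that contains it in its interior.\<close>

definition dd :: "'e::real_normed_vector \<Rightarrow> ('e \<Rightarrow> 'f::real_normed_vector) \<Rightarrow> 'e \<Rightarrow> 'f" where
  "dd b f x = frechet_derivative f (at x) b"

lemma dd_eqI: "(f has_derivative f') (at x) \<Longrightarrow> dd b f x = f' b"
  unfolding dd_def using frechet_derivative_at by metis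

lemma dd_has_derivative: "f differentiable at x \<Longrightarrow> (f has_derivative (\<lambda>b. dd b f x)) (at x)"
  unfolding dd_def using frechet_derivative_works by blast

lemma linear_dd: "f differentiable at x \<Longrightarrow> linear (\<lambda>b. dd b f x)"
  unfolding dd_def using linear_frechet_derivative by blast

lemma differentiable_cong_open:
  assumes "open S" "x \<in> S" "\<And>y. y \<in> S \<Longrightarrow> f y = g y"
  shows "f differentiable at x \<longleftrightarrow> g differentiable at x"
  unfolding differentiable_def
  using assms has_derivative_transform_within_open[OF _ assms(1,2)] by (metis (no_types, lifting))

text \<open>No differentiability is involved: both derivatives are chosen by the same predicate, so
  even the arbitrary values agree.\<close>

lemma dd_cong_open:
  assumes "open S" "x \<in> S" "\<And>y. y \<in> S \<Longrightarrow> f y = g y"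
  shows "dd b f x = dd b g x"
proof -
  have "(f has_derivative f') (at x) \<longleftrightarrow> (g has_derivative f') (at x)" for f'
    by (metis assms has_derivative_transform_within_open)
  then show ?thesis unfolding dd_def frechet_derivative_def by simp
qed

lemma dd_const [simp]: "dd b (\<lambda>x. c) = (\<lambda>x. 0)"
  unfolding dd_def by simp

lemma dd_add: "f differentiable at x \<Longrightarrow> g differentiable at x \<Longrightarrow>
    dd b (\<lambda>x. f x + g x) x = dd b f x + dd b g x"
  by (rule dd_eqI) (auto intro!: derivative_eq_intros dd_has_derivative)

lemma dd_diff: "f differentiable at x \<Longrightarrow> g differentiable at x \<Longrightarrow>
    dd b (\<lambda>x. f x - g x) x = dd b f x - dd b g x"
  by (rule dd_eqI) (auto intro!: derivative_eq_intros dd_has_derivative)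

lemma dd_mult:
  fixes f g :: "'e::real_normed_vector \<Rightarrow> 'f::real_normed_algebra"
  shows "f differentiable at x \<Longrightarrow> g differentiable at x \<Longrightarrow>
    dd b (\<lambda>x. f x * g x) x = f x * dd b g x + dd b f x * g x"
  by (rule dd_eqI) (auto intro!: derivative_eq_intros dd_has_derivative)

lemma dd_sum: "(\<And>i. i \<in> I \<Longrightarrow> f i differentiable at x) \<Longrightarrow>
    dd b (\<lambda>x. \<Sum>i\<in>I. f i x) x = (\<Sum>i\<in>I. dd b (f i) x)"
  by (rule dd_eqI) (auto intro!: derivative_eq_intros dd_has_derivative)

lemma dd_linear:
  assumes "bounded_linear T" "f differentiable at x"
  shows "dd b (\<lambda>x. T (f x)) x = T (dd b f x)"
  by (rule dd_eqI) (rule bounded_linear.has_derivative[OF assms(1) dd_has_derivative[OF assms(2)]])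

lemma dd_inverse:
  fixes f :: "'e::real_normed_vector \<Rightarrow> 'f::real_normed_field"
  shows "f differentiable at x \<Longrightarrow> f x \<noteq> 0 \<Longrightarrow>
    dd b (\<lambda>x. inverse (f x)) x = - (inverse (f x) * dd b f x * inverse (f x))"
  by (rule dd_eqI) (auto intro!: derivative_eq_intros dd_has_derivative)

lemma dd_ln:
  fixes f :: "'e::real_normed_vector \<Rightarrow> real"
  assumes "f differentiable at x" "f x > 0"
  shows "dd b (\<lambda>x. ln (f x)) x = inverse (f x) * dd b f x"
  by (rule dd_eqI)
    (use assms in \<open>auto intro!: derivative_eq_intros dd_has_derivative simp: field_simps\<close>)

lemma differentiable_ln:
  fixes f :: "'e::real_normed_vector \<Rightarrow> real"
  assumes "f differentiable at x" "f x > 0"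
  shows "(\<lambda>x. ln (f x)) differentiable at x"
  unfolding differentiable_def
  by (rule exI, rule has_derivative_ln[OF assms(2) dd_has_derivative[OF assms(1)]])

text \<open>
  For \<open>\<beta> = False\<close> the predicate \<open>Reg\<close> says that every member \<open>h p\<close> of a family is \<open>C\<^sup>k\<close> along the
  directions in \<open>B\<close>; for \<open>\<beta> = True\<close> the derivatives are moreover bounded on \<open>S\<close> uniformly in \<open>p\<close>.
  The flag lets both notions share their closure properties.
\<close>

definition Reg0 :: "bool \<Rightarrow> 'p set \<Rightarrow> 'e::real_normed_vector set \<Rightarrow> ('p \<Rightarrow> 'e \<Rightarrow> 'f::real_normed_vector) \<Rightarrow> bool"
  where "Reg0 \<beta> P S h \<longleftrightarrow> (\<forall>p\<in>P. continuous_on S (h p)) \<and> (\<beta> \<longrightarrow> (\<exists>M. \<forall>p\<in>P. \<forall>x\<in>S. norm (h p x) \<le> M))"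

primrec Reg :: "bool \<Rightarrow> 'e::real_normed_vector set \<Rightarrow> nat \<Rightarrow> 'p set \<Rightarrow> 'e set \<Rightarrow>
    ('p \<Rightarrow> 'e \<Rightarrow> 'f::real_normed_vector) \<Rightarrow> bool" where
  "Reg \<beta> B 0 P S h \<longleftrightarrow> Reg0 \<beta> P S h"
| "Reg \<beta> B (Suc k) P S h \<longleftrightarrow> Reg0 \<beta> P S h \<and> (\<forall>p\<in>P. \<forall>x\<in>S. h p differentiable at x) \<and>
     (\<forall>b\<in>B. Reg \<beta> B k P S (\<lambda>p. dd b (h p)))"

lemma Reg_Reg0: "Reg \<beta> B k P S h \<Longrightarrow> Reg0 \<beta> P S h"
  by (cases k) auto

lemma Reg_Suc: "Reg \<beta> B (Suc k) P S h \<Longrightarrow> Reg \<beta> B k P S h"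
  by (induction k arbitrary: h) auto

lemma Reg0_cong:
  assumes "\<And>p x. p \<in> P \<Longrightarrow> x \<in> S \<Longrightarrow> h p x = h' p x"
  shows "Reg0 \<beta> P S h \<longleftrightarrow> Reg0 \<beta> P S h'"
  unfolding Reg0_def using assms by (simp cong: continuous_on_cong)

text \<open>Since \<open>S\<close> is open, agreement on \<open>S\<close> passes to the derivatives.
  This is how every later lemma replaces a derivative by the formula that its rule provides.\<close>

lemma Reg_cong:
  assumes "open S" "\<And>p x. p \<in> P \<Longrightarrow> x \<in> S \<Longrightarrow> h p x = h' p x"
  shows "Reg \<beta> B k P S h \<longleftrightarrow> Reg \<beta> B k P S h'"
  using assms(2)
proof (induction k arbitrary: h h')
  case 0
  then show ?case using Reg0_cong[of P S h h'] by auto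
next
  case (Suc k)
  have "Reg \<beta> B k P S (\<lambda>p. dd b (h p)) \<longleftrightarrow> Reg \<beta> B k P S (\<lambda>p. dd b (h' p))" for b
    by (rule Suc.IH) (rule dd_cong_open[OF assms(1)], use Suc.prems in auto)
  moreover have "(h p differentiable at x) \<longleftrightarrow> (h' p differentiable at x)" if "p \<in> P" "x \<in> S" for p x
    by (rule differentiable_cong_open[OF assms(1)]) (use Suc.prems that in auto)
  ultimately show ?case using Reg0_cong[of P S h h'] Suc.prems by auto
qed

lemma Reg_const [simp, intro]: "Reg \<beta> B k P S (\<lambda>p x. c)"
  by (induction k arbitrary: c) (auto simp: Reg0_def)

lemma Reg0_add:
  assumes "Reg0 \<beta> P S f" "Reg0 \<beta> P S g"
  shows "Reg0 \<beta> P S (\<lambda>p x. f p x + g p x)"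
proof -
  have "\<exists>M. \<forall>p\<in>P. \<forall>x\<in>S. norm (f p x + g p x) \<le> M" if b: \<beta>
  proof -
    obtain M where "\<forall>p\<in>P. \<forall>x\<in>S. norm (f p x) \<le> M"
      using assms(1) b unfolding Reg0_def by blast
    moreover obtain N where "\<forall>p\<in>P. \<forall>x\<in>S. norm (g p x) \<le> N"
      using assms(2) b unfolding Reg0_def by blast
    ultimately have "\<forall>p\<in>P. \<forall>x\<in>S. norm (f p x + g p x) \<le> M + N"
      by (meson add_mono norm_triangle_le)
    then show ?thesis by blast
  qed
  then show ?thesis using assms unfolding Reg0_def by (auto intro: continuous_on_add)
qed

lemma Reg_add:
  assumes "open S" "Reg \<beta> B k P S f" "Reg \<beta> B k P S g"
  shows "Reg \<beta> B k P S (\<lambda>p x. f p x + g p x)"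
  using assms(2,3)
proof (induction k arbitrary: f g)
  case 0
  then show ?case by (simp add: Reg0_add)
next
  case (Suc k)
  have "Reg \<beta> B k P S (\<lambda>p. dd b (\<lambda>x. f p x + g p x))" if "b \<in> B" for b
  proof -
    have "Reg \<beta> B k P S (\<lambda>p x. dd b (f p) x + dd b (g p) x)"
      using Suc that by auto
    then show ?thesis
      by (rule Reg_cong[THEN iffD1, OF assms(1), rotated]) (use Suc.prems in \<open>auto simp: dd_add\<close>)
  qed
  then show ?case using Suc.prems by (auto intro: Reg0_add)
qed

lemma Reg0_linear:
  assumes "bounded_linear T" "Reg0 \<beta> P S f"
  shows "Reg0 \<beta> P S (\<lambda>p x. T (f p x))"
proof -
  have "\<exists>M. \<forall>p\<in>P. \<forall>x\<in>S. norm (T (f p x)) \<le> M" if b: \<beta>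
  proof -
    obtain M where M: "\<forall>p\<in>P. \<forall>x\<in>S. norm (f p x) \<le> M"
      using assms b unfolding Reg0_def by blast
    obtain K where K: "K > 0" "\<And>x. norm (T x) \<le> norm x * K"
      using bounded_linear.pos_bounded[OF assms(1)] by blast
    have "\<forall>p\<in>P. \<forall>x\<in>S. norm (T (f p x)) \<le> M * K"
      using M K by (meson mult_right_mono less_imp_le order_trans)
    then show ?thesis by blast
  qed
  then show ?thesis using assms unfolding Reg0_def
    by (auto intro: bounded_linear.continuous_on)
qed

lemma Reg_linear:
  assumes "open S" "bounded_linear T" "Reg \<beta> B k P S f"
  shows "Reg \<beta> B k P S (\<lambda>p x. T (f p x))"
  using assms(3)
proof (induction k arbitrary: f)
  case 0
  then show ?case using assms by (simp add: Reg0_linear)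
next
  case (Suc k)
  have "Reg \<beta> B k P S (\<lambda>p. dd b (\<lambda>x. T (f p x)))" if "b \<in> B" for b
  proof -
    have "Reg \<beta> B k P S (\<lambda>p x. T (dd b (f p) x))"
      using Suc that by auto
    then show ?thesis
      by (rule Reg_cong[THEN iffD1, OF assms(1), rotated])
        (use Suc.prems in \<open>auto simp: dd_linear[OF assms(2)]\<close>)
  qed
  moreover have "(\<lambda>x. T (f p x)) differentiable at x" if "p \<in> P" "x \<in> S" for p x
  proof -
    have "f p differentiable at x" using Suc.prems that by auto
    then show ?thesis
      using bounded_linear.has_derivative[OF assms(2)] unfolding differentiable_def by blast
  qed
  ultimately show ?case using Suc.prems by (auto intro: Reg0_linear[OF assms(2)])
qed

lemma Reg_uminus: "open S \<Longrightarrow> Reg \<beta> B k P S f \<Longrightarrow> Reg \<beta> B k P S (\<lambda>p x. - f p x)"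
  using Reg_linear[of S uminus \<beta> B k P f] bounded_linear_minus[OF bounded_linear_ident] by auto

lemma Reg_diff:
  assumes "open S" "Reg \<beta> B k P S f" "Reg \<beta> B k P S g"
  shows "Reg \<beta> B k P S (\<lambda>p x. f p x - g p x)"
  using Reg_add[OF assms(1,2) Reg_uminus[OF assms(1,3)]] by simp

lemma Reg0_mult:
  fixes f g :: "'p \<Rightarrow> 'e::real_normed_vector \<Rightarrow> 'f::real_normed_algebra"
  assumes "Reg0 \<beta> P S f" "Reg0 \<beta> P S g"
  shows "Reg0 \<beta> P S (\<lambda>p x. f p x * g p x)"
proof -
  have "\<exists>M. \<forall>p\<in>P. \<forall>x\<in>S. norm (f p x * g p x) \<le> M" if b: \<beta>
  proof -
    obtain M where M: "\<forall>p\<in>P. \<forall>x\<in>S. norm (f p x) \<le> M"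
      using assms(1) b unfolding Reg0_def by blast
    obtain N where N: "\<forall>p\<in>P. \<forall>x\<in>S. norm (g p x) \<le> N"
      using assms(2) b unfolding Reg0_def by blast
    have "norm (f p x * g p x) \<le> M * N" if "p \<in> P" "x \<in> S" for p x
    proof -
      have "norm (f p x * g p x) \<le> norm (f p x) * norm (g p x)" by (rule norm_mult_ineq)
      also have "\<dots> \<le> M * N" using M N that
        by (meson mult_mono norm_ge_zero order_trans)
      finally show ?thesis .
    qed
    then show ?thesis by blast
  qed
  then show ?thesis using assms unfolding Reg0_def by (auto intro: continuous_on_mult)
qed

lemma Reg_mult:
  fixes f g :: "'p \<Rightarrow> 'e::real_normed_vector \<Rightarrow> 'f::real_normed_algebra"
  assumes "open S" "Reg \<beta> B k P S f" "Reg \<beta> B k P S g"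
  shows "Reg \<beta> B k P S (\<lambda>p x. f p x * g p x)"
  using assms(2,3)
proof (induction k arbitrary: f g)
  case 0
  then show ?case by (simp add: Reg0_mult)
next
  case (Suc k)
  have "Reg \<beta> B k P S (\<lambda>p. dd b (\<lambda>x. f p x * g p x))" if "b \<in> B" for b
  proof -
    have "Reg \<beta> B k P S (\<lambda>p x. f p x * dd b (g p) x)"
      using Suc.IH[OF Reg_Suc[OF Suc.prems(1)]] Suc.prems(2) that by auto
    moreover have "Reg \<beta> B k P S (\<lambda>p x. dd b (f p) x * g p x)"
      using Suc.IH[OF _ Reg_Suc[OF Suc.prems(2)]] Suc.prems(1) that by auto
    ultimately have "Reg \<beta> B k P S (\<lambda>p x. f p x * dd b (g p) x + dd b (f p) x * g p x)"
      by (rule Reg_add[OF assms(1)])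
    then show ?thesis
      by (rule Reg_cong[THEN iffD1, OF assms(1), rotated]) (use Suc.prems in \<open>auto simp: dd_mult\<close>)
  qed
  then show ?case using Suc.prems by (auto intro: Reg0_mult)
qed

lemma Reg_sum:
  assumes "open S" "\<And>i. i \<in> I \<Longrightarrow> Reg \<beta> B k P S (f i)"
  shows "Reg \<beta> B k P S (\<lambda>p x. \<Sum>i\<in>I. f i p x)"
  using assms(2) by (induction I rule: infinite_finite_induct) (auto intro: Reg_add[OF assms(1)])

lemma Reg_prod:
  fixes f :: "'i \<Rightarrow> 'p \<Rightarrow> 'e::real_normed_vector \<Rightarrow> 'f::real_normed_field"
  assumes "open S" "\<And>i. i \<in> I \<Longrightarrow> Reg \<beta> B k P S (f i)"
  shows "Reg \<beta> B k P S (\<lambda>p x. \<Prod>i\<in>I. f i p x)"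
  using assms(2) by (induction I rule: infinite_finite_induct) (auto intro: Reg_mult[OF assms(1)])

lemma Reg0_inverse:
  fixes f :: "'p \<Rightarrow> 'e::real_normed_vector \<Rightarrow> 'f::real_normed_field"
  assumes "Reg0 \<beta> P S f" "\<And>p x. p \<in> P \<Longrightarrow> x \<in> S \<Longrightarrow> f p x \<noteq> 0"
    and "\<beta> \<Longrightarrow> \<exists>m>0. \<forall>p\<in>P. \<forall>x\<in>S. m \<le> norm (f p x)"
  shows "Reg0 \<beta> P S (\<lambda>p x. inverse (f p x))"
proof -
  have "\<exists>M. \<forall>p\<in>P. \<forall>x\<in>S. norm (inverse (f p x)) \<le> M" if b: \<beta>
  proof -
    obtain m where "m > 0" "\<forall>p\<in>P. \<forall>x\<in>S. m \<le> norm (f p x)"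
      using assms(3) b by blast
    then have "\<forall>p\<in>P. \<forall>x\<in>S. norm (inverse (f p x)) \<le> inverse m"
      by (auto simp: norm_inverse intro!: le_imp_inverse_le)
    then show ?thesis by blast
  qed
  then show ?thesis using assms unfolding Reg0_def by (auto intro: continuous_on_inverse)
qed

text \<open>The derivative of 1/f is - (1/f) f' (1/f), a product of functions already in the class
  by induction. A uniform lower bound on the modulus is asked for only when uniform bounds are
  claimed.\<close>

lemma Reg_inverse:
  fixes f :: "'p \<Rightarrow> 'e::real_normed_vector \<Rightarrow> 'f::real_normed_field"
  assumes "open S" "Reg \<beta> B k P S f" and nz: "\<And>p x. p \<in> P \<Longrightarrow> x \<in> S \<Longrightarrow> f p x \<noteq> 0"
    and lb: "\<beta> \<Longrightarrow> \<exists>m>0. \<forall>p\<in>P. \<forall>x\<in>S. m \<le> norm (f p x)"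
  shows "Reg \<beta> B k P S (\<lambda>p x. inverse (f p x))"
  using assms(2)
proof (induction k)
  case 0
  then show ?case using Reg0_inverse[of \<beta> P S f] nz lb by auto
next
  case (Suc k)
  have IH: "Reg \<beta> B k P S (\<lambda>p x. inverse (f p x))"
    using Suc.IH Reg_Suc[OF Suc.prems] by blast
  have "Reg \<beta> B k P S (\<lambda>p. dd b (\<lambda>x. inverse (f p x)))" if "b \<in> B" for b
  proof -
    have "Reg \<beta> B k P S (\<lambda>p x. - (inverse (f p x) * dd b (f p) x * inverse (f p x)))"
      using Suc.prems that by (intro Reg_uminus Reg_mult assms(1) IH) auto
    then show ?thesis
      by (rule Reg_cong[THEN iffD1, OF assms(1), rotated])
        (use Suc.prems nz in \<open>auto simp: dd_inverse\<close>)
  qed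
  moreover have "Reg0 \<beta> P S (\<lambda>p x. inverse (f p x))" using IH Reg_Reg0 by blast
  ultimately show ?case using Suc.prems nz by (auto intro!: differentiable_inverse)
qed

text \<open>Stated for \<open>\<beta> = False\<close>: it serves ln v, and no bound on the solution
  v is available.\<close>

lemma Reg_ln:
  fixes f :: "'p \<Rightarrow> 'e::real_normed_vector \<Rightarrow> real"
  assumes "open S" "Reg False B k P S f" and pos: "\<And>p x. p \<in> P \<Longrightarrow> x \<in> S \<Longrightarrow> f p x > 0"
  shows "Reg False B k P S (\<lambda>p x. ln (f p x))"
proof -
  have R0: "Reg0 False P S (\<lambda>p x. ln (f p x))"
    using Reg_Reg0[OF assms(2)] pos unfolding Reg0_def by (force intro!: continuous_on_ln)
  show ?thesis
  proof (cases k)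
    case 0
    then show ?thesis using R0 by simp
  next
    case (Suc j)
    have "Reg False B j P S (\<lambda>p. dd b (\<lambda>x. ln (f p x)))" if "b \<in> B" for b
    proof -
      have "Reg False B j P S (\<lambda>p x. inverse (f p x) * dd b (f p) x)"
        using assms(2) Suc that Reg_Suc[of False B j P S f] pos
        by (intro Reg_mult Reg_inverse assms(1)) (auto simp: less_imp_neq[symmetric])
      then show ?thesis
        by (rule Reg_cong[THEN iffD1, OF assms(1), rotated])
          (use assms(2) Suc pos in \<open>auto simp: dd_ln\<close>)
    qed
    then show ?thesis using R0 Suc assms(2) pos by (auto intro: differentiable_ln)
  qed
qed

lemma Reg_det:
  fixes M :: "'p \<Rightarrow> 'e::real_normed_vector \<Rightarrow> 'f::real_normed_field^'n^'n::finite"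
  assumes "open S" "\<And>i j. Reg \<beta> B k P S (\<lambda>p x. M p x $ i $ j)"
  shows "Reg \<beta> B k P S (\<lambda>p x. det (M p x))"
  unfolding det_def by (intro Reg_sum Reg_mult Reg_prod assms Reg_const)

section \<open>Inverse matrices of regular families\<close>

lemma matrix_inv_inverse:
  fixes A :: "real^'n^'n::finite"
  assumes "det A \<noteq> 0"
  shows matrix_inv_right: "A ** matrix_inv A = mat 1"
    and matrix_inv_left: "matrix_inv A ** A = mat 1"
proof -
  have "\<exists>A'. A ** A' = mat 1 \<and> A' ** A = mat 1"
    using assms invertible_det_nz[of A] unfolding invertible_def by blast
  then have "A ** matrix_inv A = mat 1 \<and> matrix_inv A ** A = mat 1"
    unfolding matrix_inv_def by (rule someI_ex)
  then show "A ** matrix_inv A = mat 1" "matrix_inv A ** A = mat 1" by auto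
qed

text \<open>Cramer's rule makes each entry of the inverse a determinant times the reciprocal of a
  determinant, so regularity of inverses reduces to sums, products and one reciprocal.\<close>

lemma matrix_inv_cramer:
  fixes A :: "real^'n^'n::finite"
  assumes "det A \<noteq> 0"
  shows "matrix_inv A $ k $ j = det (\<chi> i l. if l = k then axis j 1 $ i else A $ i $ l) * inverse (det A)"
proof -
  have inv: "A ** matrix_inv A = mat 1"
    using assms by (rule matrix_inv_right)
  have "A *v column j (matrix_inv A) = axis j 1"
    using inv by (simp add: matrix_vector_mul_component vec_eq_iff column_def matrix_matrix_mult_def
        mat_def axis_def matrix_vector_mult_def)
  then have "column j (matrix_inv A) = (\<chi> k. det (\<chi> i l. if l = k then axis j 1 $ i else A $ i $ l) / det A)"
    using cramer[OF assms] by blast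
  then have "column j (matrix_inv A) $ k = det (\<chi> i l. if l = k then axis j 1 $ i else A $ i $ l) / det A"
    by simp
  then show ?thesis by (simp add: column_def field_class.field_divide_inverse)
qed

lemma Reg_matrix_inv:
  fixes M :: "'p \<Rightarrow> 'e::real_normed_vector \<Rightarrow> real^'n^'n::finite"
  assumes "open S" "\<And>i j. Reg \<beta> B k P S (\<lambda>p x. M p x $ i $ j)"
    and nz: "\<And>p x. p \<in> P \<Longrightarrow> x \<in> S \<Longrightarrow> det (M p x) \<noteq> 0"
    and lb: "\<beta> \<Longrightarrow> \<exists>m>0. \<forall>p\<in>P. \<forall>x\<in>S. m \<le> \<bar>det (M p x)\<bar>"
  shows "Reg \<beta> B k P S (\<lambda>p x. matrix_inv (M p x) $ i $ j)"
proof -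
  have "Reg \<beta> B k P S (\<lambda>p x. (\<chi> r l. if l = i then axis j 1 $ r else M p x $ r $ l) $ r $ l)" for r l
    using assms(2) by (cases "l = i") auto
  then have "Reg \<beta> B k P S (\<lambda>p x. det (\<chi> r l. if l = i then axis j 1 $ r else M p x $ r $ l) * inverse (det (M p x)))"
    using nz lb by (intro Reg_mult Reg_inverse Reg_det assms) auto
  then show ?thesis
    by (rule Reg_cong[THEN iffD1, OF assms(1), rotated]) (simp add: matrix_inv_cramer[OF nz])
qed

section \<open>Smooth functions on open sets\<close>

lemma Ck_on_cong:
  assumes "\<And>x. x \<in> S \<Longrightarrow> f x = g x"
  shows "Ck_on k S f \<longleftrightarrow> Ck_on k S g"
  using assms
proof (cases k)
  case 0
  then show ?thesis using assms by (simp cong: continuous_on_cong)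
next
  case (Suc j)
  have "(f has_derivative f') (at x within S) \<longleftrightarrow> (g has_derivative f') (at x within S)" if "x \<in> S" for x f'
    using has_derivative_transform[OF that, of g f f'] has_derivative_transform[OF that, of f g f'] assms by auto
  then show ?thesis using Suc assms by (simp cong: continuous_on_cong)
qed

lemma Ck_on_subset:
  assumes "Ck_on k S f" "S' \<subseteq> S"
  shows "Ck_on k S' f"
  using assms(1)
proof (induction k arbitrary: f)
  case 0
  then show ?case using assms(2) continuous_on_subset by auto
next
  case (Suc k)
  then obtain f' where f': "\<forall>x\<in>S. (f has_derivative f' x) (at x within S)"
      "\<forall>b\<in>Basis. Ck_on k S (\<lambda>x. f' x b)" "continuous_on S f"
    by auto
  then show ?case using Suc.IH assms(2)
    by (auto intro!: exI[of _ f'] intro: continuous_on_subset has_derivative_subset)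
qed

text \<open>The bridge to the given notion of smoothness: a single function is a one-member family,
  and on an open set the derivative within the set is the full derivative.\<close>

lemma Ck_on_Reg:
  assumes "open S"
  shows "Ck_on k S f \<longleftrightarrow> Reg False Basis k {()} S (\<lambda>_. f)"
proof (induction k arbitrary: f)
  case 0
  then show ?case by (simp add: Reg0_def)
next
  case (Suc k)
  show ?case
  proof
    assume "Ck_on (Suc k) S f"
    then obtain f' where f': "\<forall>x\<in>S. (f has_derivative f' x) (at x)"
        "\<forall>b\<in>Basis. Ck_on k S (\<lambda>x. f' x b)" "continuous_on S f"
      using at_within_open[OF _ assms] by auto
    have "Ck_on k S (dd b f)" if "b \<in> Basis" for b
      using f' that by (subst Ck_on_cong[of S _ "\<lambda>x. f' x b"]) (auto intro: dd_eqI)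
    then show "Reg False Basis (Suc k) {()} S (\<lambda>_. f)"
      using f' Suc by (auto simp: Reg0_def differentiable_def)
  next
    assume R: "Reg False Basis (Suc k) {()} S (\<lambda>_. f)"
    then have "\<forall>x\<in>S. (f has_derivative (\<lambda>b. dd b f x)) (at x within S)"
      using dd_has_derivative has_derivative_at_withinI by (simp) blast
    moreover have "\<forall>b\<in>Basis. Ck_on k S (\<lambda>x. dd b f x)"
      using R Suc by auto
    ultimately show "Ck_on (Suc k) S f"
      using R by (auto simp: Reg0_def)
  qed
qed

lemma smooth_on_Reg: "open S \<Longrightarrow> smooth_on S f \<longleftrightarrow> (\<forall>k. Reg False Basis k {()} S (\<lambda>_. f))"
  unfolding smooth_on_def by (simp add: Ck_on_Reg)

lemma smooth_on_subset: "smooth_on S f \<Longrightarrow> S' \<subseteq> S \<Longrightarrow> smooth_on S' f"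
  unfolding smooth_on_def using Ck_on_subset by blast

lemma smooth_on_cong: "(\<And>x. x \<in> S \<Longrightarrow> f x = g x) \<Longrightarrow> smooth_on S f \<longleftrightarrow> smooth_on S g"
  unfolding smooth_on_def using Ck_on_cong by blast

lemma smooth_on_continuous: "smooth_on S f \<Longrightarrow> continuous_on S f"
  unfolding smooth_on_def by (metis Ck_on.simps(1))

lemma smooth_on_const [simp]: "open S \<Longrightarrow> smooth_on S (\<lambda>x. c)"
  by (simp add: smooth_on_Reg)

lemma smooth_on_add: "open S \<Longrightarrow> smooth_on S f \<Longrightarrow> smooth_on S g \<Longrightarrow> smooth_on S (\<lambda>x. f x + g x)"
  by (simp add: smooth_on_Reg Reg_add)

lemma smooth_on_diff: "open S \<Longrightarrow> smooth_on S f \<Longrightarrow> smooth_on S g \<Longrightarrow> smooth_on S (\<lambda>x. f x - g x)"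
  by (simp add: smooth_on_Reg Reg_diff)

lemma smooth_on_uminus: "open S \<Longrightarrow> smooth_on S f \<Longrightarrow> smooth_on S (\<lambda>x. - f x)"
  by (simp add: smooth_on_Reg Reg_uminus)

lemma smooth_on_mult:
  fixes f g :: "'e::euclidean_space \<Rightarrow> 'f::real_normed_algebra"
  shows "open S \<Longrightarrow> smooth_on S f \<Longrightarrow> smooth_on S g \<Longrightarrow> smooth_on S (\<lambda>x. f x * g x)"
  by (simp add: smooth_on_Reg Reg_mult)

lemma smooth_on_linear: "open S \<Longrightarrow> bounded_linear T \<Longrightarrow> smooth_on S f \<Longrightarrow> smooth_on S (\<lambda>x. T (f x))"
  using Reg_linear[of S T False Basis _ "{()}" "\<lambda>_. f"] by (simp add: smooth_on_Reg)

lemma smooth_on_sum: "open S \<Longrightarrow> (\<And>i. i \<in> I \<Longrightarrow> smooth_on S (f i)) \<Longrightarrow> smooth_on S (\<lambda>x. \<Sum>i\<in>I. f i x)"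
  by (auto simp: smooth_on_Reg intro!: Reg_sum)

lemma smooth_on_ln:
  fixes f :: "'e::euclidean_space \<Rightarrow> real"
  shows "open S \<Longrightarrow> smooth_on S f \<Longrightarrow> (\<And>x. x \<in> S \<Longrightarrow> f x > 0) \<Longrightarrow> smooth_on S (\<lambda>x. ln (f x))"
  by (auto simp: smooth_on_Reg intro!: Reg_ln)

lemma smooth_on_matrix_inv:
  fixes M :: "'e::euclidean_space \<Rightarrow> real^'n^'n::finite"
  shows "open S \<Longrightarrow> (\<And>i j. smooth_on S (\<lambda>x. M x $ i $ j)) \<Longrightarrow> (\<And>x. x \<in> S \<Longrightarrow> det (M x) \<noteq> 0) \<Longrightarrow>
    smooth_on S (\<lambda>x. matrix_inv (M x) $ i $ j)"
  by (auto simp: smooth_on_Reg intro!: Reg_matrix_inv)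

lemma smooth_on_differentiable: "open S \<Longrightarrow> smooth_on S f \<Longrightarrow> x \<in> S \<Longrightarrow> f differentiable at x"
  using smooth_on_Reg[of S f] Reg.simps(2)[of False Basis 0 "{()}" S "\<lambda>_. f"] by blast

lemma dd_expand:
  fixes f :: "'e::euclidean_space \<Rightarrow> 'f::real_normed_vector"
  assumes "f differentiable at x"
  shows "dd w f x = (\<Sum>b\<in>Basis. (w \<bullet> b) *\<^sub>R dd b f x)"
proof -
  interpret linear "\<lambda>b. dd b f x" by (rule linear_dd[OF assms])
  have "dd w f x = dd (\<Sum>b\<in>Basis. (w \<bullet> b) *\<^sub>R b) f x" by (simp add: euclidean_representation)
  then show ?thesis by (simp add: sum scaleR)
qed

text \<open>Smoothness is defined through basis directions; linearity of the derivative extends it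
  to every direction.\<close>

lemma smooth_on_dd:
  fixes f :: "'e::euclidean_space \<Rightarrow> 'f::real_normed_vector"
  assumes "open S" "smooth_on S f"
  shows "smooth_on S (dd w f)"
proof -
  have "smooth_on S (dd b f)" if "b \<in> Basis" for b
    unfolding smooth_on_Reg[OF assms(1)]
  proof
    fix k
    have "Reg False Basis (Suc k) {()} S (\<lambda>_. f)" using assms smooth_on_Reg by blast
    then show "Reg False Basis k {()} S (\<lambda>_. dd b f)" using that by simp
  qed
  then have "smooth_on S (\<lambda>x. \<Sum>b\<in>Basis. (w \<bullet> b) *\<^sub>R dd b f x)"
    by (intro smooth_on_sum smooth_on_linear[OF _ bounded_linear_scaleR_right] assms) auto
  then show ?thesis
    by (rule smooth_on_cong[THEN iffD1, rotated])
      (use dd_expand smooth_on_differentiable[OF assms] in metis)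
qed

lemma Reg_smooth_Suc:
  assumes "open S" "\<And>p. p \<in> P \<Longrightarrow> smooth_on S (h p)"
    "\<exists>M. \<forall>p\<in>P. \<forall>x\<in>S. norm (h p x) \<le> M" "\<And>b. b \<in> B \<Longrightarrow> Reg True B k P S (\<lambda>p. dd b (h p))"
  shows "Reg True B (Suc k) P S h"
  using assms by (auto simp: Reg0_def smooth_on_continuous smooth_on_differentiable)

section \<open>Functions on space-time: lifts and slices\<close>

lemma dd_snd:
  fixes h :: "'b::real_normed_vector \<Rightarrow> 'f::real_normed_vector"
  assumes "h differentiable at (snd z)"
  shows "dd w (\<lambda>z::'a::real_normed_vector\<times>'b. h (snd z)) z = dd (snd w) h (snd z)"
proof -
  have "((h \<circ> snd) has_derivative ((\<lambda>b. dd b h (snd z)) \<circ> snd)) (at z)"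
    by (rule diff_chain_at) (use assms in \<open>auto intro!: derivative_eq_intros dd_has_derivative\<close>)
  then show ?thesis by (auto dest!: dd_eqI[of _ _ z w] simp: o_def)
qed

lemma differentiable_snd:
  assumes "h differentiable at (snd z)"
  shows "(\<lambda>z. h (snd z)) differentiable at z"
proof -
  have "((h \<circ> snd) has_derivative ((\<lambda>b. dd b h (snd z)) \<circ> snd)) (at z)"
    by (rule diff_chain_at) (use assms in \<open>auto intro!: derivative_eq_intros dd_has_derivative\<close>)
  then show ?thesis unfolding differentiable_def o_def by blast
qed

text \<open>Time-independent data are bounded with all their derivatives even over an infinite time
  interval, because they only see the compact set \<open>K\<close>.\<close>

lemma Reg_lift:
  fixes h :: "'e::euclidean_space \<Rightarrow> 'f::real_normed_vector"
    and S :: "('a::real_normed_vector \<times> 'e) set"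
  assumes "open S" "open V" "smooth_on V h" "snd ` S \<subseteq> K" "K \<subseteq> V" "\<beta> \<Longrightarrow> compact K"
  shows "Reg \<beta> B k P S (\<lambda>p z. h (snd z))"
proof -
  have R0: "Reg0 \<beta> P S (\<lambda>p z. h (snd z))" if "smooth_on V h" for h :: "'e \<Rightarrow> 'f"
  proof -
    have c: "continuous_on K h" using smooth_on_continuous[OF that] assms(5) continuous_on_subset by blast
    have "continuous_on S (\<lambda>z. h (snd z))"
      using continuous_on_compose2[OF c continuous_on_snd[OF continuous_on_id] assms(4)] by simp
    moreover have "\<exists>M. \<forall>z\<in>S. norm (h (snd z)) \<le> M" if \<beta>
    proof -
      have "compact (h ` K)" using c assms(6) that compact_continuous_image by blast
      then obtain M where "\<forall>x\<in>h ` K. norm x \<le> M" using compact_imp_bounded bounded_iff by metis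
      then show ?thesis using assms(4) by blast
    qed
    ultimately show ?thesis unfolding Reg0_def by blast
  qed
  have SV: "snd z \<in> V" if "z \<in> S" for z using assms that by auto
  show ?thesis using assms(3)
  proof (induction k arbitrary: h)
    case 0
    then show ?case using R0 by simp
  next
    case (Suc k)
    note df = smooth_on_differentiable[OF assms(2) Suc.prems]
    have "Reg \<beta> B k P S (\<lambda>p. dd w (\<lambda>z. h (snd z)))" for w :: "'a \<times> 'e"
    proof -
      have "Reg \<beta> B k P S (\<lambda>p z. dd (snd w) h (snd z))"
        by (rule Suc.IH) (rule smooth_on_dd[OF assms(2) Suc.prems])
      then show ?thesis
        by (rule Reg_cong[THEN iffD1, OF assms(1), rotated]) (simp add: dd_snd[OF df[OF SV]])
    qed
    then show ?case using R0[OF Suc.prems] df SV by (auto intro!: differentiable_snd)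
  qed
qed

lemma smooth_on_snd:
  fixes h :: "'e::euclidean_space \<Rightarrow> 'f::real_normed_vector"
    and S :: "('a::euclidean_space \<times> 'e) set"
  assumes "open S" "open V" "smooth_on V h" "snd ` S \<subseteq> V"
  shows "smooth_on S (\<lambda>z. h (snd z))"
  unfolding smooth_on_Reg[OF assms(1)] using Reg_lift[OF assms order_refl, of False] by blast

lemma dd_slice:
  fixes U :: "'a::real_normed_vector \<times> 'b::real_normed_vector \<Rightarrow> 'f::real_normed_vector"
  assumes "U differentiable at (t, y)"
  shows "(\<lambda>y. U (t, y)) differentiable at y" "dd w (\<lambda>y. U (t, y)) y = dd (0, w) U (t, y)"
proof -
  have "((U \<circ> (\<lambda>y. (t, y))) has_derivative ((\<lambda>b. dd b U (t, y)) \<circ> (\<lambda>w. (0, w)))) (at y)"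
    by (rule diff_chain_at) (use assms in \<open>auto intro!: derivative_eq_intros dd_has_derivative\<close>)
  then have *: "((\<lambda>y. U (t, y)) has_derivative (\<lambda>w. dd (0, w) U (t, y))) (at y)"
    by (simp add: o_def)
  then show "(\<lambda>y. U (t, y)) differentiable at y" unfolding differentiable_def by blast
  show "dd w (\<lambda>y. U (t, y)) y = dd (0, w) U (t, y)" using dd_eqI[OF *] .
qed

lemma dd_slice_time:
  fixes U :: "real \<times> 'b::real_normed_vector \<Rightarrow> 'f::real_normed_vector"
  assumes "U differentiable at (t, y)"
  shows "((\<lambda>s. U (s, y)) has_vector_derivative dd (1, 0) U (t, y)) (at t)"
proof -
  have "((U \<circ> (\<lambda>s. (s, y))) has_derivative ((\<lambda>b. dd b U (t, y)) \<circ> (\<lambda>s. (s, 0)))) (at t)"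
    by (rule diff_chain_at) (use assms in \<open>auto intro!: derivative_eq_intros dd_has_derivative\<close>)
  moreover have "(\<lambda>b. dd b U (t, y)) \<circ> (\<lambda>s. (s, 0)) = (\<lambda>s. s *\<^sub>R dd (1, 0) U (t, y))"
  proof
    fix s show "((\<lambda>b. dd b U (t, y)) \<circ> (\<lambda>s. (s, 0))) s = s *\<^sub>R dd (1, 0) U (t, y)"
      using linear_scale[OF linear_dd[OF assms], of s "(1,0)"] by simp
  qed
  ultimately show ?thesis unfolding has_vector_derivative_def by (simp only: o_def)
qed

lemma smooth_on_slice:
  fixes U :: "'a::euclidean_space \<times> 'b::euclidean_space \<Rightarrow> 'f::real_normed_vector"
  assumes "open T" "open V" "smooth_on (T \<times> V) U" "t \<in> T"
  shows "smooth_on V (\<lambda>y. U (t, y))"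
proof -
  have o: "open (T \<times> V)" using assms by (simp add: open_Times)
  have "Ck_on k V (\<lambda>y. U (t, y))" for k
    using assms(3)
  proof (induction k arbitrary: U)
    case 0
    have "continuous_on V (\<lambda>y. (t, y))" by (intro continuous_intros)
    from continuous_on_compose2[OF smooth_on_continuous[OF 0] this] show ?case using assms(4) by auto
  next
    case (Suc k)
    note df = smooth_on_differentiable[OF o Suc.prems]
    have "Ck_on k V (\<lambda>y. dd (0, b) U (t, y))" for b
      using Suc.IH smooth_on_dd[OF o Suc.prems] by blast
    moreover have "((\<lambda>y. U (t, y)) has_derivative (\<lambda>b. dd (0, b) U (t, y))) (at y within V)" if "y \<in> V" for y
      using dd_has_derivative[OF dd_slice(1)[of U t y]] dd_slice(2)[of U t y] df that assms(4)
      by (auto intro: has_derivative_at_withinI)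
    ultimately show ?case
      by (auto intro!: exI[of _ "\<lambda>y b. dd (0, b) U (t, y)"] has_derivative_continuous_on)
  qed
  then show ?thesis unfolding smooth_on_def by blast
qed

section \<open>Symmetry of second derivatives\<close>

lemma dd_line:
  fixes f :: "'e::real_normed_vector \<Rightarrow> real"
  assumes "f differentiable at (x + s *\<^sub>R b)"
  shows "((\<lambda>s. f (x + s *\<^sub>R b)) has_real_derivative dd b f (x + s *\<^sub>R b)) (at s)"
proof -
  have "((f \<circ> (\<lambda>s. x + s *\<^sub>R b)) has_derivative ((\<lambda>w. dd w f (x + s *\<^sub>R b)) \<circ> (\<lambda>r. r *\<^sub>R b))) (at s)"
    by (rule diff_chain_at) (use assms in \<open>auto intro!: derivative_eq_intros dd_has_derivative\<close>)
  moreover have "(\<lambda>w. dd w f (x + s *\<^sub>R b)) \<circ> (\<lambda>r. r *\<^sub>R b) = (*) (dd b f (x + s *\<^sub>R b))"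
  proof
    fix r show "((\<lambda>w. dd w f (x + s *\<^sub>R b)) \<circ> (\<lambda>r. r *\<^sub>R b)) r = dd b f (x + s *\<^sub>R b) * r"
      using linear_scale[OF linear_dd[OF assms], of r b] by simp
  qed
  ultimately show ?thesis unfolding has_field_derivative_def by (simp only: o_def)
qed

text \<open>Two mean value steps, in direction \<open>b\<close> for the difference in direction
  \<open>c\<close> and then in direction \<open>c\<close>. The left-hand side is symmetric in
  \<open>b\<close> and \<open>c\<close>, which is what makes the derivatives commute.\<close>

lemma double_difference_mvt:
  fixes f :: "'e::real_normed_vector \<Rightarrow> real"
  assumes h: "0 < h" and S: "\<And>s t. 0 \<le> s \<Longrightarrow> s \<le> h \<Longrightarrow> 0 \<le> t \<Longrightarrow> t \<le> h \<Longrightarrow> x + s *\<^sub>R b + t *\<^sub>R c \<in> S"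
    and d: "\<And>z. z \<in> S \<Longrightarrow> f differentiable at z" "\<And>z. z \<in> S \<Longrightarrow> dd b f differentiable at z"
  obtains s t where "0 < s" "s < h" "0 < t" "t < h"
    "f (x + h *\<^sub>R b + h *\<^sub>R c) - f (x + h *\<^sub>R b) - f (x + h *\<^sub>R c) + f x
       = h * h * dd c (dd b f) (x + s *\<^sub>R b + t *\<^sub>R c)"
proof -
  let ?k = "\<lambda>s. f ((x + h *\<^sub>R c) + s *\<^sub>R b) - f (x + s *\<^sub>R b)"
  have S0: "x + s *\<^sub>R b \<in> S" "(x + h *\<^sub>R c) + s *\<^sub>R b \<in> S" if "0 \<le> s" "s \<le> h" for s
    using S[of s 0] S[of s h] that h by (auto simp: algebra_simps)
  have dk: "(?k has_real_derivative (dd b f ((x + h *\<^sub>R c) + s *\<^sub>R b) - dd b f (x + s *\<^sub>R b))) (at s)"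
    if "0 \<le> s" "s \<le> h" for s
    by (intro DERIV_diff dd_line d S0 that)
  obtain s where s: "0 < s" "s < h"
    "?k h - ?k 0 = (h - 0) * (dd b f ((x + h *\<^sub>R c) + s *\<^sub>R b) - dd b f (x + s *\<^sub>R b))"
    using MVT2[OF h, of ?k, OF dk] by blast
  obtain t where t: "0 < t" "t < h"
    "dd b f ((x + s *\<^sub>R b) + h *\<^sub>R c) - dd b f ((x + s *\<^sub>R b) + 0 *\<^sub>R c)
       = (h - 0) * dd c (dd b f) ((x + s *\<^sub>R b) + t *\<^sub>R c)"
    using MVT2[OF h, of "\<lambda>t. dd b f ((x + s *\<^sub>R b) + t *\<^sub>R c)",
        OF dd_line[OF d(2)[OF S[OF less_imp_le[OF s(1)] less_imp_le[OF s(2)]]]]] by blast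
  have e: "(x + h *\<^sub>R c) + s *\<^sub>R b = (x + s *\<^sub>R b) + h *\<^sub>R c" "(x + h *\<^sub>R c) + h *\<^sub>R b = x + h *\<^sub>R b + h *\<^sub>R c"
    by (simp_all add: algebra_simps)
  have "?k h - ?k 0 = h * (h * dd c (dd b f) ((x + s *\<^sub>R b) + t *\<^sub>R c))"
    using s(3) t(3) unfolding e(1) by simp
  moreover have "?k h - ?k 0 = f (x + h *\<^sub>R b + h *\<^sub>R c) - f (x + h *\<^sub>R b) - f (x + h *\<^sub>R c) + f x"
    unfolding e(2) by simp
  ultimately show ?thesis using s t by (intro that[of s t]) auto
qed

text \<open>The double difference over a small parallelogram equals h squared times either mixed
  derivative at some nearby point; continuity brings both points back to \<open>x\<close>.\<close>

lemma dd_commute: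
  fixes f :: "'e::euclidean_space \<Rightarrow> real"
  assumes "open S" "smooth_on S f" "x \<in> S"
  shows "dd b (dd c f) x = dd c (dd b f) x"
proof -
  note sm = smooth_on_dd[OF assms(1)] and df = smooth_on_differentiable[OF assms(1)]
  let ?A = "dd b (dd c f)" and ?B = "dd c (dd b f)"
  have "\<bar>?A x - ?B x\<bar> \<le> e" if "e > 0" for e
  proof -
    have "continuous_on S ?A" "continuous_on S ?B"
      using assms(2) by (auto intro: smooth_on_continuous sm)
    then have "isCont ?A x" "isCont ?B x"
      using assms continuous_on_eq_continuous_at by blast+
    then have "\<exists>d>0. \<forall>z. dist z x < d \<longrightarrow> dist (?A z) (?A x) < e / 2"
        "\<exists>d>0. \<forall>z. dist z x < d \<longrightarrow> dist (?B z) (?B x) < e / 2"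
      using half_gt_zero[OF that] unfolding continuous_at_eps_delta by blast+
    then obtain d1 d2 where d12: "d1 > 0" "d2 > 0" "\<And>z. dist z x < d1 \<Longrightarrow> dist (?A z) (?A x) < e / 2"
        "\<And>z. dist z x < d2 \<Longrightarrow> dist (?B z) (?B x) < e / 2"
      by blast
    obtain d3 where d3: "d3 > 0" "ball x d3 \<subseteq> S" using assms openE by blast
    define d where "d = min d1 (min d2 d3)"
    have d: "d > 0" using d12 d3 unfolding d_def by simp
    \<comment> \<open>This size keeps the whole parallelogram within distance \<open>d\<close> of
      \<open>x\<close>; the added 1 covers zero directions.\<close>
    define h where "h = d / (norm b + norm c + 1)"
    have n: "norm b + norm c + 1 > 0" by (smt (verit) norm_ge_zero)
    have h: "h > 0" using d n unfolding h_def by simp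
    have close: "dist (x + s *\<^sub>R b + t *\<^sub>R c) x < d" if "0 \<le> s" "s \<le> h" "0 \<le> t" "t \<le> h" for s t
    proof -
      have "norm (s *\<^sub>R b + t *\<^sub>R c) \<le> s * norm b + t * norm c"
        using norm_triangle_ineq[of "s *\<^sub>R b" "t *\<^sub>R c"] that by simp
      also have "\<dots> \<le> h * norm b + h * norm c" using that by (intro add_mono mult_right_mono) auto
      also have "\<dots> < h * (norm b + norm c + 1)" using h by (simp add: algebra_simps)
      also have "\<dots> = d" unfolding h_def using n by simp
      finally show ?thesis by (simp add: dist_norm add.assoc)
    qed
    have inS: "x + s *\<^sub>R b + t *\<^sub>R c \<in> S" if "0 \<le> s" "s \<le> h" "0 \<le> t" "t \<le> h" for s t
      using close[OF that] d3 unfolding d_def by (auto simp: dist_commute subset_iff)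
    obtain s t where st: "0 < s" "s < h" "0 < t" "t < h"
      "f (x + h *\<^sub>R b + h *\<^sub>R c) - f (x + h *\<^sub>R b) - f (x + h *\<^sub>R c) + f x
         = h * h * ?B (x + s *\<^sub>R b + t *\<^sub>R c)"
      using double_difference_mvt[of h x b c S f, OF h inS df[OF assms(2)] df[OF sm[OF assms(2)]]] by blast
    have inS': "x + s *\<^sub>R c + t *\<^sub>R b \<in> S" if "0 \<le> s" "s \<le> h" "0 \<le> t" "t \<le> h" for s t
      using inS[of t s] that by (simp add: add_ac)
    obtain s' t' where st': "0 < s'" "s' < h" "0 < t'" "t' < h"
      "f (x + h *\<^sub>R c + h *\<^sub>R b) - f (x + h *\<^sub>R c) - f (x + h *\<^sub>R b) + f x
         = h * h * ?A (x + s' *\<^sub>R c + t' *\<^sub>R b)"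
      using double_difference_mvt[of h x c b S f, OF h inS' df[OF assms(2)] df[OF sm[OF assms(2)]]] by blast
    have "h * h * ?A (x + s' *\<^sub>R c + t' *\<^sub>R b) = h * h * ?B (x + s *\<^sub>R b + t *\<^sub>R c)"
    proof -
      have "x + h *\<^sub>R b + h *\<^sub>R c = x + h *\<^sub>R c + h *\<^sub>R b" by (simp add: add_ac)
      from st(5)[unfolded this] st'(5) show ?thesis by linarith
    qed
    then have eq: "?A (x + t' *\<^sub>R b + s' *\<^sub>R c) = ?B (x + s *\<^sub>R b + t *\<^sub>R c)"
      using h by (simp add: add_ac)
    have "dist (?A (x + t' *\<^sub>R b + s' *\<^sub>R c)) (?A x) < e / 2"
      using close[of t' s'] st' unfolding d_def by (intro d12(3)) auto
    moreover have "dist (?B (x + s *\<^sub>R b + t *\<^sub>R c)) (?B x) < e / 2"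
      using close[of s t] st unfolding d_def by (intro d12(4)) auto
    ultimately show ?thesis using eq unfolding dist_real_def by linarith
  qed
  then have "\<bar>?A x - ?B x\<bar> \<le> 0" by (rule field_le_epsilon) simp
  then show ?thesis by simp
qed

section \<open>Positive semidefinite forms and tensors\<close>

lemma quadratic_form_shift:
  fixes M :: "'n::finite \<Rightarrow> 'n \<Rightarrow> real"
  assumes sym: "\<And>i j. M i j = M j i"
  shows "(\<Sum>i\<in>UNIV. \<Sum>j\<in>UNIV. M i j * (w i + (if i = a then t else 0)) * (w j + (if j = a then t else 0))) =
    (\<Sum>i\<in>UNIV. \<Sum>j\<in>UNIV. M i j * w i * w j) + 2 * t * (\<Sum>j\<in>UNIV. M a j * w j) + t * t * M a a"
proof -
  have 1: "M i j * (w i + (if i = a then t else 0)) * (w j + (if j = a then t else 0)) =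
      M i j * w i * w j + (if j = a then M i j * w i * t else 0) + (if i = a then M i j * t * w j else 0) +
      (if i = a then if j = a then t * t * M a a else 0 else 0)" for i j
    by (simp add: algebra_simps)
  have 2: "(\<Sum>j\<in>UNIV. if i = a then f j else 0) = (if i = a then (\<Sum>j\<in>UNIV. f j) else 0)" for i and f :: "'n \<Rightarrow> real"
    by simp
  have 3: "(\<Sum>i\<in>UNIV. M i a * w i * t) = t * (\<Sum>j\<in>UNIV. M a j * w j)"
    unfolding sum_distrib_left by (rule sum.cong[OF refl]) (simp add: sym[of a])
  have 4: "(\<Sum>j\<in>UNIV. M a j * t * w j) = t * (\<Sum>j\<in>UNIV. M a j * w j)"
    unfolding sum_distrib_left by (rule sum.cong[OF refl]) simp
  show ?thesis
    unfolding 1 by (simp add: sum.distrib 2 3 4)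
qed

text \<open>Cholesky factorisation by induction on the set of indices where the form is nonzero:
  completing the square in the index \<open>a\<close> leaves a semidefinite form supported on the
  rest.\<close>

lemma psd_factor_on:
  fixes M :: "'n::finite \<Rightarrow> 'n \<Rightarrow> real"
  assumes "finite A" "\<And>i j. M i j = M j i" "\<And>w. 0 \<le> (\<Sum>i\<in>UNIV. \<Sum>j\<in>UNIV. M i j * w i * w j)"
    "\<And>i j. i \<notin> A \<Longrightarrow> M i j = 0"
  shows "\<exists>W. \<forall>i j. M i j = (\<Sum>r\<in>A. W r i * W r j)"
  using assms
proof (induction A arbitrary: M rule: finite_induct)
  case empty
  then show ?case by simp
next
  case (insert a A)
  note sym = insert.prems(1) and psd = insert.prems(2) and supp = insert.prems(3)
  show ?case
  proof (cases "M a a = 0")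
    case True
    have row: "M a j = 0" for j
    proof (rule ccontr)
      assume nz: "M a j \<noteq> 0"
      let ?w = "\<lambda>i. if i = j then 1 else 0 :: real"
      have q: "(\<Sum>i\<in>UNIV. \<Sum>l\<in>UNIV. M i l * ?w i * ?w l) = M j j" "(\<Sum>l\<in>UNIV. M a l * ?w l) = M a j"
      proof -
        have "M i l * ?w i * ?w l = (if l = j then if i = j then M j j else 0 else 0)" for i l by simp
        then show "(\<Sum>i\<in>UNIV. \<Sum>l\<in>UNIV. M i l * ?w i * ?w l) = M j j" by simp
        have "M a l * ?w l = (if l = j then M a j else 0)" for l by simp
        then show "(\<Sum>l\<in>UNIV. M a l * ?w l) = M a j" by simp
      qed
      have "0 \<le> M j j + 2 * t * M a j" for t
        using psd[of "\<lambda>i. ?w i + (if i = a then t else 0)"]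
        unfolding quadratic_form_shift[OF sym] q using True by simp
      \<comment> \<open>With a vanishing diagonal entry the form is affine in \<open>t\<close>, and
        this \<open>t\<close> gives it the value -1.\<close>
      from this[of "- (M j j + 1) / (2 * M a j)"] show False using nz by (simp add: field_simps)
    qed
    have "\<exists>W. \<forall>i j. M i j = (\<Sum>r\<in>A. W r i * W r j)"
      by (rule insert.IH[OF sym psd]) (metis insert_iff supp row)
    then obtain W where W: "\<And>i j. M i j = (\<Sum>r\<in>A. W r i * W r j)" by blast
    have "(\<Sum>r\<in>A. (W(a := (\<lambda>_. 0))) r i * (W(a := (\<lambda>_. 0))) r j) = (\<Sum>r\<in>A. W r i * W r j)" for i j
      by (rule sum.cong) (use insert.hyps in auto)
    then show ?thesis using insert.hyps W
      by (intro exI[of _ "W(a := (\<lambda>_. 0))"]) simp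
  next
    case False
    have "M a a \<ge> 0"
    proof -
      have "M i l * (if i = a then 1 else 0) * (if l = a then 1 else 0) = (if l = a then if i = a then M a a else 0 else 0)" for i l
        by simp
      then show ?thesis using psd[of "\<lambda>i. if i = a then 1 else 0"] by simp
    qed
    with False have pos: "M a a > 0" by simp
    \<comment> \<open>The Schur complement of the entry \<open>M a a\<close>.\<close>
    define M' where "M' i j = M i j - M a i * M a j / M a a" for i j
    have "\<exists>W. \<forall>i j. M' i j = (\<Sum>r\<in>A. W r i * W r j)"
    proof (rule insert.IH)
      show "M' i j = M' j i" for i j unfolding M'_def using sym[of i j] by simp
      show "M' i j = 0" if "i \<notin> A" for i j
      proof (cases "i = a")
        case True
        then show ?thesis unfolding M'_def using pos by simp
      next
        case False
        then have "M i j = 0" "M a i = 0" using supp[of i] that sym[of a i] by auto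
        then show ?thesis unfolding M'_def by simp
      qed
      show "0 \<le> (\<Sum>i\<in>UNIV. \<Sum>j\<in>UNIV. M' i j * w i * w j)" for w
      proof -
        define s where "s = (\<Sum>j\<in>UNIV. M a j * w j)"
        let ?q = "\<Sum>i\<in>UNIV. \<Sum>j\<in>UNIV. M i j * w i * w j"
        \<comment> \<open>The shift of the coordinate \<open>a\<close> that minimises the form; the
          minimum is the value of the Schur complement at \<open>w\<close>.\<close>
        have "0 \<le> ?q + 2 * (- s / M a a) * s + (- s / M a a) * (- s / M a a) * M a a"
          using psd[of "\<lambda>i. w i + (if i = a then - s / M a a else 0)"]
          unfolding quadratic_form_shift[OF sym] s_def[symmetric] .
        also have "\<dots> = ?q - s * s / M a a" using pos by (simp add: field_simps)
        also have "s * s / M a a = (\<Sum>i\<in>UNIV. \<Sum>j\<in>UNIV. M a i * M a j / M a a * w i * w j)"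
          unfolding s_def sum_product sum_divide_distrib by (simp add: mult_ac)
        also have "?q - \<dots> = (\<Sum>i\<in>UNIV. \<Sum>j\<in>UNIV. M' i j * w i * w j)"
          unfolding M'_def sum_subtractf[symmetric] by (simp add: algebra_simps)
        finally show ?thesis .
      qed
    qed
    then obtain W where W: "\<And>i j. M' i j = (\<Sum>r\<in>A. W r i * W r j)" by blast
    let ?W = "W(a := (\<lambda>i. M a i / sqrt (M a a)))"
    have "(\<Sum>r\<in>A. ?W r i * ?W r j) = M' i j" for i j
      unfolding W by (rule sum.cong) (use insert.hyps in auto)
    moreover have "sqrt (M a a) * sqrt (M a a) = M a a" using pos by simp
    ultimately have "M i j = (\<Sum>r\<in>insert a A. ?W r i * ?W r j)" for i j
      using insert.hyps pos by (simp add: M'_def)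
    then show ?thesis by blast
  qed
qed

lemma psd_factor:
  fixes M :: "'n::finite \<Rightarrow> 'n \<Rightarrow> real"
  assumes "\<And>i j. M i j = M j i" "\<And>w. 0 \<le> (\<Sum>i\<in>UNIV. \<Sum>j\<in>UNIV. M i j * w i * w j)"
  shows "\<exists>W :: 'n \<Rightarrow> 'n \<Rightarrow> real. \<forall>i j. M i j = (\<Sum>r\<in>UNIV. W r i * W r j)"
  using psd_factor_on[of UNIV M] assms by auto

text \<open>Factoring \<mu> times the identity separately from the semidefinite remainder puts
  multiples of the coordinate vectors among the rows of \<open>W\<close>. They make it possible to
  read off single components in \<open>tensor_form_lower\<close>.\<close>

lemma elliptic_factor:
  fixes M :: "'n::finite \<Rightarrow> 'n \<Rightarrow> real"
  assumes "\<And>i j. M i j = M j i" "0 \<le> \<mu>"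
    "\<And>w. \<mu> * (\<Sum>i\<in>UNIV. w i * w i) \<le> (\<Sum>i\<in>UNIV. \<Sum>j\<in>UNIV. M i j * w i * w j)"
  obtains W :: "'n + 'n \<Rightarrow> 'n \<Rightarrow> real" where "\<And>i j. M i j = (\<Sum>r\<in>UNIV. W r i * W r j)"
    "\<And>r i. W (Inl r) i = (if r = i then sqrt \<mu> else 0)"
proof -
  have e: "(\<Sum>i\<in>UNIV. \<Sum>j\<in>UNIV. (M i j - (if i = j then \<mu> else 0)) * w i * w j) =
      (\<Sum>i\<in>UNIV. \<Sum>j\<in>UNIV. M i j * w i * w j) - \<mu> * (\<Sum>i\<in>UNIV. w i * w i)" for w
  proof -
    have "(M i j - (if i = j then \<mu> else 0)) * w i * w j = M i j * w i * w j - (if i = j then \<mu> * (w i * w i) else 0)" for i j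
      by (simp add: algebra_simps)
    then show ?thesis by (simp add: sum_subtractf sum_distrib_left)
  qed
  define N where "N i j = M i j - (if i = j then \<mu> else 0)" for i j
  have sym: "N i j = N j i" for i j
    unfolding N_def using assms(1)[of i j] by simp
  have psd: "0 \<le> (\<Sum>i\<in>UNIV. \<Sum>j\<in>UNIV. N i j * w i * w j)" for w
    unfolding N_def e using assms(3)[of w] by simp
  have "\<exists>W :: 'n \<Rightarrow> 'n \<Rightarrow> real. \<forall>i j. N i j = (\<Sum>r\<in>UNIV. W r i * W r j)"
    using sym psd by (rule psd_factor)
  then obtain W :: "'n \<Rightarrow> 'n \<Rightarrow> real" where W: "\<forall>i j. N i j = (\<Sum>r\<in>UNIV. W r i * W r j)"
    by blast
  define W' where "W' r i = (case r of Inl r \<Rightarrow> (if r = i then sqrt \<mu> else 0) | Inr r \<Rightarrow> W r i)" for r :: "'n + 'n" and i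
  have "(\<Sum>r\<in>UNIV. W' r i * W' r j) = (\<Sum>r\<in>UNIV. W' (Inl r) i * W' (Inl r) j) + (\<Sum>r\<in>UNIV. W' (Inr r) i * W' (Inr r) j)" for i j
    unfolding UNIV_Plus_UNIV[symmetric] by (subst sum.Plus) (auto simp: o_def)
  moreover have "(\<Sum>r\<in>UNIV. W' (Inl r) i * W' (Inl r) j) = (if i = j then \<mu> else 0)" for i j
  proof -
    have "W' (Inl r) i * W' (Inl r) j = (if r = i then if i = j then \<mu> else 0 else 0)" for r
      unfolding W'_def using assms(2) by auto
    then show ?thesis by simp
  qed
  moreover have "(\<Sum>r\<in>UNIV. W' (Inr r) i * W' (Inr r) j) = M i j - (if i = j then \<mu> else 0)" for i j
    using W[rule_format, of i j] unfolding W'_def N_def by simp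
  ultimately have "M i j = (\<Sum>r\<in>UNIV. W' r i * W' r j)" for i j by simp
  moreover have "W' (Inl r) i = (if r = i then sqrt \<mu> else 0)" for r i unfolding W'_def by simp
  ultimately show ?thesis by (rule that)
qed

section \<open>Quadratic forms on tensors indexed by lists\<close>

lemma finite_lists_length [simp]: "finite {xs :: 'a::finite list. length xs = k}"
  using finite_lists_length_eq[of "UNIV :: 'a set" k] by simp

lemma sum_lists_Suc:
  "(\<Sum>is | length is = Suc k. f is) = (\<Sum>i\<in>UNIV. \<Sum>is | length is = k. f (i # is))"
  for f :: "'a::finite list \<Rightarrow> 'b::comm_monoid_add"
proof -
  have "(\<Sum>(i, is)\<in>UNIV \<times> {is. length is = k}. f (i # is)) = (\<Sum>is | length is = Suc k. f is)"
    by (rule sum.reindex_bij_witness[of _ "\<lambda>is. (hd is, tl is)" "\<lambda>(i, is). i # is"])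
      (auto simp: length_Suc_conv)
  then show ?thesis by (simp add: sum.cartesian_product)
qed

lemma prod_sum_lists:
  fixes F :: "nat \<Rightarrow> 'r::finite \<Rightarrow> real"
  shows "(\<Prod>a<k. \<Sum>r\<in>UNIV. F a r) = (\<Sum>rs | length rs = k. \<Prod>a<k. F a (rs ! a))"
proof (induction k arbitrary: F)
  case 0
  then show ?case by simp
next
  case (Suc k)
  have "(\<Prod>a<Suc k. \<Sum>r\<in>UNIV. F a r) = (\<Sum>r\<in>UNIV. F 0 r) * (\<Prod>a<k. \<Sum>r\<in>UNIV. F (Suc a) r)"
    by (subst prod.lessThan_Suc_shift) simp
  also have "\<dots> = (\<Sum>r\<in>UNIV. \<Sum>rs | length rs = k. F 0 r * (\<Prod>a<k. F (Suc a) (rs ! a)))"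
    unfolding Suc.IH by (simp add: sum_product)
  finally show ?case by (simp add: sum_lists_Suc prod.lessThan_Suc_shift del: prod.lessThan_Suc)
qed

text \<open>For \<open>M\<close> the inverse metric this is the squared norm of a covariant
  \<open>k\<close>-tensor; for \<open>M\<close> the coefficients of the equation and
  \<open>k = 2\<close> it measures the Hessian of ln v.\<close>

definition tensor_form :: "('n \<Rightarrow> 'n \<Rightarrow> real) \<Rightarrow> nat \<Rightarrow> ('n::finite list \<Rightarrow> real) \<Rightarrow> real" where
  "tensor_form M k T = (\<Sum>is | length is = k. \<Sum>js | length js = k. (\<Prod>a<k. M (is ! a) (js ! a)) * T is * T js)"

text \<open>Contracting every slot with rows of \<open>W\<close> diagonalises the form into a sum of
  squares, one for each list of rows.\<close>

lemma tensor_form_factor: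
  fixes W :: "'r::finite \<Rightarrow> 'n::finite \<Rightarrow> real"
  assumes "\<And>i j. M i j = (\<Sum>r\<in>UNIV. W r i * W r j)"
  shows "tensor_form M k T = (\<Sum>rs | length rs = k. (\<Sum>is | length is = k. (\<Prod>a<k. W (rs ! a) (is ! a)) * T is)\<^sup>2)"
proof -
  have "tensor_form M k T = (\<Sum>is | length is = k. \<Sum>js | length js = k. \<Sum>rs | length rs = k.
      ((\<Prod>a<k. W (rs ! a) (is ! a)) * T is) * ((\<Prod>a<k. W (rs ! a) (js ! a)) * T js))"
    unfolding tensor_form_def assms prod_sum_lists prod.distrib sum_distrib_right
    by (simp add: mult_ac)
  also have "\<dots> = (\<Sum>is | length is = k. \<Sum>rs | length rs = k. \<Sum>js | length js = k.
      ((\<Prod>a<k. W (rs ! a) (is ! a)) * T is) * ((\<Prod>a<k. W (rs ! a) (js ! a)) * T js))"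
    by (rule sum.cong[OF refl sum.swap])
  also have "\<dots> = (\<Sum>rs | length rs = k. \<Sum>is | length is = k. \<Sum>js | length js = k.
      ((\<Prod>a<k. W (rs ! a) (is ! a)) * T is) * ((\<Prod>a<k. W (rs ! a) (js ! a)) * T js))"
    by (rule sum.swap)
  finally show ?thesis unfolding power2_eq_square sum_product .
qed

lemma tensor_form_nonneg:
  fixes M :: "'n::finite \<Rightarrow> 'n \<Rightarrow> real"
  assumes "\<And>i j. M i j = M j i" "\<And>w. 0 \<le> (\<Sum>i\<in>UNIV. \<Sum>j\<in>UNIV. M i j * w i * w j)"
  shows "0 \<le> tensor_form M k T"
proof -
  obtain W :: "'n \<Rightarrow> 'n \<Rightarrow> real" where "\<And>i j. M i j = (\<Sum>r\<in>UNIV. W r i * W r j)"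
    using psd_factor[of M, OF assms] by blast
  then show ?thesis using tensor_form_factor[of M W k T] by (simp add: sum_nonneg)
qed

text \<open>Among the squares of \<open>tensor_form_factor\<close> the one for the rows
  \<open>Inl\<close> of \<open>ks\<close> is exactly the left-hand side; the others are
  nonnegative.\<close>

lemma tensor_form_lower:
  fixes M :: "'n::finite \<Rightarrow> 'n \<Rightarrow> real"
  assumes "\<And>i j. M i j = M j i" "0 \<le> \<mu>"
    "\<And>w. \<mu> * (\<Sum>i\<in>UNIV. w i * w i) \<le> (\<Sum>i\<in>UNIV. \<Sum>j\<in>UNIV. M i j * w i * w j)"
    and len: "length ks = k"
  shows "\<mu> ^ k * (T ks)\<^sup>2 \<le> tensor_form M k T"
proof -
  obtain W :: "'n + 'n \<Rightarrow> 'n \<Rightarrow> real" where W: "\<And>i j. M i j = (\<Sum>r\<in>UNIV. W r i * W r j)"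
    "\<And>r i. W (Inl r) i = (if r = i then sqrt \<mu> else 0)"
    using elliptic_factor[OF assms(1-3)] by metis
  define S where "S rs = (\<Sum>is | length is = k. (\<Prod>a<k. W (rs ! a) (is ! a)) * T is)" for rs
  let ?rs = "map Inl ks :: ('n + 'n) list"
  have "(\<Prod>a<k. W (?rs ! a) (is ! a)) = (if is = ks then sqrt \<mu> ^ k else 0)" if l: "length is = k" for "is"
  proof (cases "is = ks")
    case True
    then show ?thesis using len by (simp add: W(2))
  next
    case False
    then obtain a where "a < k" "is ! a \<noteq> ks ! a" using l len nth_equalityI by metis
    then have "W (?rs ! a) (is ! a) = 0" using len by (simp add: W(2))
    then show ?thesis using False \<open>a < k\<close> by (auto intro!: prod_zero)
  qed
  then have "S ?rs = (\<Sum>is | length is = k. (if is = ks then sqrt \<mu> ^ k * T is else 0))"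
    unfolding S_def by (intro sum.cong) auto
  also have "\<dots> = sqrt \<mu> ^ k * T ks" using len by (simp add: sum.delta)
  finally have "(S ?rs)\<^sup>2 = \<mu> ^ k * (T ks)\<^sup>2"
    using assms(2) by (simp add: power_mult_distrib power_mult[symmetric] mult.commute[of k] power_mult[of "sqrt \<mu>" 2 k])
  moreover have "(S ?rs)\<^sup>2 \<le> (\<Sum>rs | length rs = k. (S rs)\<^sup>2)"
    by (rule member_le_sum) (use len in auto)
  ultimately show ?thesis unfolding tensor_form_factor[of M W, OF W(1)] S_def by simp
qed

text \<open>Chart independence of tensor norms: \<open>T'\<close> is the pullback of
  \<open>T\<close> by \<open>J\<close>, while \<open>M\<close> is the push-forward of
  \<open>M'\<close>, so the factors \<open>J\<close> match up slot by slot.\<close>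

lemma tensor_form_transform:
  fixes J :: "'n::finite \<Rightarrow> 'n \<Rightarrow> real"
  assumes "\<And>k l. M k l = (\<Sum>i\<in>UNIV. \<Sum>j\<in>UNIV. J k i * M' i j * J l j)"
    and "\<And>is. length is = k \<Longrightarrow> T' is = (\<Sum>ks | length ks = k. (\<Prod>a<k. J (ks ! a) (is ! a)) * T ks)"
  shows "tensor_form M' k T' = tensor_form M k T"
proof -
  let ?L = "{is :: 'n list. length is = k}"
  have P: "(\<Prod>a<k. M (ks ! a) (ls ! a)) = (\<Sum>is\<in>?L. \<Sum>js\<in>?L.
      (\<Prod>a<k. J (ks ! a) (is ! a)) * (\<Prod>a<k. M' (is ! a) (js ! a)) * (\<Prod>a<k. J (ls ! a) (js ! a)))" for ks ls :: "'n list"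
    unfolding assms(1) prod_sum_lists
    by (simp add: prod_sum_lists prod.distrib)
  have "tensor_form M k T = (\<Sum>ks\<in>?L. \<Sum>ls\<in>?L. \<Sum>is\<in>?L. \<Sum>js\<in>?L.
      ((\<Prod>a<k. J (ks ! a) (is ! a)) * T ks) * ((\<Prod>a<k. J (ls ! a) (js ! a)) * T ls) * (\<Prod>a<k. M' (is ! a) (js ! a)))"
    unfolding tensor_form_def P sum_distrib_right by (simp add: mult_ac)
  also have "\<dots> = (\<Sum>ks\<in>?L. \<Sum>is\<in>?L. \<Sum>ls\<in>?L. \<Sum>js\<in>?L.
      ((\<Prod>a<k. J (ks ! a) (is ! a)) * T ks) * ((\<Prod>a<k. J (ls ! a) (js ! a)) * T ls) * (\<Prod>a<k. M' (is ! a) (js ! a)))"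
    by (rule sum.cong[OF refl sum.swap])
  also have "\<dots> = (\<Sum>is\<in>?L. \<Sum>ks\<in>?L. \<Sum>ls\<in>?L. \<Sum>js\<in>?L.
      ((\<Prod>a<k. J (ks ! a) (is ! a)) * T ks) * ((\<Prod>a<k. J (ls ! a) (js ! a)) * T ls) * (\<Prod>a<k. M' (is ! a) (js ! a)))"
    by (rule sum.swap)
  also have "\<dots> = (\<Sum>is\<in>?L. \<Sum>ks\<in>?L. \<Sum>js\<in>?L. \<Sum>ls\<in>?L.
      ((\<Prod>a<k. J (ks ! a) (is ! a)) * T ks) * ((\<Prod>a<k. J (ls ! a) (js ! a)) * T ls) * (\<Prod>a<k. M' (is ! a) (js ! a)))"
    by (rule sum.cong[OF refl], rule sum.cong[OF refl sum.swap])
  also have "\<dots> = (\<Sum>is\<in>?L. \<Sum>js\<in>?L. \<Sum>ks\<in>?L. \<Sum>ls\<in>?L.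
      ((\<Prod>a<k. J (ks ! a) (is ! a)) * T ks) * ((\<Prod>a<k. J (ls ! a) (js ! a)) * T ls) * (\<Prod>a<k. M' (is ! a) (js ! a)))"
    by (rule sum.cong[OF refl sum.swap])
  also have "\<dots> = (\<Sum>is\<in>?L. \<Sum>js\<in>?L. T' is * T' js * (\<Prod>a<k. M' (is ! a) (js ! a)))"
  proof (intro sum.cong refl)
    fix "is" js assume "is \<in> ?L" "js \<in> ?L"
    then have l: "length is = k" "length js = k" by auto
    show "(\<Sum>ks\<in>?L. \<Sum>ls\<in>?L. ((\<Prod>a<k. J (ks ! a) (is ! a)) * T ks) * ((\<Prod>a<k. J (ls ! a) (js ! a)) * T ls)
        * (\<Prod>a<k. M' (is ! a) (js ! a))) = T' is * T' js * (\<Prod>a<k. M' (is ! a) (js ! a))"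
      unfolding assms(2)[OF l(1)] assms(2)[OF l(2)] sum_product by (simp only: sum_distrib_right)
  qed
  finally show ?thesis unfolding tensor_form_def by (simp add: mult_ac)
qed

lemma tensor_norm_sq_form:
  "tensor_norm_sq G k T y = tensor_form (\<lambda>i j. matrix_inv (G y) $ i $ j) k (\<lambda>is. T is y)"
  unfolding tensor_norm_sq_def tensor_form_def ..

text \<open>A pulled back metric has an inverse that is pushed forward. Invertibility of
  \<open>J\<close> follows from that of the pulled back metric.\<close>

lemma congruence_matrix_inv:
  fixes G G' J :: "real^'n^'n::finite"
  assumes G': "G' = transpose J ** G ** J" and "det G' \<noteq> 0" "det G \<noteq> 0"
  shows "matrix_inv G = J ** matrix_inv G' ** transpose J"
proof -
  have "det G' = det J * det G * det J" unfolding G' by (simp add: det_mul det_transpose)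
  then have dJ: "det J \<noteq> 0" using assms(2) by auto
  let ?X = "J ** matrix_inv G' ** transpose J"
  have "?X ** G ** J = J ** (matrix_inv G' ** (transpose J ** G ** J))"
    by (simp add: matrix_mul_assoc)
  also have "\<dots> = J" unfolding G'[symmetric] by (simp add: matrix_inv_left assms(2))
  finally have XJ: "?X ** G ** J = J" .
  have "?X ** G = ?X ** G ** (J ** matrix_inv J)" by (simp add: matrix_inv_right dJ)
  also have "\<dots> = (?X ** G ** J) ** matrix_inv J" by (simp add: matrix_mul_assoc)
  also have "\<dots> = mat 1" unfolding XJ by (simp add: matrix_inv_right dJ)
  finally have XG: "?X ** G = mat 1" .
  have "?X = ?X ** (G ** matrix_inv G)" by (simp add: matrix_inv_right assms)
  also have "\<dots> = (?X ** G) ** matrix_inv G" by (simp add: matrix_mul_assoc)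
  also have "\<dots> = matrix_inv G" unfolding XG by simp
  finally show ?thesis by simp
qed

section \<open>Change of coordinates\<close>

lemma pderiv_at_dd: "pderiv_at i f y = dd (axis i 1) f y"
  unfolding pderiv_at_def dd_def ..

lemma sum_rotate:
  "(\<Sum>p\<in>A. \<Sum>q\<in>B. \<Sum>r\<in>C. f p q r) = (\<Sum>q\<in>B. \<Sum>r\<in>C. \<Sum>p\<in>A. f p q r)"
proof -
  have "(\<Sum>p\<in>A. \<Sum>q\<in>B. \<Sum>r\<in>C. f p q r) = (\<Sum>q\<in>B. \<Sum>p\<in>A. \<Sum>r\<in>C. f p q r)" by (rule sum.swap)
  also have "\<dots> = (\<Sum>q\<in>B. \<Sum>r\<in>C. \<Sum>p\<in>A. f p q r)" by (rule sum.cong[OF refl sum.swap])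
  finally show ?thesis .
qed

lemma smooth_on_vec_nth: "open S \<Longrightarrow> smooth_on S f \<Longrightarrow> smooth_on S (\<lambda>x. f x $ i)"
  by (rule smooth_on_linear[OF _ bounded_linear_vec_nth])

lemma dd_chain:
  fixes f :: "real^'n::finite \<Rightarrow> 'f::real_normed_vector" and \<Phi> :: "real^'n \<Rightarrow> real^'n"
  assumes "\<Phi> differentiable at y" "f differentiable at (\<Phi> y)"
  shows "(\<lambda>z. f (\<Phi> z)) differentiable at y"
    and "dd w (\<lambda>z. f (\<Phi> z)) y = (\<Sum>p\<in>UNIV. dd w (\<lambda>z. \<Phi> z $ p) y *\<^sub>R dd (axis p 1) f (\<Phi> y))"
proof -
  have *: "((f \<circ> \<Phi>) has_derivative ((\<lambda>b. dd b f (\<Phi> y)) \<circ> (\<lambda>b. dd b \<Phi> y))) (at y)"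
    by (intro diff_chain_at dd_has_derivative assms)
  then show "(\<lambda>z. f (\<Phi> z)) differentiable at y" unfolding differentiable_def o_def by blast
  have "dd w \<Phi> y = (\<Sum>p\<in>UNIV. (dd w \<Phi> y $ p) *\<^sub>R axis p 1)"
    by (simp add: vec_eq_iff axis_def if_distrib cong: if_cong)
  moreover have "dd w \<Phi> y $ p = dd w (\<lambda>z. \<Phi> z $ p) y" for p
    using dd_linear[OF bounded_linear_vec_nth assms(1)] by metis
  ultimately have w: "dd w \<Phi> y = (\<Sum>p\<in>UNIV. dd w (\<lambda>z. \<Phi> z $ p) y *\<^sub>R axis p 1)" by simp
  interpret linear "\<lambda>b. dd b f (\<Phi> y)" by (rule linear_dd[OF assms(2)])
  have "dd w (\<lambda>z. f (\<Phi> z)) y = dd (dd w \<Phi> y) f (\<Phi> y)"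
    using dd_eqI[OF *, of w] by (simp add: o_def)
  also have "\<dots> = (\<Sum>p\<in>UNIV. dd w (\<lambda>z. \<Phi> z $ p) y *\<^sub>R dd (axis p 1) f (\<Phi> y))"
    unfolding w by (simp add: sum scaleR)
  finally show "dd w (\<lambda>z. f (\<Phi> z)) y = (\<Sum>p\<in>UNIV. dd w (\<lambda>z. \<Phi> z $ p) y *\<^sub>R dd (axis p 1) f (\<Phi> y))" .
qed

lemma dd_prod:
  fixes f :: "'i \<Rightarrow> 'e::real_normed_vector \<Rightarrow> real"
  assumes "\<And>i. i \<in> I \<Longrightarrow> f i differentiable at x"
  shows "(\<lambda>x. \<Prod>i\<in>I. f i x) differentiable at x"
    and "dd b (\<lambda>x. \<Prod>i\<in>I. f i x) x = (\<Sum>i\<in>I. dd b (f i) x * (\<Prod>j\<in>I - {i}. f j x))"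
proof -
  have *: "((\<lambda>x. \<Prod>i\<in>I. f i x) has_derivative (\<lambda>b. \<Sum>i\<in>I. dd b (f i) x * (\<Prod>j\<in>I - {i}. f j x))) (at x)"
    by (rule has_derivative_prod) (use assms dd_has_derivative in blast)
  then show "(\<lambda>x. \<Prod>i\<in>I. f i x) differentiable at x" unfolding differentiable_def by blast
  show "dd b (\<lambda>x. \<Prod>i\<in>I. f i x) x = (\<Sum>i\<in>I. dd b (f i) x * (\<Prod>j\<in>I - {i}. f j x))"
    using dd_eqI[OF *] .
qed

text \<open>\<open>G'\<close> is the pullback of \<open>G\<close> under the change of coordinates
  \<Phi>; invertibility of the Jacobian is a consequence of \<open>det_G'\<close> and
  \<open>metric_change\<close>. The locale isolates the tensor calculus from charts and
  manifolds.\<close>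

locale coord_change =
  fixes U V :: "(real^'n::finite) set" and \<Phi> :: "real^'n \<Rightarrow> real^'n"
    and G G' :: "real^'n \<Rightarrow> real^'n^'n"
  assumes open_U: "open U" and open_V: "open V" and \<Phi>_V: "y \<in> U \<Longrightarrow> \<Phi> y \<in> V"
    and smooth_\<Phi>: "smooth_on U \<Phi>"
    and smooth_G: "smooth_on V (\<lambda>y. G y $ i $ j)"
    and sym_G: "y \<in> V \<Longrightarrow> G y $ i $ j = G y $ j $ i"
    and det_G: "y \<in> V \<Longrightarrow> det (G y) \<noteq> 0" and det_G': "y \<in> U \<Longrightarrow> det (G' y) \<noteq> 0"
    and metric_change: "y \<in> U \<Longrightarrow> G' y $ i $ j =
      (\<Sum>k\<in>UNIV. \<Sum>l\<in>UNIV. pderiv_at i (\<lambda>z. \<Phi> z $ k) y * pderiv_at j (\<lambda>z. \<Phi> z $ l) y * G (\<Phi> y) $ k $ l)"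
begin

definition J :: "'n \<Rightarrow> 'n \<Rightarrow> real^'n \<Rightarrow> real" where
  "J k i y = pderiv_at i (\<lambda>z. \<Phi> z $ k) y"

lemma J_eq: "J k i = dd (axis i 1) (\<lambda>z. \<Phi> z $ k)"
  unfolding J_def pderiv_at_dd ..

lemma smooth_J: "smooth_on U (J k i)"
  unfolding J_eq by (intro smooth_on_dd smooth_on_vec_nth open_U smooth_\<Phi>)

lemma diff_J: "y \<in> U \<Longrightarrow> J k i differentiable at y"
  using smooth_on_differentiable[OF open_U smooth_J] .

lemma J_commute: "y \<in> U \<Longrightarrow> pderiv_at i (J k j) y = pderiv_at j (J k i) y"
  unfolding pderiv_at_dd J_eq by (intro dd_commute[OF open_U] smooth_on_vec_nth open_U smooth_\<Phi>)

lemma chain: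
  assumes "y \<in> U" "f differentiable at (\<Phi> y)"
  shows "(\<lambda>z. f (\<Phi> z)) differentiable at y"
    and "pderiv_at i (\<lambda>z. f (\<Phi> z)) y = (\<Sum>p\<in>UNIV. J p i y * pderiv_at p f (\<Phi> y))"
  using dd_chain[OF smooth_on_differentiable[OF open_U smooth_\<Phi> assms(1)] assms(2)]
  unfolding pderiv_at_dd J_eq by auto

lemma metric_change_J: "y \<in> U \<Longrightarrow> G' y $ i $ j =
    (\<Sum>k\<in>UNIV. \<Sum>l\<in>UNIV. J k i y * J l j y * G (\<Phi> y) $ k $ l)"
  unfolding J_def by (rule metric_change)

lemma congruence_inv:
  assumes "det N \<noteq> 0" "det N' \<noteq> 0"
    "\<And>i j. N' $ i $ j = (\<Sum>k\<in>UNIV. \<Sum>l\<in>UNIV. J k i y * J l j y * N $ k $ l)"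
  shows "matrix_inv N $ k $ l = (\<Sum>i\<in>UNIV. \<Sum>j\<in>UNIV. J k i y * matrix_inv N' $ i $ j * J l j y)"
proof -
  let ?J = "\<chi> k i. J k i y"
  have "N' = transpose ?J ** N ** ?J"
  proof -
    have "(\<Sum>k\<in>UNIV. \<Sum>l\<in>UNIV. J k i y * J l j y * N $ k $ l) =
        (\<Sum>l\<in>UNIV. (\<Sum>k\<in>UNIV. J k i y * N $ k $ l) * J l j y)" for i j
      by (subst sum.swap) (simp add: sum_distrib_right sum_distrib_left mult_ac)
    then show ?thesis by (simp add: vec_eq_iff assms(3) matrix_matrix_mult_def transpose_def)
  qed
  from congruence_matrix_inv[OF this assms(2,1)]
  have "matrix_inv N = ?J ** matrix_inv N' ** transpose ?J" .
  then have "matrix_inv N $ k $ l = (?J ** matrix_inv N' ** transpose ?J) $ k $ l" by (rule arg_cong)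
  also have "\<dots> = (\<Sum>j\<in>UNIV. \<Sum>i\<in>UNIV. J k i y * matrix_inv N' $ i $ j * J l j y)"
    by (simp add: matrix_matrix_mult_def transpose_def sum_distrib_right)
  finally show ?thesis by (subst sum.swap)
qed

lemma metric_inv: "y \<in> U \<Longrightarrow> matrix_inv (G (\<Phi> y)) $ k $ l =
    (\<Sum>i\<in>UNIV. \<Sum>j\<in>UNIV. J k i y * matrix_inv (G' y) $ i $ j * J l j y)"
  by (rule congruence_inv) (simp_all add: det_G det_G' \<Phi>_V metric_change_J)

text \<open>The inhomogeneous transformation law of the Levi-Civita connection. In the derivative of
  the pulled back metric, \<open>S\<close> collects the second derivatives of \<Phi> and
  \<open>D\<close> the derivatives of the metric.\<close>

lemma christoffel_change:
  assumes y: "y \<in> U"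
  shows "(\<Sum>m\<in>UNIV. christoffel G' m i j y * J k m y) =
    pderiv_at i (J k j) y + (\<Sum>a\<in>UNIV. \<Sum>b\<in>UNIV. christoffel G k a b (\<Phi> y) * J a i y * J b j y)"
proof -
  define g where "g p q = G (\<Phi> y) $ p $ q" for p q
  define dg where "dg r p q = pderiv_at r (\<lambda>z. G z $ p $ q) (\<Phi> y)" for r p q
  define A where "A i p j = pderiv_at i (J p j) y" for i p j
  define j' where "j' p i = J p i y" for p i
  define S where "S i j l = (\<Sum>p\<in>UNIV. \<Sum>q\<in>UNIV. A i p j * j' q l * g p q)" for i j l
  define D where "D i j l = (\<Sum>p\<in>UNIV. \<Sum>q\<in>UNIV. j' p j * j' q l * (\<Sum>r\<in>UNIV. j' r i * dg r p q))" for i j l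
  define K where "K a b q = dg a b q + dg b a q - dg q a b" for a b q
  define E where "E q = 2 * (\<Sum>p\<in>UNIV. A i p j * g p q) + (\<Sum>a\<in>UNIV. \<Sum>b\<in>UNIV. j' a i * j' b j * K a b q)" for q
  define gi where "gi p q = matrix_inv (G (\<Phi> y)) $ p $ q" for p q
  have delta: "(\<Sum>q\<in>UNIV. gi k q * g q p) = (if k = p then 1 else 0)" for p
  proof -
    have "(matrix_inv (G (\<Phi> y)) ** G (\<Phi> y)) $ k $ p = mat 1 $ k $ p"
      using matrix_inv_left[OF det_G[OF \<Phi>_V[OF y]]] by simp
    then show ?thesis unfolding gi_def g_def by (simp add: matrix_matrix_mult_def mat_def)
  qed
  have gsym: "g p q = g q p" for p q unfolding g_def using sym_G[OF \<Phi>_V[OF y]] .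
  have dG: "(\<lambda>z. G z $ p $ q) differentiable at (\<Phi> y)" for p q
    by (rule smooth_on_differentiable[OF open_V smooth_G \<Phi>_V[OF y]])
  have Asym: "A i p j = A j p i" for i p j unfolding A_def by (rule J_commute[OF y])
  have S2: "(\<Sum>p\<in>UNIV. \<Sum>q\<in>UNIV. j' p j * A i q l * g p q) = S i l j" for i j l
    unfolding S_def by (subst sum.swap) (simp add: mult_ac gsym)
  have Ssym: "S i j l = S j i l" for i j l unfolding S_def using Asym by simp
  have dG': "pderiv_at i (\<lambda>z. G' z $ j $ l) y = S i j l + S i l j + D i j l" for i j l
  proof -
    have "pderiv_at i (\<lambda>z. G' z $ j $ l) y =
        pderiv_at i (\<lambda>z. \<Sum>p\<in>UNIV. \<Sum>q\<in>UNIV. J p j z * J q l z * G (\<Phi> z) $ p $ q) y"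
      unfolding pderiv_at_dd by (rule dd_cong_open[OF open_U y]) (rule metric_change_J)
    also have "\<dots> = (\<Sum>p\<in>UNIV. \<Sum>q\<in>UNIV. J p j y * J q l y * pderiv_at i (\<lambda>z. G (\<Phi> z) $ p $ q) y +
        (J p j y * pderiv_at i (J q l) y + pderiv_at i (J p j) y * J q l y) * G (\<Phi> y) $ p $ q)"
      unfolding pderiv_at_dd
      by (simp add: dd_sum dd_mult diff_J[OF y] chain(1)[OF y dG] differentiable_mult differentiable_sum)
    also have "\<dots> = (\<Sum>p\<in>UNIV. \<Sum>q\<in>UNIV. j' p j * j' q l * (\<Sum>r\<in>UNIV. j' r i * dg r p q) +
        (j' p j * A i q l * g p q + A i p j * j' q l * g p q))"
      unfolding chain(2)[OF y dG] j'_def dg_def A_def g_def by (simp add: algebra_simps)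
    also have "\<dots> = D i j l + (S i l j + S i j l)"
      unfolding sum.distrib S2 unfolding D_def S_def ..
    finally show ?thesis by simp
  qed
  have D1: "D i j l = (\<Sum>q\<in>UNIV. j' q l * (\<Sum>a\<in>UNIV. \<Sum>b\<in>UNIV. j' a i * j' b j * dg a b q))" for i j l
  proof -
    have "D i j l = (\<Sum>p\<in>UNIV. \<Sum>q\<in>UNIV. \<Sum>r\<in>UNIV. j' p j * j' q l * j' r i * dg r p q)"
      unfolding D_def by (simp add: sum_distrib_left mult_ac)
    also have "\<dots> = (\<Sum>q\<in>UNIV. \<Sum>r\<in>UNIV. \<Sum>p\<in>UNIV. j' p j * j' q l * j' r i * dg r p q)"
      by (rule sum_rotate)
    finally show ?thesis by (simp add: sum_distrib_left mult_ac)
  qed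
  have D2: "D j i l = (\<Sum>q\<in>UNIV. j' q l * (\<Sum>a\<in>UNIV. \<Sum>b\<in>UNIV. j' a i * j' b j * dg b a q))" for i j l
  proof -
    have "D j i l = (\<Sum>p\<in>UNIV. \<Sum>q\<in>UNIV. \<Sum>r\<in>UNIV. j' p i * j' q l * j' r j * dg r p q)"
      unfolding D_def by (simp add: sum_distrib_left mult_ac)
    also have "\<dots> = (\<Sum>q\<in>UNIV. \<Sum>p\<in>UNIV. \<Sum>r\<in>UNIV. j' p i * j' q l * j' r j * dg r p q)"
      by (rule sum.swap)
    finally show ?thesis by (simp add: sum_distrib_left mult_ac)
  qed
  have D3: "D l i j = (\<Sum>q\<in>UNIV. j' q l * (\<Sum>a\<in>UNIV. \<Sum>b\<in>UNIV. j' a i * j' b j * dg q a b))" for i j l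
  proof -
    have "D l i j = (\<Sum>p\<in>UNIV. \<Sum>q\<in>UNIV. \<Sum>r\<in>UNIV. j' p i * j' q j * j' r l * dg r p q)"
      unfolding D_def by (simp add: sum_distrib_left mult_ac)
    also have "\<dots> = (\<Sum>r\<in>UNIV. \<Sum>p\<in>UNIV. \<Sum>q\<in>UNIV. j' p i * j' q j * j' r l * dg r p q)"
      by (rule sum_rotate[symmetric])
    finally show ?thesis by (simp add: sum_distrib_left mult_ac)
  qed
  have S1: "2 * S i j l = (\<Sum>q\<in>UNIV. j' q l * (2 * (\<Sum>p\<in>UNIV. A i p j * g p q)))" for l
    unfolding S_def by (subst sum.swap) (simp add: sum_distrib_left mult_ac)
  have K': "pderiv_at i (\<lambda>z. G' z $ j $ l) y + pderiv_at j (\<lambda>z. G' z $ i $ l) y - pderiv_at l (\<lambda>z. G' z $ i $ j) y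
      = (\<Sum>q\<in>UNIV. j' q l * E q)" for l
  proof -
    have "D i j l + D j i l - D l i j = (\<Sum>q\<in>UNIV. j' q l * (\<Sum>a\<in>UNIV. \<Sum>b\<in>UNIV. j' a i * j' b j * K a b q))"
      unfolding D1[of i j l] D2[of j i l] D3[of l i j] K_def
      by (simp add: algebra_simps sum.distrib sum_subtractf)
    \<comment> \<open>\<open>S\<close> is symmetric in its first two arguments because the
      derivatives of \<Phi> commute, so four of the six terms cancel in pairs.\<close>
    moreover have "S i j l + S i l j + (S j i l + S j l i) - (S l i j + S l j i) = 2 * S i j l"
      using Ssym[of i l j] Ssym[of j l i] Ssym[of i j l] by simp
    ultimately show ?thesis unfolding dG' E_def using S1[of l] by (simp add: distrib_left sum.distrib)
  qed
  have "(\<Sum>m\<in>UNIV. christoffel G' m i j y * J k m y) =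
      (\<Sum>m\<in>UNIV. \<Sum>l\<in>UNIV. \<Sum>q\<in>UNIV. 1/2 * (J k m y * matrix_inv (G' y) $ m $ l * J q l y) * E q)"
    unfolding christoffel_def K' by (simp add: sum_distrib_left sum_distrib_right j'_def mult_ac)
  also have "\<dots> = (\<Sum>q\<in>UNIV. \<Sum>m\<in>UNIV. \<Sum>l\<in>UNIV. 1/2 * (J k m y * matrix_inv (G' y) $ m $ l * J q l y) * E q)"
    by (rule sum_rotate[symmetric])
  also have "\<dots> = (\<Sum>q\<in>UNIV. 1/2 * gi k q * E q)"
    unfolding gi_def metric_inv[OF y] by (simp add: sum_distrib_left sum_distrib_right)
  also have "\<dots> = (\<Sum>q\<in>UNIV. \<Sum>p\<in>UNIV. A i p j * (gi k q * g q p)) +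
      (\<Sum>q\<in>UNIV. \<Sum>a\<in>UNIV. \<Sum>b\<in>UNIV. 1/2 * (gi k q * K a b q) * j' a i * j' b j)"
    unfolding E_def by (simp add: distrib_left sum.distrib sum_distrib_left mult_ac gsym)
  also have "(\<Sum>q\<in>UNIV. \<Sum>p\<in>UNIV. A i p j * (gi k q * g q p)) = (\<Sum>p\<in>UNIV. A i p j * (\<Sum>q\<in>UNIV. gi k q * g q p))"
    by (subst sum.swap) (simp add: sum_distrib_left)
  also have "\<dots> = A i k j" by (simp add: delta if_distrib cong: if_cong)
  also have "(\<Sum>q\<in>UNIV. \<Sum>a\<in>UNIV. \<Sum>b\<in>UNIV. 1/2 * (gi k q * K a b q) * j' a i * j' b j) =
      (\<Sum>a\<in>UNIV. \<Sum>b\<in>UNIV. \<Sum>q\<in>UNIV. 1/2 * (gi k q * K a b q) * j' a i * j' b j)"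
    by (rule sum_rotate)
  also have "\<dots> = (\<Sum>a\<in>UNIV. \<Sum>b\<in>UNIV. christoffel G k a b (\<Phi> y) * J a i y * J b j y)"
    unfolding christoffel_def gi_def K_def dg_def j'_def by (simp add: sum_distrib_left sum_distrib_right mult_ac)
  finally show ?thesis by (simp add: A_def)
qed

definition tensor_related :: "nat \<Rightarrow> ('n list \<Rightarrow> real^'n \<Rightarrow> real) \<Rightarrow> ('n list \<Rightarrow> real^'n \<Rightarrow> real) \<Rightarrow> bool" where
  "tensor_related k T' T \<longleftrightarrow> (\<forall>y\<in>U. \<forall>is. length is = k \<longrightarrow>
     T' is y = (\<Sum>ks | length ks = k. (\<Prod>a<k. J (ks ! a) (is ! a) y) * T ks (\<Phi> y)))"

lemma tensor_relatedD: "tensor_related k T' T \<Longrightarrow> y \<in> U \<Longrightarrow> length is = k \<Longrightarrow>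
     T' is y = (\<Sum>ks | length ks = k. (\<Prod>a<k. J (ks ! a) (is ! a) y) * T ks (\<Phi> y))"
  unfolding tensor_related_def by blast

text \<open>Tensoriality of the covariant derivative: the second derivatives of \<Phi> that arise
  from differentiating the Jacobian factors cancel against the inhomogeneous part of the Christoffel
  symbols, slot by slot.\<close>

lemma cov_deriv_related:
  assumes rel: "tensor_related k T' T"
    and dT: "\<And>ks y. length ks = k \<Longrightarrow> y \<in> V \<Longrightarrow> T ks differentiable at y"
  shows "tensor_related (Suc k) (cov_deriv G' T') (cov_deriv G T)"
  unfolding tensor_related_def
proof (intro ballI allI impI)
  fix y and iis :: "'n list"
  assume y: "y \<in> U" and "length iis = Suc k"
  then obtain i "is" where iis: "iis = i # is" and len: "length is = k" by (auto simp: length_Suc_conv)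
  let ?L = "{ks :: 'n list. length ks = k}"
  define R where "R a ks = (\<Prod>b\<in>{..<k} - {a}. J (ks ! b) (is ! b) y)" for a ks
  define P where "P ks = (\<Prod>b<k. J (ks ! b) (is ! b) y)" for ks
  define C where "C m p q = christoffel G m p q (\<Phi> y)" for m p q
  have PR: "P ks = J (ks ! a) (is ! a) y * R a ks" if "a < k" for a ks
    unfolding P_def R_def using that by (subst prod.remove[of _ a]) auto
  have dTk: "T ks differentiable at (\<Phi> y)" if "length ks = k" for ks
    using dT[OF that \<Phi>_V[OF y]] .
  have 1: "pderiv_at i (T' is) y = (\<Sum>ks\<in>?L. P ks * (\<Sum>p\<in>UNIV. J p i y * pderiv_at p (T ks) (\<Phi> y))
      + (\<Sum>a<k. pderiv_at i (J (ks ! a) (is ! a)) y * R a ks) * T ks (\<Phi> y))"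
  proof -
    have "pderiv_at i (T' is) y = pderiv_at i (\<lambda>z. \<Sum>ks\<in>?L. (\<Prod>a<k. J (ks ! a) (is ! a) z) * T ks (\<Phi> z)) y"
      unfolding pderiv_at_dd by (rule dd_cong_open[OF open_U y]) (rule tensor_relatedD[OF rel _ len])
    also have "\<dots> = (\<Sum>ks\<in>?L. pderiv_at i (\<lambda>z. (\<Prod>a<k. J (ks ! a) (is ! a) z) * T ks (\<Phi> z)) y)"
      unfolding pderiv_at_dd
      by (rule dd_sum) (intro differentiable_mult dd_prod(1) diff_J[OF y] chain(1)[OF y dTk], simp)
    also have "\<dots> = (\<Sum>ks\<in>?L. P ks * pderiv_at i (\<lambda>z. T ks (\<Phi> z)) y
      + (\<Sum>a<k. pderiv_at i (J (ks ! a) (is ! a)) y * R a ks) * T ks (\<Phi> y))"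
      unfolding pderiv_at_dd P_def R_def
      by (intro sum.cong refl) (simp add: dd_mult dd_prod diff_J[OF y] chain(1)[OF y dTk])
    finally show ?thesis by (simp add: chain(2)[OF y dTk])
  qed
  have upd: "(\<Sum>m\<in>UNIV. christoffel G' m i (is ! a) y * T' (is[a := m]) y) =
      (\<Sum>ks\<in>?L. pderiv_at i (J (ks ! a) (is ! a)) y * R a ks * T ks (\<Phi> y)) +
      (\<Sum>ks\<in>?L. \<Sum>p\<in>UNIV. \<Sum>q\<in>UNIV. C (ks ! a) p q * J p i y * J q (is ! a) y * R a ks * T ks (\<Phi> y))"
    if a: "a < k" for a
  proof -
    have Tm: "T' (is[a := m]) y = (\<Sum>ks\<in>?L. J (ks ! a) m y * R a ks * T ks (\<Phi> y))" for m
    proof -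
      have "(\<Prod>b<k. J (ks ! b) (is[a := m] ! b) y) = J (ks ! a) m y * R a ks" for ks
      proof -
        have "(\<Prod>b<k. J (ks ! b) (is[a := m] ! b) y) =
            J (ks ! a) (is[a := m] ! a) y * (\<Prod>b\<in>{..<k} - {a}. J (ks ! b) (is[a := m] ! b) y)"
          using a by (subst prod.remove[of _ a]) auto
        also have "(\<Prod>b\<in>{..<k} - {a}. J (ks ! b) (is[a := m] ! b) y) = R a ks"
          unfolding R_def by (rule prod.cong) auto
        finally show ?thesis using a len by simp
      qed
      then show ?thesis using tensor_relatedD[OF rel y, of "is[a := m]"] len by simp
    qed
    have "(\<Sum>m\<in>UNIV. christoffel G' m i (is ! a) y * T' (is[a := m]) y) =
        (\<Sum>ks\<in>?L. (\<Sum>m\<in>UNIV. christoffel G' m i (is ! a) y * J (ks ! a) m y) * R a ks * T ks (\<Phi> y))"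
      unfolding Tm sum_distrib_left sum_distrib_right by (subst sum.swap) (simp add: mult_ac)
    also have "\<dots> = (\<Sum>ks\<in>?L. pderiv_at i (J (ks ! a) (is ! a)) y * R a ks * T ks (\<Phi> y) +
      (\<Sum>p\<in>UNIV. \<Sum>q\<in>UNIV. C (ks ! a) p q * J p i y * J q (is ! a) y * R a ks * T ks (\<Phi> y)))"
      unfolding christoffel_change[OF y] C_def by (simp add: distrib_right sum_distrib_right)
    finally show ?thesis by (simp add: sum.distrib)
  qed
  \<comment> \<open>Exchanging the entry of \<open>ks\<close> at position \<open>a\<close> with the
    free index is an involution on the pairs; it moves the Christoffel symbol from the Jacobian
    factor onto the tensor.\<close>
  have swap: "(\<Sum>ks\<in>?L. \<Sum>q\<in>UNIV. C (ks ! a) p q * J q (is ! a) y * R a ks * T ks (\<Phi> y)) =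
      (\<Sum>ks\<in>?L. \<Sum>m\<in>UNIV. P ks * (C m p (ks ! a) * T (ks[a := m]) (\<Phi> y)))" if a: "a < k" for a p
  proof -
    have Rupd: "R a (ks[a := m]) = R a ks" for ks m
      unfolding R_def by (rule prod.cong) auto
    have "(\<Sum>ks\<in>?L. \<Sum>q\<in>UNIV. C (ks ! a) p q * J q (is ! a) y * R a ks * T ks (\<Phi> y)) =
        (\<Sum>(ks, q)\<in>?L \<times> UNIV. C (ks ! a) p q * J q (is ! a) y * R a ks * T ks (\<Phi> y))"
      by (simp add: sum.cartesian_product)
    also have "\<dots> = (\<Sum>(ks, m)\<in>?L \<times> UNIV. P ks * (C m p (ks ! a) * T (ks[a := m]) (\<Phi> y)))"
      by (rule sum.reindex_bij_witness[of _ "\<lambda>(ks, m). (ks[a := m], ks ! a)" "\<lambda>(ks, q). (ks[a := q], ks ! a)"])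
        (use a in \<open>auto simp: PR[OF a] Rupd mult_ac\<close>)
    finally show ?thesis by (simp add: sum.cartesian_product)
  qed
  have "cov_deriv G' T' iis y = pderiv_at i (T' is) y -
      (\<Sum>a<k. \<Sum>m\<in>UNIV. christoffel G' m i (is ! a) y * T' (is[a := m]) y)"
    unfolding iis using len by simp
  also have "(\<Sum>a<k. \<Sum>m\<in>UNIV. christoffel G' m i (is ! a) y * T' (is[a := m]) y) =
      (\<Sum>a<k. (\<Sum>ks\<in>?L. pderiv_at i (J (ks ! a) (is ! a)) y * R a ks * T ks (\<Phi> y)) +
      (\<Sum>ks\<in>?L. \<Sum>p\<in>UNIV. \<Sum>q\<in>UNIV. C (ks ! a) p q * J p i y * J q (is ! a) y * R a ks * T ks (\<Phi> y)))"
    by (intro sum.cong refl upd) simp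
  also have "\<dots> = (\<Sum>a<k. \<Sum>ks\<in>?L. pderiv_at i (J (ks ! a) (is ! a)) y * R a ks * T ks (\<Phi> y)) +
      (\<Sum>a<k. \<Sum>p\<in>UNIV. J p i y * (\<Sum>ks\<in>?L. \<Sum>q\<in>UNIV. C (ks ! a) p q * J q (is ! a) y * R a ks * T ks (\<Phi> y)))"
    unfolding sum.distrib sum_distrib_left
    by (simp add: mult_ac sum.swap[of _ UNIV ?L])
  also have "(\<Sum>a<k. \<Sum>ks\<in>?L. pderiv_at i (J (ks ! a) (is ! a)) y * R a ks * T ks (\<Phi> y)) =
      (\<Sum>ks\<in>?L. (\<Sum>a<k. pderiv_at i (J (ks ! a) (is ! a)) y * R a ks) * T ks (\<Phi> y))"
    unfolding sum_distrib_right by (rule sum.swap)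
  also have "(\<Sum>a<k. \<Sum>p\<in>UNIV. J p i y * (\<Sum>ks\<in>?L. \<Sum>q\<in>UNIV. C (ks ! a) p q * J q (is ! a) y * R a ks * T ks (\<Phi> y)))
     = (\<Sum>a<k. \<Sum>p\<in>UNIV. J p i y * (\<Sum>ks\<in>?L. \<Sum>m\<in>UNIV. P ks * (C m p (ks ! a) * T (ks[a := m]) (\<Phi> y))))"
    by (intro sum.cong refl) (simp add: swap)
  also have "\<dots> = (\<Sum>p\<in>UNIV. \<Sum>a<k. \<Sum>ks\<in>?L. J p i y * (\<Sum>m\<in>UNIV. P ks * (C m p (ks ! a) * T (ks[a := m]) (\<Phi> y))))"
    unfolding sum_distrib_left[of "J _ i y" _ ?L] by (rule sum.swap)
  also have "\<dots> = (\<Sum>p\<in>UNIV. \<Sum>ks\<in>?L. \<Sum>a<k. J p i y * (\<Sum>m\<in>UNIV. P ks * (C m p (ks ! a) * T (ks[a := m]) (\<Phi> y))))"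
    by (rule sum.cong[OF refl sum.swap])
  finally have "cov_deriv G' T' iis y =
      (\<Sum>ks\<in>?L. \<Sum>p\<in>UNIV. P ks * (J p i y * pderiv_at p (T ks) (\<Phi> y))) -
      (\<Sum>p\<in>UNIV. \<Sum>ks\<in>?L. \<Sum>a<k. J p i y * (\<Sum>m\<in>UNIV. P ks * (C m p (ks ! a) * T (ks[a := m]) (\<Phi> y))))"
    unfolding 1 by (simp add: sum.distrib sum_distrib_left)
  also have "(\<Sum>ks\<in>?L. \<Sum>p\<in>UNIV. P ks * (J p i y * pderiv_at p (T ks) (\<Phi> y))) =
      (\<Sum>p\<in>UNIV. \<Sum>ks\<in>?L. P ks * (J p i y * pderiv_at p (T ks) (\<Phi> y)))"
    by (rule sum.swap)
  also have "(\<Sum>p\<in>UNIV. \<Sum>ks\<in>?L. P ks * (J p i y * pderiv_at p (T ks) (\<Phi> y))) -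
      (\<Sum>p\<in>UNIV. \<Sum>ks\<in>?L. \<Sum>a<k. J p i y * (\<Sum>m\<in>UNIV. P ks * (C m p (ks ! a) * T (ks[a := m]) (\<Phi> y))))
     = (\<Sum>p\<in>UNIV. \<Sum>ks\<in>?L. J p i y * P ks * cov_deriv G T (p # ks) (\<Phi> y))"
    unfolding sum_subtractf[symmetric]
    by (intro sum.cong refl) (simp add: C_def sum_distrib_left right_diff_distrib mult_ac)
  also have "\<dots> = (\<Sum>ks | length ks = Suc k. (\<Prod>a<Suc k. J (ks ! a) (iis ! a) y) * cov_deriv G T ks (\<Phi> y))"
    unfolding sum_lists_Suc iis P_def by (simp add: prod.lessThan_Suc_shift del: prod.lessThan_Suc)
  finally show "cov_deriv G' T' iis y =
      (\<Sum>ks | length ks = Suc k. (\<Prod>a<Suc k. J (ks ! a) (iis ! a) y) * cov_deriv G T ks (\<Phi> y))" .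
qed

lemma tensor_norm_related:
  assumes "tensor_related k T' T" "y \<in> U"
  shows "tensor_norm_sq G' k T' y = tensor_norm_sq G k T (\<Phi> y)"
  unfolding tensor_norm_sq_form
  by (rule tensor_form_transform[where J = "\<lambda>k i. J k i y"])
    (use metric_inv[OF assms(2)] tensor_relatedD[OF assms] in auto)

end

section \<open>Riemannian manifolds\<close>

lemma inner_matrix_form:
  fixes A :: "real^'n^'n::finite"
  shows "w \<bullet> (A *v w) = (\<Sum>i\<in>UNIV. \<Sum>j\<in>UNIV. A $ i $ j * w $ i * w $ j)"
  by (simp add: inner_vec_def matrix_vector_mult_def sum_distrib_left mult_ac)

lemma pos_def_det:
  fixes A :: "real^'n^'n::finite"
  assumes "\<And>w. w \<noteq> 0 \<Longrightarrow> 0 < w \<bullet> (A *v w)"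
  shows "det A \<noteq> 0"
proof -
  have "\<forall>x. A *v x = 0 \<longrightarrow> x = 0" using assms by (metis inner_zero_right less_irrefl)
  then show ?thesis
    using matrix_left_invertible_ker[of A] invertible_left_inverse[of A] invertible_det_nz[of A] by blast
qed

lemma matrix_inv_sym:
  fixes A :: "real^'n^'n::finite"
  assumes "transpose A = A" "det A \<noteq> 0"
  shows "transpose (matrix_inv A) = matrix_inv A"
proof -
  have "transpose (matrix_inv A) ** A = mat 1"
    using matrix_inv_right[OF assms(2)] matrix_transpose_mul[of A "matrix_inv A"] assms(1) by simp
  then have "transpose (matrix_inv A) ** A ** matrix_inv A = matrix_inv A" by simp
  then show ?thesis by (simp add: matrix_mul_assoc[symmetric] matrix_inv_right[OF assms(2)])
qed

lemma matrix_inv_vector: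
  fixes A :: "real^'n^'n::finite"
  assumes "det A \<noteq> 0"
  shows "A *v (matrix_inv A *v w) = w"
  by (simp add: matrix_vector_mul_assoc matrix_inv_right[OF assms])

locale elliptic =
  fixes A :: "real^'n^'n::finite" and \<mu> :: real
  assumes sym: "transpose A = A" and \<mu>: "0 < \<mu>" and ell: "\<And>w. \<mu> * (w \<bullet> w) \<le> w \<bullet> (A *v w)"
begin

lemma det_nz: "det A \<noteq> 0"
proof (rule pos_def_det)
  fix w :: "real^'n" assume "w \<noteq> 0"
  then have "0 < \<mu> * (w \<bullet> w)" using \<mu> by simp
  also have "\<dots> \<le> w \<bullet> (A *v w)" by (rule ell)
  finally show "0 < w \<bullet> (A *v w)" .
qed

lemma sym_inv: "matrix_inv A $ i $ j = matrix_inv A $ j $ i"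
proof -
  have "transpose (matrix_inv A) $ i $ j = matrix_inv A $ i $ j"
    using matrix_inv_sym[OF sym det_nz] by simp
  then show ?thesis by (simp add: transpose_def)
qed

text \<open>The column z of the inverse solves A z = e_j, so \<mu> |z|^2 \<le> z . e_j \<le>
  |z|.\<close>

lemma inv_entry_bound: "\<bar>matrix_inv A $ i $ j\<bar> \<le> 1 / \<mu>"
proof -
  define z where "z = matrix_inv A *v axis j 1"
  have "\<mu> * (norm z * norm z) \<le> z \<bullet> (A *v z)"
    using ell[of z] by (simp add: dot_square_norm power2_eq_square)
  also have "\<dots> = z \<bullet> axis j 1" unfolding z_def matrix_inv_vector[OF det_nz] ..
  also have "\<dots> \<le> norm z * norm (axis j (1::real) :: real^'n)" by (rule norm_cauchy_schwarz)
  finally have *: "\<mu> * norm z * norm z \<le> 1 * norm z" by simp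
  have "\<mu> * norm z \<le> 1"
  proof (cases "norm z = 0")
    case False
    then have "norm z > 0" by simp
    then show ?thesis using * mult_le_cancel_right_pos by blast
  qed simp
  then have "norm z \<le> 1 / \<mu>" using \<mu> by (simp add: field_simps)
  moreover have "z $ i = matrix_inv A $ i $ j"
    unfolding z_def by (simp add: matrix_vector_mult_def axis_def if_distrib cong: if_cong)
  ultimately show ?thesis using component_le_norm_cart[of z i] by simp
qed

text \<open>The Leibniz formula with \<open>inv_entry_bound\<close> bounds the determinant of the
  inverse from above, which bounds the determinant itself away from zero.\<close>

lemma det_lower: "inverse (fact CARD('n) * (1 / \<mu>) ^ CARD('n)) \<le> \<bar>det A\<bar>"
proof -
  let ?B = "fact CARD('n) * (1 / \<mu>) ^ CARD('n)"
  have pos: "0 < ?B" using \<mu> by simp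
  have "\<bar>det (matrix_inv A)\<bar> \<le> (\<Sum>p | p permutes (UNIV :: 'n set). (1 / \<mu>) ^ CARD('n))"
    unfolding det_def
  proof (rule order_trans[OF sum_abs sum_mono])
    fix p :: "'n \<Rightarrow> 'n"
    have "(\<Prod>i\<in>UNIV. \<bar>matrix_inv A $ i $ p i\<bar>) \<le> (\<Prod>i\<in>(UNIV :: 'n set). 1 / \<mu>)"
      by (rule prod_mono) (use inv_entry_bound in auto)
    then show "\<bar>of_int (sign p) * (\<Prod>i\<in>UNIV. matrix_inv A $ i $ p i)\<bar> \<le> (1 / \<mu>) ^ CARD('n)"
      by (simp add: abs_mult abs_prod sign_def)
  qed
  also have "\<dots> = ?B" by (simp add: card_permutations)
  finally have le: "\<bar>det (matrix_inv A)\<bar> \<le> ?B" .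
  have "det A * det (matrix_inv A) = 1"
    using matrix_inv_right[OF det_nz] by (metis det_mul det_I)
  then have "1 = \<bar>det A\<bar> * \<bar>det (matrix_inv A)\<bar>" by (metis abs_mult abs_one)
  also have "\<dots> \<le> \<bar>det A\<bar> * ?B" by (rule mult_left_mono[OF le]) simp
  finally have 1: "1 \<le> \<bar>det A\<bar> * ?B" .
  have "inverse B \<le> d" if "0 < B" "1 \<le> d * B" for B d :: real
    using that by (simp add: field_simps)
  from this[OF pos 1] show ?thesis .
qed

text \<open>For v = A z one has v . (A^-1 v) = z . (A z) \<ge> \<mu> |z|^2, and the entry bound
  gives |v| \<le> n^2 L |z| by way of the sum norm.\<close>

lemma inv_elliptic:
  assumes "\<And>i j. \<bar>A $ i $ j\<bar> \<le> L" "0 < L"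
  shows "\<mu> / (real CARD('n) * (real CARD('n) * L))\<^sup>2 * (\<Sum>i\<in>UNIV. w i * w i) \<le>
    (\<Sum>i\<in>UNIV. \<Sum>j\<in>UNIV. matrix_inv A $ i $ j * w i * w j)"
proof -
  define v :: "real^'n" where "v = (\<chi> i. w i)"
  define z where "z = matrix_inv A *v v"
  let ?n = "real CARD('n)"
  have n: "?n \<ge> 1" by (simp add: Suc_leI)
  have Az: "A *v z = v" unfolding z_def by (rule matrix_inv_vector[OF det_nz])
  have "\<bar>v $ i\<bar> \<le> ?n * L * norm z" for i
  proof -
    have "\<bar>v $ i\<bar> \<le> (\<Sum>j\<in>UNIV. \<bar>A $ i $ j\<bar> * \<bar>z $ j\<bar>)"
      unfolding Az[symmetric] matrix_vector_mult_def by (simp add: abs_mult[symmetric] sum_abs)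
    also have "\<dots> \<le> (\<Sum>j\<in>(UNIV :: 'n set). L * norm z)"
      by (intro sum_mono mult_mono assms component_le_norm_cart) (use assms in auto)
    finally show ?thesis by simp
  qed
  then have "norm v \<le> (\<Sum>i\<in>(UNIV :: 'n set). ?n * L * norm z)"
    by (intro order_trans[OF norm_le_l1_cart] sum_mono)
  then have "norm v \<le> ?n * (?n * L) * norm z" by simp
  then have "(norm v)\<^sup>2 \<le> (?n * (?n * L))\<^sup>2 * (norm z)\<^sup>2"
    unfolding power_mult_distrib[symmetric] by (intro power_mono) auto
  then have "\<mu> / (?n * (?n * L))\<^sup>2 * (norm v)\<^sup>2 \<le> \<mu> / (?n * (?n * L))\<^sup>2 * ((?n * (?n * L))\<^sup>2 * (norm z)\<^sup>2)"
    using \<mu> by (intro mult_left_mono) auto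
  also have "\<dots> = \<mu> * (z \<bullet> z)" using assms(2) n by (simp add: dot_square_norm)
  also have "\<dots> \<le> z \<bullet> (A *v z)" by (rule ell)
  also have "\<dots> = v \<bullet> (matrix_inv A *v v)" unfolding Az by (simp add: z_def inner_commute)
  finally show ?thesis
    unfolding inner_matrix_form power2_norm_eq_inner by (simp add: v_def inner_vec_def)
qed

end

section \<open>Smoothness and invariance of iterated covariant derivatives\<close>

lemma cov_deriv_cong:
  assumes "\<And>js. length js = k \<Longrightarrow> T js = T' js" "length is = Suc k"
  shows "cov_deriv G T is = cov_deriv G T' is"
proof -
  obtain i js where is_eq: "is = i # js" and len: "length js = k" using assms(2) by (auto simp: length_Suc_conv)
  have "T js = T' js" "T (js[a := m]) = T' (js[a := m])" for a m
    using assms(1) len by auto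
  then show ?thesis unfolding is_eq by (intro ext) simp
qed

lemma iter_cov_deriv_0 [simp]: "iter_cov_deriv G 0 f = (\<lambda>_. f)"
  unfolding iter_cov_deriv_def by simp

lemma iter_cov_deriv_Suc [simp]: "iter_cov_deriv G (Suc k) f = cov_deriv G (iter_cov_deriv G k f)"
  unfolding iter_cov_deriv_def by simp

text \<open>The reason why only the norm of \<open>u\<close> modulo functions of time matters:
  constants disappear at the first derivative.\<close>

lemma iter_cov_deriv_minus_const:
  assumes "length is = Suc k"
  shows "iter_cov_deriv G (Suc k) (\<lambda>y. f y - a) is = iter_cov_deriv G (Suc k) f is"
  using assms
proof (induction k arbitrary: "is")
  case 0
  then obtain i where "is = [i]" by (auto simp: length_Suc_conv)
  moreover have "pderiv_at i (\<lambda>y. f y - a) y = pderiv_at i f y" for y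
  proof -
    have "((\<lambda>y. f y - a) has_derivative f') (at y) \<longleftrightarrow> (f has_derivative f') (at y)" for f'
      using has_derivative_diff[of f f' "at y" "\<lambda>_. a" "\<lambda>_. 0"]
        has_derivative_add[of "\<lambda>y. f y - a" f' "at y" "\<lambda>_. a" "\<lambda>_. 0"] by (auto simp: has_derivative_const)
    then show ?thesis unfolding pderiv_at_def frechet_derivative_def by simp
  qed
  ultimately show ?case by (auto intro!: ext)
next
  case (Suc k)
  show ?case
    unfolding iter_cov_deriv_Suc[of G "Suc k"] by (rule cov_deriv_cong[OF _ Suc.prems]) (rule Suc.IH)
qed

lemma smooth_on_christoffel:
  assumes "open V" "\<And>i j. smooth_on V (\<lambda>y. G y $ i $ j)" "\<And>y. y \<in> V \<Longrightarrow> det (G y) \<noteq> 0"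
  shows "smooth_on V (christoffel G m i j)"
  unfolding christoffel_def[abs_def] pderiv_at_dd
  by (intro smooth_on_mult smooth_on_sum smooth_on_const smooth_on_matrix_inv smooth_on_diff smooth_on_add
      smooth_on_dd assms)

lemma smooth_on_cov_deriv:
  assumes "open V" "\<And>i j. smooth_on V (\<lambda>y. G y $ i $ j)" "\<And>y. y \<in> V \<Longrightarrow> det (G y) \<noteq> 0"
    and "\<And>js. length js = k \<Longrightarrow> smooth_on V (T js)" "length is = Suc k"
  shows "smooth_on V (cov_deriv G T is)"
proof -
  obtain i js where is_eq: "is = i # js" and len: "length js = k" using assms(5) by (auto simp: length_Suc_conv)
  have "cov_deriv G T is = (\<lambda>y. pderiv_at i (T js) y -
     (\<Sum>a<length js. \<Sum>m\<in>UNIV. christoffel G m i (js ! a) y * T (js[a := m]) y))"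
    unfolding is_eq by (rule ext) simp
  moreover have "smooth_on V (\<lambda>y. pderiv_at i (T js) y -
     (\<Sum>a<length js. \<Sum>m\<in>UNIV. christoffel G m i (js ! a) y * T (js[a := m]) y))"
    unfolding pderiv_at_dd using len
    by (intro smooth_on_diff smooth_on_sum smooth_on_mult smooth_on_dd smooth_on_christoffel assms) auto
  ultimately show ?thesis by simp
qed

lemma smooth_on_iter_cov_deriv:
  assumes "open V" "\<And>i j. smooth_on V (\<lambda>y. G y $ i $ j)" "\<And>y. y \<in> V \<Longrightarrow> det (G y) \<noteq> 0"
    and "smooth_on V f" "length is = k"
  shows "smooth_on V (iter_cov_deriv G k f is)"
  using assms(5)
proof (induction k arbitrary: "is")
  case 0
  then show ?case using assms(4) by simp
next
  case (Suc k)
  show ?case unfolding iter_cov_deriv_Suc by (rule smooth_on_cov_deriv[OF assms(1-3) Suc.IH Suc.prems])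
qed

context coord_change
begin

lemma scalar_related:
  assumes "\<And>y. y \<in> U \<Longrightarrow> f' y = f (\<Phi> y)"
  shows "tensor_related 0 (\<lambda>_. f') (\<lambda>_. f)"
  unfolding tensor_related_def using assms by simp

lemma iter_cov_deriv_related:
  assumes "\<And>y. y \<in> U \<Longrightarrow> f' y = f (\<Phi> y)" "smooth_on V f"
  shows "tensor_related k (iter_cov_deriv G' k f') (iter_cov_deriv G k f)"
proof (induction k)
  case 0
  then show ?case using scalar_related[of f' f] assms(1) by simp
next
  case (Suc k)
  then show ?case
    unfolding iter_cov_deriv_Suc
    by (rule cov_deriv_related)
      (rule smooth_on_differentiable[OF open_V smooth_on_iter_cov_deriv[OF open_V smooth_G det_G assms(2)]])
qed

end

text \<open>The constant is the minimum of the quadratic form over the compact product of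
  \<open>K\<close> with the unit sphere; homogeneity extends the bound to all vectors.\<close>

lemma compact_ellipticity:
  fixes G :: "real^'n \<Rightarrow> real^'n^'n::finite"
  assumes "compact K" "continuous_on K G" "\<And>y w. y \<in> K \<Longrightarrow> w \<noteq> 0 \<Longrightarrow> 0 < w \<bullet> (G y *v w)"
  shows "\<exists>\<mu>>0. \<forall>y\<in>K. \<forall>w. \<mu> * (w \<bullet> w) \<le> w \<bullet> (G y *v w)"
proof (cases "K = {}")
  case True
  then show ?thesis by (auto intro: exI[of _ 1])
next
  case False
  let ?S = "K \<times> sphere (0 :: real^'n) 1"
  let ?q = "\<lambda>(y, w). w \<bullet> (G y *v w)"
  have "axis undefined 1 \<in> sphere (0 :: real^'n) 1" by simp
  then have ne: "?S \<noteq> {}" using False by blast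
  have cG: "continuous_on ?S (\<lambda>p. G (fst p))"
    by (rule continuous_on_compose2[OF assms(2) continuous_on_fst[OF continuous_on_id]]) auto
  have c1: "continuous_on ?S (\<lambda>p. G (fst p) $ i $ j)" for i j
    by (intro continuous_on_component cG)
  have c2: "continuous_on ?S (\<lambda>p. snd p $ i)" for i
    by (intro continuous_on_component continuous_on_snd continuous_on_id)
  have "continuous_on ?S (\<lambda>p. \<Sum>i\<in>UNIV. \<Sum>j\<in>UNIV. G (fst p) $ i $ j * snd p $ i * snd p $ j)"
    by (intro continuous_on_sum continuous_on_mult c1 c2)
  then have "continuous_on ?S ?q" by (simp add: inner_matrix_form case_prod_unfold)
  then obtain p where p: "p \<in> ?S" "\<And>p'. p' \<in> ?S \<Longrightarrow> ?q p \<le> ?q p'"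
    using continuous_attains_inf[OF compact_Times[OF assms(1) compact_sphere] ne] by blast
  obtain y0 w0 where p_eq: "p = (y0, w0)" by (cases p)
  have "w0 \<noteq> 0" "y0 \<in> K" using p(1) p_eq by auto
  then have pos: "?q p > 0" using assms(3) p_eq by simp
  have "?q p * (w \<bullet> w) \<le> w \<bullet> (G y *v w)" if y: "y \<in> K" for y w
  proof (cases "w = 0")
    case False
    let ?v = "(1 / norm w) *\<^sub>R w"
    have "(y, ?v) \<in> ?S" using y False by simp
    then have "?q p \<le> ?v \<bullet> (G y *v ?v)" using p(2)[of "(y, ?v)"] by simp
    also have "\<dots> = (w \<bullet> (G y *v w)) / (norm w)\<^sup>2"
      by (simp add: matrix_vector_mult_scaleR power2_eq_square)
    finally show ?thesis using False by (simp add: field_simps power2_norm_eq_inner)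
  qed simp
  then show ?thesis using pos by blast
qed

locale riemannian =
  fixes \<A> :: "('a::t2_space, 'n::finite) chart set" and g :: "('a, 'n) metric_field"
  assumes compact_X: "compact (UNIV :: 'a set)" and atlas: "smooth_atlas \<A>" and metric: "riemannian_metric \<A> g"
begin

lemma chart:
  assumes "c \<in> \<A>"
  shows open_dom: "open (chart_dom c)" and open_img: "open (chart_img c)"
    and chart_homeo: "homeomorphism (chart_dom c) (chart_img c) (coord c) (chart_inv c)"
  using atlas assms unfolding smooth_atlas_def by auto

lemma coord_in: "c \<in> \<A> \<Longrightarrow> x \<in> chart_dom c \<Longrightarrow> coord c x \<in> chart_img c"
  unfolding chart_img_def by auto

lemma inv_coord: "c \<in> \<A> \<Longrightarrow> x \<in> chart_dom c \<Longrightarrow> chart_inv c (coord c x) = x"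
  using chart_homeo unfolding homeomorphism_def by blast

lemma coord_inv: "c \<in> \<A> \<Longrightarrow> y \<in> chart_img c \<Longrightarrow> coord c (chart_inv c y) = y"
  using chart_homeo unfolding homeomorphism_def by blast

lemma inv_in: "c \<in> \<A> \<Longrightarrow> y \<in> chart_img c \<Longrightarrow> chart_inv c y \<in> chart_dom c"
  using chart_homeo unfolding homeomorphism_def by blast

lemma smooth_metric: "c \<in> \<A> \<Longrightarrow> smooth_on (chart_img c) (\<lambda>y. g c y $ i $ j)"
  using metric unfolding riemannian_metric_def
  by (intro smooth_on_vec_nth[OF open_img] smooth_on_linear[OF open_img bounded_linear_vec_nth]) auto

lemma continuous_metric: "c \<in> \<A> \<Longrightarrow> continuous_on (chart_img c) (g c)"
  using metric smooth_on_continuous unfolding riemannian_metric_def by blast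

lemma metric_sym: "c \<in> \<A> \<Longrightarrow> y \<in> chart_img c \<Longrightarrow> transpose (g c y) = g c y"
  using metric unfolding riemannian_metric_def by blast

lemma metric_pos: "c \<in> \<A> \<Longrightarrow> y \<in> chart_img c \<Longrightarrow> w \<noteq> 0 \<Longrightarrow> 0 < w \<bullet> (g c y *v w)"
  using metric unfolding riemannian_metric_def by blast

lemma metric_det: "c \<in> \<A> \<Longrightarrow> y \<in> chart_img c \<Longrightarrow> det (g c y) \<noteq> 0"
  using pos_def_det metric_pos by blast

section \<open>Overlaps of charts and a finite cover by coordinate balls\<close>

definition overlap :: "('a, 'n) chart \<Rightarrow> ('a, 'n) chart \<Rightarrow> (real^'n) set" where
  "overlap c d = coord c ` (chart_dom c \<inter> chart_dom d)"

lemma overlap_iff: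
  assumes "c \<in> \<A>"
  shows "y \<in> overlap c d \<longleftrightarrow> y \<in> chart_img c \<and> chart_inv c y \<in> chart_dom d"
proof
  assume "y \<in> overlap c d"
  then obtain x where "x \<in> chart_dom c" "x \<in> chart_dom d" "y = coord c x" unfolding overlap_def by blast
  then show "y \<in> chart_img c \<and> chart_inv c y \<in> chart_dom d"
    using coord_in[OF assms] inv_coord[OF assms] by metis
next
  assume "y \<in> chart_img c \<and> chart_inv c y \<in> chart_dom d"
  then show "y \<in> overlap c d"
    unfolding overlap_def using inv_in[OF assms] coord_inv[OF assms] by (metis IntI imageI)
qed

lemma open_overlap:
  assumes "c \<in> \<A>" "d \<in> \<A>"
  shows "open (overlap c d)"
proof -
  have "overlap c d = chart_img c \<inter> chart_inv c -` chart_dom d"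
    using overlap_iff[OF assms(1), of _ d] by blast
  moreover have "continuous_on (chart_img c) (chart_inv c)"
    using chart_homeo[OF assms(1)] unfolding homeomorphism_def by blast
  ultimately show ?thesis
    using continuous_open_preimage open_img[OF assms(1)] open_dom[OF assms(2)] by metis
qed

lemma change:
  assumes "c \<in> \<A>" "d \<in> \<A>"
  shows "coord_change (overlap c d) (chart_img d) (transition c d) (g d) (g c)"
proof
  show "open (overlap c d)" by (rule open_overlap[OF assms])
  show "open (chart_img d)" by (rule open_img[OF assms(2)])
  show "transition c d y \<in> chart_img d" if "y \<in> overlap c d" for y
    using that overlap_iff[OF assms(1), of y d] coord_in[OF assms(2)] unfolding transition_def by simp
  show "smooth_on (overlap c d) (transition c d)"
    using atlas assms unfolding smooth_atlas_def overlap_def by blast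
  show "smooth_on (chart_img d) (\<lambda>y. g d y $ i $ j)" for i j by (rule smooth_metric[OF assms(2)])
  show "g d y $ i $ j = g d y $ j $ i" if "y \<in> chart_img d" for y i j
  proof -
    have "transpose (g d y) $ i $ j = g d y $ i $ j" using metric_sym[OF assms(2) that] by simp
    then show ?thesis by (simp add: transpose_def)
  qed
  show "det (g d y) \<noteq> 0" if "y \<in> chart_img d" for y using metric_det[OF assms(2) that] .
  show "det (g c y) \<noteq> 0" if "y \<in> overlap c d" for y
    using metric_det[OF assms(1)] that overlap_iff[OF assms(1), of y d] by blast
  show "g c y $ i $ j = (\<Sum>k\<in>UNIV. \<Sum>l\<in>UNIV. pderiv_at i (\<lambda>z. transition c d z $ k) y *
      pderiv_at j (\<lambda>z. transition c d z $ l) y * g d (transition c d y) $ k $ l)"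
    if y: "y \<in> overlap c d" for y i j
  proof -
    obtain x where x: "x \<in> chart_dom c \<inter> chart_dom d" "y = coord c x" using y unfolding overlap_def by blast
    have t: "transition c d y = coord d x" using x inv_coord[OF assms(1)] unfolding transition_def by auto
    have "g c (coord c x) $ i $ j = (\<Sum>k\<in>UNIV. \<Sum>l\<in>UNIV. jacobian c d (coord c x) $ k $ i *
        jacobian c d (coord c x) $ l $ j * g d (coord d x) $ k $ l)"
      using metric assms x(1) unfolding riemannian_metric_def by blast
    then show ?thesis unfolding t unfolding x(2) by (simp add: jacobian_def)
  qed
qed

lemma in_chart_change:
  assumes "c \<in> \<A>" "d \<in> \<A>" "y \<in> overlap c d"
  shows "in_chart c f y = in_chart d f (transition c d y)"
  using assms(3) inv_coord[OF assms(2)] overlap_iff[OF assms(1), of y d] unfolding in_chart_def transition_def by simp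

text \<open>The open balls cover and serve as interiors; the closed ball inside the chart supplies
  the compactness for all bounds.\<close>

definition piece :: "('a, 'n) chart \<Rightarrow> real^'n \<Rightarrow> real \<Rightarrow> bool" where
  "piece c z r \<longleftrightarrow> c \<in> \<A> \<and> 0 < r \<and> cball z r \<subseteq> chart_img c"

lemma open_piece:
  assumes "piece c z r"
  shows "open (chart_inv c ` ball z r)"
proof -
  have c: "c \<in> \<A>" and sub: "ball z r \<subseteq> chart_img c"
    using assms unfolding piece_def by (auto simp: subset_iff)
  have "chart_inv c ` ball z r = chart_dom c \<inter> coord c -` ball z r"
  proof
    show "chart_inv c ` ball z r \<subseteq> chart_dom c \<inter> coord c -` ball z r"
      using sub inv_in[OF c] coord_inv[OF c] by auto
    show "chart_dom c \<inter> coord c -` ball z r \<subseteq> chart_inv c ` ball z r"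
    proof
      fix x assume "x \<in> chart_dom c \<inter> coord c -` ball z r"
      then show "x \<in> chart_inv c ` ball z r"
        using inv_coord[OF c, of x] by (metis IntE image_eqI vimageD)
    qed
  qed
  moreover have "continuous_on (chart_dom c) (coord c)"
    using chart_homeo[OF c] unfolding homeomorphism_def by blast
  ultimately show ?thesis
    using continuous_open_preimage[of "chart_dom c" "coord c" "ball z r"] open_dom[OF c] by simp
qed

lemma finite_pieces:
  obtains F where "finite F" "\<And>c z r. (c, z, r) \<in> F \<Longrightarrow> piece c z r"
    "(\<Union>(c, z, r)\<in>F. chart_inv c ` ball z r) = UNIV"
proof -
  let ?\<C> = "{(c, z, r). piece c z r}"
  let ?f = "\<lambda>(c, z, r). chart_inv c ` ball z r"
  have cover: "x \<in> \<Union> (?f ` ?\<C>)" for x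
  proof -
    obtain c where c: "c \<in> \<A>" "x \<in> chart_dom c" using atlas unfolding smooth_atlas_def by blast
    obtain r where r: "r > 0" "cball (coord c x) r \<subseteq> chart_img c"
      using open_contains_cball open_img[OF c(1)] coord_in[OF c] by blast
    have "(c, coord c x, r) \<in> ?\<C>" using c r unfolding piece_def by simp
    moreover have "x \<in> ?f (c, coord c x, r)"
      using r inv_coord[OF c] by (auto intro!: image_eqI[of _ _ "coord c x"])
    ultimately show ?thesis by blast
  qed
  have op: "open (?f p)" if "p \<in> ?\<C>" for p using that open_piece by auto
  obtain F where F: "F \<subseteq> ?\<C>" "finite F" "UNIV \<subseteq> \<Union> (?f ` F)"
    using compactE_image[OF compact_X, of ?\<C> ?f] op cover by (metis (no_types, lifting) subsetI)
  show ?thesis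
  proof (rule that[OF F(2)])
    show "piece c z r" if "(c, z, r) \<in> F" for c z r using F(1) that by auto
    show "\<Union> (?f ` F) = UNIV" using F(3) by blast
  qed
qed

section \<open>Finiteness of the suprema in \<open>Cm_norm\<close>\<close>

lemma metric_inv_sym:
  assumes "c \<in> \<A>" "y \<in> chart_img c"
  shows "matrix_inv (g c y) $ i $ j = matrix_inv (g c y) $ j $ i"
proof -
  have "transpose (matrix_inv (g c y)) $ i $ j = matrix_inv (g c y) $ i $ j"
    using matrix_inv_sym[OF metric_sym metric_det] assms by simp
  then show ?thesis by (simp add: transpose_def)
qed

lemma metric_inv_nonneg:
  assumes "c \<in> \<A>" "y \<in> chart_img c"
  shows "0 \<le> (\<Sum>i\<in>UNIV. \<Sum>j\<in>UNIV. matrix_inv (g c y) $ i $ j * w i * w j)"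
proof -
  let ?v = "\<chi> i. w i" let ?z = "matrix_inv (g c y) *v ?v"
  have "0 \<le> ?z \<bullet> (g c y *v ?z)"
    using metric_pos[OF assms, of ?z] by (cases "?z = 0") (auto intro: less_imp_le)
  also have "\<dots> = ?v \<bullet> (matrix_inv (g c y) *v ?v)"
    unfolding matrix_inv_vector[OF metric_det[OF assms]] by (simp add: inner_commute)
  finally show ?thesis unfolding inner_matrix_form by simp
qed

lemma tensor_norm_nonneg:
  assumes "c \<in> \<A>" "y \<in> chart_img c"
  shows "0 \<le> tensor_norm_sq (g c) k T y"
  unfolding tensor_norm_sq_form
  by (rule tensor_form_nonneg[OF metric_inv_sym[OF assms] metric_inv_nonneg[OF assms]])

lemma smooth_tensor_norm:
  assumes "c \<in> \<A>" "\<And>is. length is = k \<Longrightarrow> smooth_on (chart_img c) (T is)"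
  shows "continuous_on (chart_img c) (tensor_norm_sq (g c) k T)"
proof -
  note o = open_img[OF assms(1)]
  have "smooth_on (chart_img c) (\<lambda>y. matrix_inv (g c y) $ i $ j)" for i j
    by (rule smooth_on_matrix_inv[OF o smooth_metric[OF assms(1)] metric_det[OF assms(1)]])
  then have "continuous_on (chart_img c) (\<lambda>y. matrix_inv (g c y) $ i $ j)" for i j
    by (rule smooth_on_continuous)
  then show ?thesis
    unfolding tensor_norm_sq_def[abs_def]
    by (intro continuous_on_sum continuous_on_mult continuous_on_prod)
      (use assms(2) in \<open>auto intro!: smooth_on_continuous\<close>)
qed

text \<open>A real supremum bounds its elements only if the set is bounded above. The set ranges
  over all charts and all their points, so it is compared with the images of finitely many closed
  balls.\<close>

lemma Cm_norm_ge:
  assumes f: "smooth_fun \<A> f" and c: "c \<in> \<A>" "y \<in> chart_img c" and k: "k \<le> m"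
  shows "sqrt (tensor_norm_sq (g c) k (iter_cov_deriv (g c) k (in_chart c f)) y) \<le> Cm_norm \<A> g m f"
proof -
  define N where "N k c y = sqrt (tensor_norm_sq (g c) k (iter_cov_deriv (g c) k (in_chart c f)) y)" for k c y
  let ?S = "\<lambda>k. {N k c y | c y. c \<in> \<A> \<and> y \<in> chart_img c}"
  have sm: "smooth_on (chart_img c) (iter_cov_deriv (g c) k (in_chart c f) is)" if "c \<in> \<A>" "length is = k" for c k "is"
    using f that(1) unfolding smooth_fun_def
    by (intro smooth_on_iter_cov_deriv[OF open_img smooth_metric metric_det] that) auto
  obtain F where F: "finite F" "\<And>c z r. (c, z, r) \<in> F \<Longrightarrow> piece c z r"
    "(\<Union>(c, z, r)\<in>F. chart_inv c ` ball z r) = UNIV" using finite_pieces by blast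
  have bdd: "bdd_above (?S k)" for k
  proof -
    have "bdd_above (N k c ` cball z r)" if "(c, z, r) \<in> F" for c z r
    proof -
      have p: "c \<in> \<A>" "cball z r \<subseteq> chart_img c" using F(2)[OF that] unfolding piece_def by auto
      have "continuous_on (chart_img c) (N k c)"
        unfolding N_def[abs_def] by (intro continuous_on_real_sqrt smooth_tensor_norm sm p)
      then have "compact (N k c ` cball z r)"
        using p(2) by (intro compact_continuous_image continuous_on_subset[OF _ p(2)]) auto
      then show ?thesis by (rule compact_imp_bounded[THEN bounded_imp_bdd_above])
    qed
    then have b: "bdd_above (\<Union>(c, z, r)\<in>F. N k c ` cball z r)"
      using F(1) by (auto intro!: bdd_above_UN[THEN iffD2])
    \<comment> \<open>Each point lies in some ball of the finite cover, and the pointwise norm there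
      is the same by tensoriality.\<close>
    have "?S k \<subseteq> (\<Union>(c, z, r)\<in>F. N k c ` cball z r)"
    proof
      fix s assume "s \<in> ?S k"
      then obtain c y where s: "s = N k c y" and cy: "c \<in> \<A>" "y \<in> chart_img c" by blast
      have "chart_inv c y \<in> (\<Union>(c, z, r)\<in>F. chart_inv c ` ball z r)" using F(3) by simp
      then obtain d z r y' where d: "(d, z, r) \<in> F" "y' \<in> ball z r" "chart_inv c y = chart_inv d y'" by auto
      have dA: "d \<in> \<A>" and y': "y' \<in> chart_img d" using F(2)[OF d(1)] d(2) unfolding piece_def by (auto simp: subset_iff)
      have ov: "y \<in> overlap c d" unfolding overlap_iff[OF cy(1)] using cy d(3) inv_in[OF dA y'] by simp
      have t: "transition c d y = y'" unfolding transition_def using d(3) coord_inv[OF dA y'] by simp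
      interpret coord_change "overlap c d" "chart_img d" "transition c d" "g d" "g c"
        by (rule change[OF cy(1) dA])
      have "tensor_related k (iter_cov_deriv (g c) k (in_chart c f)) (iter_cov_deriv (g d) k (in_chart d f))"
        by (rule iter_cov_deriv_related) (use in_chart_change[OF cy(1) dA] f dA in \<open>auto simp: smooth_fun_def\<close>)
      from tensor_norm_related[OF this ov] have "N k c y = N k d y'" unfolding N_def t by simp
      then have "s \<in> N k d ` cball z r" using s d(2) by auto
      then show "s \<in> (\<Union>(c, z, r)\<in>F. N k c ` cball z r)" using d(1) by (auto intro!: bexI[of _ "(d, z, r)"])
    qed
    then show ?thesis by (rule bdd_above_mono[OF b])
  qed
  have nonneg: "0 \<le> N k c y" if "c \<in> \<A>" "y \<in> chart_img c" for k c y
    unfolding N_def using tensor_norm_nonneg[OF that] by simp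
  have upper: "N k c y \<le> Sup (?S k)" if "c \<in> \<A>" "y \<in> chart_img c" for k c y
    by (rule cSup_upper[OF _ bdd]) (use that in blast)
  have "N k c y \<le> Sup (?S k)" by (rule upper[OF c])
  also have "\<dots> \<le> (\<Sum>k\<le>m. Sup (?S k))"
    by (rule member_le_sum) (use k order_trans[OF nonneg[OF c] upper[OF c]] in auto)
  also have "\<dots> = Cm_norm \<A> g m f" unfolding Cm_norm_def N_def ..
  finally show ?thesis unfolding N_def .
qed

end

section \<open>Bounds on the coefficients of the linear equation\<close>

definition space_dir :: "'n::finite \<Rightarrow> real \<times> (real^'n)" where
  "space_dir i = (0, axis i 1)"

definition time_dir :: "real \<times> (real^'n::finite)" where
  "time_dir = (1, 0)"

lemma uniform_finite:
  assumes "\<And>i::'i::finite. \<exists>M. \<forall>p\<in>P. \<forall>x\<in>S. norm (h i p x) \<le> (M::real)"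
  shows "\<exists>M. \<forall>i. \<forall>p\<in>P. \<forall>x\<in>S. norm (h i p x) \<le> M"
proof -
  obtain M where M: "\<And>i. \<forall>p\<in>P. \<forall>x\<in>S. norm (h i p x) \<le> M i" using assms by metis
  have "M i \<le> (\<Sum>i\<in>UNIV. \<bar>M i\<bar>)" for i
    using member_le_sum[of i UNIV "\<lambda>i. \<bar>M i\<bar>"] by simp
  then show ?thesis using M by (meson order_trans)
qed

text \<open>Precisely what the Bochner error consumes: \<open>L\<close> applied to \<open>a\<close>
  takes two spatial derivatives of \<open>a\<close>, commuting a spatial derivative past
  \<open>L\<close> takes one of \<open>a\<close> and of \<open>b\<close>, and commuting the time
  derivative takes one time derivative of each.\<close>

definition bounded_coeffs :: "real \<Rightarrow> real \<Rightarrow> ('n::finite \<Rightarrow> 'n \<Rightarrow> real \<times> (real^'n) \<Rightarrow> real) \<Rightarrow>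
    ('n \<Rightarrow> real \<times> (real^'n) \<Rightarrow> real) \<Rightarrow> real \<times> (real^'n) \<Rightarrow> bool" where
  "bounded_coeffs M \<mu> a b p \<longleftrightarrow> (\<forall>i j. a i j p = a j i p) \<and>
     (\<forall>w. \<mu> * (\<Sum>i\<in>UNIV. w i * w i) \<le> (\<Sum>i\<in>UNIV. \<Sum>j\<in>UNIV. a i j p * w i * w j)) \<and>
     (\<forall>i j. \<bar>a i j p\<bar> \<le> M) \<and> (\<forall>m. \<bar>b m p\<bar> \<le> M) \<and>
     (\<forall>i j k. \<bar>dd (space_dir k) (a i j) p\<bar> \<le> M) \<and> (\<forall>m k. \<bar>dd (space_dir k) (b m) p\<bar> \<le> M) \<and>
     (\<forall>i j k l. \<bar>dd (space_dir k) (dd (space_dir l) (a i j)) p\<bar> \<le> M) \<and>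
     (\<forall>i j. \<bar>dd time_dir (a i j) p\<bar> \<le> M) \<and> (\<forall>m. \<bar>dd time_dir (b m) p\<bar> \<le> M)"

lemma bounded_coeffs_mono:
  assumes "bounded_coeffs M \<mu> a b p" "M \<le> M'" "\<mu>' \<le> \<mu>"
  shows "bounded_coeffs M' \<mu>' a b p"
proof -
  have "\<mu>' * (\<Sum>i\<in>UNIV. w i * w i) \<le> \<mu> * (\<Sum>i\<in>UNIV. w i * w i)" for w :: "'a \<Rightarrow> real"
    using assms(3) by (intro mult_right_mono sum_nonneg) auto
  then show ?thesis using assms(1,2) unfolding bounded_coeffs_def by (meson order_trans)
qed

text \<open>Everything is expressed by functions of (t, y). Smoothness is proved on all of
  \<open>W\<close>, uniform bounds only on \<open>S\<close>, where y stays in a compact part of the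
  chart.\<close>

locale chart_piece = riemannian \<A> g for \<A> :: "('a::t2_space, 'n::finite) chart set" and g +
  fixes \<xi> :: "('a, 'n) one_form" and c :: "('a, 'n) chart" and z :: "real^'n" and r :: real
  assumes closed: "closed_one_form \<A> \<xi>" and piece: "piece c z r"
begin

abbreviation "V \<equiv> chart_img c"
abbreviation W :: "(real \<times> (real^'n)) set" where "W \<equiv> {0<..} \<times> V"
abbreviation S :: "(real \<times> (real^'n)) set" where "S \<equiv> {0<..} \<times> ball z r"

lemma c: "c \<in> \<A>" and cball_V: "cball z r \<subseteq> V" and ball_V: "ball z r \<subseteq> V"
  using piece ball_subset_cball[of z r] unfolding piece_def by auto

lemma open_V: "open V" by (rule open_img[OF c])

lemma open_W: "open W" using open_V by (simp add: open_Times)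

lemma open_S: "open S" by (simp add: open_Times)

lemma S_W: "S \<subseteq> W" using ball_V by auto

lemma SW: "p \<in> S \<Longrightarrow> p \<in> W" using S_W by blast

definition fld :: "(real \<Rightarrow> 'a \<Rightarrow> real) \<Rightarrow> real \<times> (real^'n) \<Rightarrow> real" where
  "fld u p = in_chart c (u (fst p)) (snd p)"
definition om :: "(real \<Rightarrow> 'a \<Rightarrow> real) \<Rightarrow> 'n \<Rightarrow> real \<times> (real^'n) \<Rightarrow> real" where
  "om u j p = add_differential \<xi> (u (fst p)) c (snd p) $ j"
definition chi :: "(real \<Rightarrow> 'a \<Rightarrow> real) \<Rightarrow> 'n \<Rightarrow> 'n \<Rightarrow> real \<times> (real^'n) \<Rightarrow> real" where
  "chi u i j p = cov_matrix (g c) (add_differential \<xi> (u (fst p)) c) (snd p) $ i $ j"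
definition eta :: "(real \<Rightarrow> 'a \<Rightarrow> real) \<Rightarrow> real \<times> (real^'n) \<Rightarrow> real^'n^'n" where
  "eta u p = graph_metric (g c) (add_differential \<xi> (u (fst p)) c) (snd p)"
definition ac :: "(real \<Rightarrow> 'a \<Rightarrow> real) \<Rightarrow> 'n \<Rightarrow> 'n \<Rightarrow> real \<times> (real^'n) \<Rightarrow> real" where
  "ac u i j p = matrix_inv (eta u p) $ i $ j"
definition Gam :: "'n \<Rightarrow> 'n \<Rightarrow> 'n \<Rightarrow> real \<times> (real^'n) \<Rightarrow> real" where
  "Gam m i j p = christoffel (g c) m i j (snd p)"
text \<open>The Christoffel part of a^ij v_ij: with it the equation becomes v_t = a^ij d_ij v + b^m
  d_m v in coordinates.\<close>

definition bc :: "(real \<Rightarrow> 'a \<Rightarrow> real) \<Rightarrow> 'n \<Rightarrow> real \<times> (real^'n) \<Rightarrow> real" where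
  "bc u m p = - (\<Sum>i\<in>UNIV. \<Sum>j\<in>UNIV. ac u i j p * Gam m i j p)"
definition T :: "(real \<Rightarrow> 'a \<Rightarrow> real) \<Rightarrow> nat \<Rightarrow> 'n list \<Rightarrow> real \<times> (real^'n) \<Rightarrow> real" where
  "T u k is p = iter_cov_deriv (g c) k (in_chart c (u (fst p))) is (snd p)"

lemma smooth_fld: "smooth_spacetime \<A> {0<..} u \<Longrightarrow> smooth_on W (fld u)"
  using c unfolding smooth_spacetime_def fld_def[abs_def] case_prod_unfold by blast

text \<open>Replaces coordinate derivatives at a frozen time by directional derivatives on the open
  set \<open>W\<close>, where spatial and time derivatives are handled alike.\<close>

lemma slice_pderiv:
  assumes F: "smooth_on W F" and p: "p \<in> W" and f: "\<And>y. y \<in> V \<Longrightarrow> f y = F (fst p, y)"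
  shows "pderiv_at i f (snd p) = dd (space_dir i) F p"
proof -
  have y: "snd p \<in> V" using p by auto
  have "pderiv_at i f (snd p) = dd (axis i 1) (\<lambda>y. F (fst p, y)) (snd p)"
    unfolding pderiv_at_dd by (rule dd_cong_open[OF open_V y f])
  also have "\<dots> = dd (space_dir i) F p"
    using dd_slice(2)[of F "fst p" "snd p"] smooth_on_differentiable[OF open_W F p]
    by (simp add: space_dir_def)
  finally show ?thesis .
qed

lemma smooth_Gam: "smooth_on W (Gam m i j)"
  unfolding Gam_def[abs_def]
  by (rule smooth_on_snd[OF open_W open_V smooth_on_christoffel[OF open_V smooth_metric[OF c] metric_det[OF c]]]) auto

lemma T_Suc:
  assumes sm: "\<And>js. length js = k \<Longrightarrow> smooth_on W (T u k js)" and len: "length is = k" and p: "p \<in> W"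
  shows "T u (Suc k) (i # is) p =
    dd (space_dir i) (T u k is) p - (\<Sum>a<k. \<Sum>m\<in>UNIV. Gam m i (is ! a) p * T u k (is[a := m]) p)"
proof -
  have "pderiv_at i (iter_cov_deriv (g c) k (in_chart c (u (fst p))) is) (snd p) = dd (space_dir i) (T u k is) p"
    by (rule slice_pderiv[OF sm[OF len] p]) (simp add: T_def)
  then show ?thesis using len by (simp add: T_def Gam_def)
qed

lemma smooth_T:
  assumes "smooth_on W (fld u)" "length is = k"
  shows "smooth_on W (T u k is)"
  using assms(2)
proof (induction k arbitrary: "is")
  case 0
  then show ?case using assms(1) by (simp add: T_def[abs_def] fld_def[abs_def])
next
  case (Suc k)
  then obtain i js where is_eq: "is = i # js" and len: "length js = k" by (auto simp: length_Suc_conv)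
  have "smooth_on W (\<lambda>p. dd (space_dir i) (T u k js) p - (\<Sum>a<k. \<Sum>m\<in>UNIV. Gam m i (js ! a) p * T u k (js[a := m]) p))"
    using len by (intro smooth_on_diff smooth_on_dd smooth_on_sum smooth_on_mult smooth_Gam Suc.IH open_W) auto
  then show ?case
    unfolding is_eq by (rule smooth_on_cong[THEN iffD1, rotated]) (use T_Suc[OF Suc.IH len] in auto)
qed

lemma T_1:
  assumes "smooth_on W (fld u)" "p \<in> W"
  shows "T u (Suc 0) [j] p = dd (space_dir j) (fld u) p"
  using T_Suc[of 0 u "[]", OF smooth_T[OF assms(1)] _ assms(2)] by (simp add: T_def[abs_def] fld_def[abs_def])

lemma smooth_xi: "smooth_on W (\<lambda>p. \<xi> c (snd p) $ j)"
proof -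
  have "smooth_on V (\<xi> c)" using closed c unfolding closed_one_form_def by blast
  then show ?thesis by (intro smooth_on_snd[OF open_W open_V smooth_on_vec_nth[OF open_V]]) auto
qed

lemma om_eq:
  assumes "smooth_on W (fld u)" "p \<in> W"
  shows "om u j p = \<xi> c (snd p) $ j + dd (space_dir j) (fld u) p"
  using slice_pderiv[OF assms, of "in_chart c (u (fst p))" j]
  by (simp add: om_def add_differential_def fld_def)

lemma smooth_om: "smooth_on W (fld u) \<Longrightarrow> smooth_on W (om u j)"
  by (rule smooth_on_cong[THEN iffD2, OF om_eq]) (auto intro!: smooth_on_add smooth_on_dd smooth_xi open_W)

lemma chi_eq:
  assumes "smooth_on W (fld u)" "p \<in> W"
  shows "chi u i j p = dd (space_dir i) (om u j) p - (\<Sum>m\<in>UNIV. Gam m i j p * om u m p)"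
  using slice_pderiv[OF smooth_om[OF assms(1)] assms(2), of "\<lambda>y. add_differential \<xi> (u (fst p)) c y $ j" j i]
  by (simp add: chi_def cov_matrix_def om_def Gam_def)

lemma smooth_chi: "smooth_on W (fld u) \<Longrightarrow> smooth_on W (chi u i j)"
  by (rule smooth_on_cong[THEN iffD2, OF chi_eq])
    (auto intro!: smooth_on_diff smooth_on_dd smooth_on_sum smooth_on_mult smooth_om smooth_Gam open_W)

lemma eta_eq: "eta u p $ i $ j = g c (snd p) $ i $ j +
    (\<Sum>k\<in>UNIV. \<Sum>l\<in>UNIV. chi u i k p * matrix_inv (g c (snd p)) $ k $ l * chi u j l p)"
  by (simp add: eta_def graph_metric_def chi_def)

lemma eta_sym:
  assumes "snd p \<in> V"
  shows "transpose (eta u p) = eta u p"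
proof -
  have "transpose (g c (snd p)) $ i $ j = g c (snd p) $ i $ j" for i j
    using metric_sym[OF c assms] by simp
  then have "g c (snd p) $ j $ i = g c (snd p) $ i $ j" for i j by (simp add: transpose_def)
  moreover have "(\<Sum>k\<in>UNIV. \<Sum>l\<in>UNIV. chi u j k p * matrix_inv (g c (snd p)) $ k $ l * chi u i l p) =
      (\<Sum>k\<in>UNIV. \<Sum>l\<in>UNIV. chi u i k p * matrix_inv (g c (snd p)) $ k $ l * chi u j l p)" for i j
    by (subst sum.swap) (simp add: metric_inv_sym[OF c assms] mult_ac)
  ultimately show ?thesis by (simp add: vec_eq_iff transpose_def eta_eq)
qed

text \<open>The added term is the inverse metric evaluated on the contraction of \<chi> with
  \<open>w\<close>, hence nonnegative. So \<eta> inherits the ellipticity constant of g, uniformly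
  in \<open>u\<close>.\<close>

lemma eta_ge:
  assumes "snd p \<in> V"
  shows "w \<bullet> (g c (snd p) *v w) \<le> w \<bullet> (eta u p *v w)"
proof -
  define v where "v k = (\<Sum>i\<in>UNIV. chi u i k p * w $ i)" for k
  let ?gi = "\<lambda>k l. matrix_inv (g c (snd p)) $ k $ l"
  have "(\<Sum>i\<in>UNIV. \<Sum>j\<in>UNIV. (\<Sum>k\<in>UNIV. \<Sum>l\<in>UNIV. chi u i k p * ?gi k l * chi u j l p) * w $ i * w $ j)
      = (\<Sum>i\<in>UNIV. \<Sum>j\<in>UNIV. \<Sum>k\<in>UNIV. \<Sum>l\<in>UNIV. ?gi k l * (chi u i k p * w $ i) * (chi u j l p * w $ j))"
    by (simp add: sum_distrib_right sum_distrib_left mult_ac)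
  also have "\<dots> = (\<Sum>i\<in>UNIV. \<Sum>k\<in>UNIV. \<Sum>l\<in>UNIV. \<Sum>j\<in>UNIV. ?gi k l * (chi u i k p * w $ i) * (chi u j l p * w $ j))"
    by (rule sum.cong[OF refl sum_rotate])
  also have "\<dots> = (\<Sum>k\<in>UNIV. \<Sum>l\<in>UNIV. \<Sum>i\<in>UNIV. \<Sum>j\<in>UNIV. ?gi k l * (chi u i k p * w $ i) * (chi u j l p * w $ j))"
    by (rule sum_rotate)
  also have "\<dots> = (\<Sum>k\<in>UNIV. \<Sum>l\<in>UNIV. ?gi k l * v k * v l)"
    unfolding v_def by (simp add: sum_product sum_distrib_left mult_ac)
  finally have "w \<bullet> (eta u p *v w) = w \<bullet> (g c (snd p) *v w) + (\<Sum>k\<in>UNIV. \<Sum>l\<in>UNIV. ?gi k l * v k * v l)"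
    unfolding inner_matrix_form eta_eq by (simp add: distrib_right sum.distrib)
  then show ?thesis using metric_inv_nonneg[OF c assms, of v] by simp
qed

lemma det_eta_nz:
  assumes "snd p \<in> V"
  shows "det (eta u p) \<noteq> 0"
  by (rule pos_def_det) (use metric_pos[OF c assms] eta_ge[OF assms] less_le_trans in blast)

lemma ellipticity:
  obtains \<mu> where "0 < \<mu>" "\<And>y. y \<in> cball z r \<Longrightarrow> elliptic (g c y) \<mu>"
    "\<And>p u. p \<in> S \<Longrightarrow> elliptic (eta u p) \<mu>"
proof -
  obtain \<mu> where \<mu>: "0 < \<mu>" "\<And>y w. y \<in> cball z r \<Longrightarrow> \<mu> * (w \<bullet> w) \<le> w \<bullet> (g c y *v w)"
    using compact_ellipticity[OF compact_cball continuous_on_subset[OF continuous_metric[OF c] cball_V]]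
      metric_pos[OF c] cball_V by (metis subsetD)
  show ?thesis
  proof (rule that[OF \<mu>(1)])
    show "elliptic (g c y) \<mu>" if "y \<in> cball z r" for y
      using \<mu>(1) \<mu>(2)[OF that] metric_sym[OF c] cball_V that by unfold_locales auto
    show "elliptic (eta u p) \<mu>" if "p \<in> S" for p u
    proof
      have p: "snd p \<in> cball z r" "snd p \<in> V" using that ball_V by auto
      show "transpose (eta u p) = eta u p" by (rule eta_sym[OF p(2)])
      show "0 < \<mu>" by (rule \<mu>(1))
      show "\<mu> * (w \<bullet> w) \<le> w \<bullet> (eta u p *v w)" for w
        using \<mu>(2)[OF p(1), of w] eta_ge[OF p(2), of w u] by linarith
    qed
  qed
qed

section \<open>The coefficients as regular families indexed by u\<close>

lemma Reg_fixed:
  fixes h :: "real^'n \<Rightarrow> 'f::real_normed_vector"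
  assumes "smooth_on V h"
  shows "Reg True B k P S (\<lambda>u p. h (snd p))"
  by (rule Reg_lift[OF open_S open_V assms _ cball_V]) auto

lemma Reg_Gam: "Reg True B k P S (\<lambda>u. Gam m i j)"
  unfolding Gam_def[abs_def]
  by (rule Reg_fixed[OF smooth_on_christoffel[OF open_V smooth_metric[OF c] metric_det[OF c]]])

lemma Reg_eta:
  assumes "\<And>i j. Reg True B k P S (\<lambda>u. chi u i j)"
  shows "Reg True B k P S (\<lambda>u p. eta u p $ i $ j)"
  unfolding eta_eq
  by (intro Reg_add Reg_sum Reg_mult open_S assms Reg_fixed smooth_metric[OF c]
      smooth_on_matrix_inv[OF open_V smooth_metric[OF c] metric_det[OF c]])

text \<open>The determinant of \<eta> is bounded away from zero uniformly in \<open>u\<close>,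
  because the constant in \<open>ellipticity\<close> comes from g alone.\<close>

lemma Reg_ac:
  assumes "\<And>i j. Reg True B k P S (\<lambda>u. chi u i j)"
  shows "Reg True B k P S (\<lambda>u. ac u i j)"
  unfolding ac_def[abs_def]
proof (rule Reg_matrix_inv[OF open_S Reg_eta[OF assms]])
  show "det (eta u p) \<noteq> 0" if "p \<in> S" for u p
    by (rule det_eta_nz) (use that ball_V in auto)
  obtain \<mu> where \<mu>: "0 < \<mu>" "\<And>p u. p \<in> S \<Longrightarrow> elliptic (eta u p) \<mu>" using ellipticity by metis
  show "\<exists>m>0. \<forall>u\<in>P. \<forall>p\<in>S. m \<le> \<bar>det (eta u p)\<bar>"
    using elliptic.det_lower[OF \<mu>(2)] \<mu>(1)
    by (intro exI[of _ "inverse (fact CARD('n) * (1 / \<mu>) ^ CARD('n))"]) auto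
qed

lemma Reg_bc:
  assumes "\<And>i j. Reg True B k P S (\<lambda>u. chi u i j)"
  shows "Reg True B k P S (\<lambda>u. bc u m)"
  unfolding bc_def[abs_def]
  by (intro Reg_uminus Reg_sum Reg_mult open_S Reg_ac assms Reg_Gam)

lemma smooth_ac:
  assumes "smooth_on W (fld u)"
  shows "smooth_on W (ac u i j)"
proof -
  have "smooth_on W (\<lambda>p. eta u p $ i $ j)" for i j
    unfolding eta_eq
    by (intro smooth_on_add smooth_on_sum smooth_on_mult open_W smooth_chi assms smooth_on_snd[OF open_W open_V]
        smooth_metric[OF c] smooth_on_matrix_inv[OF open_V smooth_metric[OF c] metric_det[OF c]]) auto
  moreover have "det (eta u p) \<noteq> 0" if "p \<in> W" for p
    by (rule det_eta_nz) (use that in auto)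
  ultimately show ?thesis unfolding ac_def[abs_def]
    by (intro smooth_on_matrix_inv[OF open_W]) blast+
qed

lemma smooth_bc: "smooth_on W (fld u) \<Longrightarrow> smooth_on W (bc u m)"
  unfolding bc_def[abs_def]
  by (intro smooth_on_uminus smooth_on_sum smooth_on_mult open_W smooth_ac smooth_Gam)

section \<open>Bounds over the class of admissible flows\<close>

definition Dc :: "(real \<Rightarrow> 'a \<Rightarrow> real) \<Rightarrow> real \<times> (real^'n) \<Rightarrow> complex" where
  "Dc u p = det (\<chi> i j. complex_of_real (g c (snd p) $ i $ j) + \<i> * complex_of_real (chi u i j p))"

text \<open>The index set of the families. Order zero is left out since the size of \<open>u\<close>
  is not controlled, and the last condition is the flow equation in exponential form, free of any
  choice of the angle. \<open>K\<close> bounds squared norms.\<close>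

definition adm :: "real \<Rightarrow> (real \<Rightarrow> 'a \<Rightarrow> real) set" where
  "adm K = {u. smooth_on W (fld u) \<and>
     (\<forall>t>0. \<forall>k\<in>{1..4}. \<forall>y\<in>ball z r. tensor_norm_sq (g c) k (iter_cov_deriv (g c) k (in_chart c (u t))) y \<le> K) \<and>
     (\<forall>p\<in>S. exp (\<i> * complex_of_real (dd time_dir (fld u) p)) =
        Dc u p / complex_of_real (sqrt (det (g c (snd p))) * sqrt (det (eta u p))))}"

lemma adm_smooth: "u \<in> adm K \<Longrightarrow> smooth_on W (fld u)"
  unfolding adm_def by blast

text \<open>On the closed ball the inverse metric is uniformly elliptic, so an invariant norm bound
  becomes a bound on each component.\<close>

lemma T_bounded:
  assumes k: "1 \<le> k" "k \<le> 4" and len: "length is = k"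
  shows "\<exists>M. \<forall>u\<in>adm K. \<forall>p\<in>S. norm (T u k is p) \<le> M"
proof -
  obtain \<mu> where \<mu>: "0 < \<mu>" "\<And>y. y \<in> cball z r \<Longrightarrow> elliptic (g c y) \<mu>" using ellipticity by metis
  have "compact (g c ` cball z r)"
    by (intro compact_continuous_image continuous_on_subset[OF continuous_metric[OF c] cball_V]) simp
  then obtain L where "\<forall>x\<in>g c ` cball z r. norm x \<le> L" and L0: "L > 0"
    using compact_imp_bounded bounded_pos[of "g c ` cball z r"] by metis
  then have L: "\<And>y. y \<in> cball z r \<Longrightarrow> norm (g c y) \<le> L" "L > 0" by auto
  define \<nu> where "\<nu> = \<mu> / (real CARD('n) * (real CARD('n) * L))\<^sup>2"
  have \<nu>: "\<nu> > 0" unfolding \<nu>_def using \<mu>(1) L(2) by simp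
  have "norm (T u k is p) \<le> sqrt (K / \<nu> ^ k)" if u: "u \<in> adm K" and p: "p \<in> S" for u p
  proof -
    have y: "snd p \<in> cball z r" "snd p \<in> ball z r" "0 < fst p" using p by auto
    interpret elliptic "g c (snd p)" \<mu> by (rule \<mu>(2)[OF y(1)])
    have entry: "\<bar>g c (snd p) $ i $ j\<bar> \<le> L" for i j
      using component_le_norm_cart[of "g c (snd p) $ i" j] Finite_Cartesian_Product.norm_nth_le[of "g c (snd p)" i] L(1)[OF y(1)]
      by linarith
    have "\<nu> ^ k * (T u k is p)\<^sup>2 \<le> tensor_norm_sq (g c) k (iter_cov_deriv (g c) k (in_chart c (u (fst p)))) (snd p)"
      unfolding tensor_norm_sq_form T_def
      by (rule tensor_form_lower[OF sym_inv less_imp_le[OF \<nu>] inv_elliptic[OF entry L(2), folded \<nu>_def] len])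
    also have "\<dots> \<le> K" using u y k unfolding adm_def by auto
    finally have "(T u k is p)\<^sup>2 \<le> K / \<nu> ^ k" using \<nu> by (simp add: field_simps)
    then show ?thesis using real_le_rsqrt[of "\<bar>T u k is p\<bar>"] by simp
  qed
  then show ?thesis by blast
qed

text \<open>A partial derivative of a component is a component of the next covariant derivative plus
  Christoffel terms of the same order. Every derivative uses up one order, and
  \<open>k + j \<le> 4\<close> is the budget.\<close>

lemma Reg_T:
  assumes "1 \<le> k" "k + j \<le> 4" "length is = k"
  shows "Reg True (range space_dir) j (adm K) S (\<lambda>u. T u k is)"
  using assms
proof (induction j arbitrary: k "is")
  case 0
  have "continuous_on S (T u k is)" if "u \<in> adm K" for u
    using smooth_on_continuous[OF smooth_on_subset[OF smooth_T[OF adm_smooth[OF that] 0(3)] S_W]] .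
  then show ?case using T_bounded[of k "is" K] 0 by (simp add: Reg0_def)
next
  case (Suc j)
  show ?case
  proof (rule Reg_smooth_Suc[OF open_S])
    show "smooth_on S (T u k is)" if "u \<in> adm K" for u
      by (rule smooth_on_subset[OF smooth_T[OF adm_smooth[OF that] Suc.prems(3)] S_W])
    show "\<exists>M. \<forall>u\<in>adm K. \<forall>p\<in>S. norm (T u k is p) \<le> M"
      using T_bounded[of k "is" K] Suc.prems by auto
    fix b :: "real \<times> (real^'n)" assume "b \<in> range space_dir"
    then obtain i where b: "b = space_dir i" by blast
    have "Reg True (range space_dir) j (adm K) S
        (\<lambda>u p. T u (Suc k) (i # is) p + (\<Sum>a<k. \<Sum>m\<in>UNIV. Gam m i (is ! a) p * T u k (is[a := m]) p))"
      using Suc.prems by (intro Reg_add Reg_sum Reg_mult open_S Reg_Gam Suc.IH) auto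
    then show "Reg True (range space_dir) j (adm K) S (\<lambda>u. dd b (T u k is))"
      unfolding b
      by (rule Reg_cong[THEN iffD1, OF open_S, rotated])
        (simp add: T_Suc[OF smooth_T[OF adm_smooth[of _ K]] Suc.prems(3) SW])
  qed
qed

text \<open>One of the four orders is spent on du, which leaves three spatial derivatives here and
  two for \<chi>.\<close>

lemma Reg_om: "Reg True (range space_dir) (Suc (Suc (Suc 0))) (adm K) S (\<lambda>u. om u j)"
proof -
  have "smooth_on V (\<lambda>y. \<xi> c y $ j)"
    using closed c unfolding closed_one_form_def by (intro smooth_on_vec_nth[OF open_V]) blast
  then have "Reg True (range space_dir) (Suc (Suc (Suc 0))) (adm K) S (\<lambda>u p. \<xi> c (snd p) $ j + T u (Suc 0) [j] p)"
    by (intro Reg_add open_S Reg_fixed Reg_T) auto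
  then show ?thesis
    by (rule Reg_cong[THEN iffD1, OF open_S, rotated])
      (simp only: om_eq[OF adm_smooth[of _ K] SW] T_1[OF adm_smooth[of _ K] SW])
qed

lemma Reg_chi: "Reg True (range space_dir) (Suc (Suc 0)) (adm K) S (\<lambda>u. chi u i j)"
proof -
  have "Reg True (range space_dir) (Suc (Suc 0)) (adm K) S (\<lambda>u. dd (space_dir i) (om u j))"
    using Reg_om[of K j] unfolding Reg.simps(2)[of _ _ "Suc (Suc 0)"] by blast
  then have "Reg True (range space_dir) (Suc (Suc 0)) (adm K) S
      (\<lambda>u p. dd (space_dir i) (om u j) p - (\<Sum>m\<in>UNIV. Gam m i j p * om u m p))"
    by (intro Reg_diff Reg_sum Reg_mult open_S Reg_Gam Reg_Suc[OF Reg_om])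
  then show ?thesis
    by (rule Reg_cong[THEN iffD1, OF open_S, rotated])
      (simp only: chi_eq[OF adm_smooth[of _ K] SW])
qed

text \<open>Since the exponential has modulus one, \<open>Dc\<close> has the modulus of the
  denominator. Squaring and using E = 1 / cnj E removes the denominator with its square roots,
  leaving a rational expression in \<chi> and g.\<close>

lemma Dc_norm:
  assumes "u \<in> adm K" "p \<in> S"
  shows "norm (Dc u p) = sqrt (\<bar>det (g c (snd p))\<bar> * \<bar>det (eta u p)\<bar>)"
    and "exp (\<i> * complex_of_real (2 * dd time_dir (fld u) p)) = Dc u p * inverse (cnj (Dc u p))"
proof -
  let ?\<rho> = "sqrt (det (g c (snd p))) * sqrt (det (eta u p))"
  let ?E = "exp (\<i> * complex_of_real (dd time_dir (fld u) p))"
  have E: "?E = Dc u p / complex_of_real ?\<rho>" using assms unfolding adm_def by blast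
  have n: "norm ?E = 1" by (rule norm_exp_i_times)
  \<comment> \<open>A zero denominator would make the quotient 0, which does not have modulus
    one.\<close>
  then have \<rho>: "?\<rho> \<noteq> 0" unfolding E by (auto simp: divide_simps)
  have D: "Dc u p = ?E * complex_of_real ?\<rho>" unfolding E using \<rho> by simp
  have "norm (Dc u p) = norm ?E * \<bar>?\<rho>\<bar>" unfolding D norm_mult norm_of_real ..
  then show "norm (Dc u p) = sqrt (\<bar>det (g c (snd p))\<bar> * \<bar>det (eta u p)\<bar>)"
    unfolding n by (simp add: real_sqrt_mult real_sqrt_abs' abs_mult)
  have EE: "?E * cnj ?E = 1" using n by (simp add: complex_norm_square[symmetric])
  have "exp (\<i> * complex_of_real (2 * dd time_dir (fld u) p)) = ?E * ?E"
    by (simp add: exp_add[symmetric] algebra_simps)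
  also have "\<dots> = ?E * inverse (cnj ?E)"
  proof -
    have "cnj ?E \<noteq> 0" by simp
    then have "?E = inverse (cnj ?E)" using EE by (simp add: field_simps)
    then show ?thesis by simp
  qed
  also have "\<dots> = Dc u p * inverse (cnj (Dc u p))"
    unfolding D using \<rho> by (simp add: field_simps)
  finally show "exp (\<i> * complex_of_real (2 * dd time_dir (fld u) p)) = Dc u p * inverse (cnj (Dc u p))" .
qed

text \<open>By \<open>Dc_norm\<close> the squared modulus is the product of the moduli of two
  determinants, each bounded below by ellipticity.\<close>

lemma Dc_lower: "\<exists>m>0. \<forall>u\<in>adm K. \<forall>p\<in>S. m \<le> norm (Dc u p)"
proof -
  obtain \<mu> where \<mu>: "0 < \<mu>" "\<And>y. y \<in> cball z r \<Longrightarrow> elliptic (g c y) \<mu>"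
    "\<And>p u. p \<in> S \<Longrightarrow> elliptic (eta u p) \<mu>" using ellipticity by blast
  let ?m = "inverse (fact CARD('n) * (1 / \<mu>) ^ CARD('n)) :: real"
  have m: "?m > 0" using \<mu>(1) by simp
  have "?m \<le> norm (Dc u p)" if "u \<in> adm K" "p \<in> S" for u p
  proof -
    have 1: "?m \<le> \<bar>det (g c (snd p))\<bar>" "?m \<le> \<bar>det (eta u p)\<bar>"
      using elliptic.det_lower[OF \<mu>(2)[of "snd p"]] elliptic.det_lower[OF \<mu>(3)] that by auto
    have "?m = sqrt (?m * ?m)" using m by simp
    also have "\<dots> \<le> sqrt (\<bar>det (g c (snd p))\<bar> * \<bar>det (eta u p)\<bar>)"
      using 1 m by (intro real_sqrt_le_mono mult_mono) auto
    finally show ?thesis unfolding Dc_norm[OF that] .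
  qed
  then show ?thesis using m by blast
qed

text \<open>Differentiating \<open>exp (2 i u\<^sub>t) = D / cnj D\<close> bounds the first two spatial derivatives of
  \<open>u\<^sub>t\<close> by the first two derivatives of \<open>\<chi>\<close>.\<close>

lemma Reg_angle: "Reg True (range space_dir) (Suc 0) (adm K) S (\<lambda>u. dd (space_dir i) (dd time_dir (fld u)))"
proof -
  define q where "q u p = Dc u p * inverse (cnj (Dc u p))" for u p
  obtain m where m: "m > 0" "\<forall>u\<in>adm K. \<forall>p\<in>S. m \<le> norm (Dc u p)" using Dc_lower by blast
  have D: "Reg True (range space_dir) (Suc (Suc 0)) (adm K) S Dc"
  proof -
    have "Reg True (range space_dir) (Suc (Suc 0)) (adm K) S
        (\<lambda>u p. complex_of_real (g c (snd p) $ i $ j) + \<i> * complex_of_real (chi u i j p))" for i j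
      by (intro Reg_add Reg_mult Reg_const open_S Reg_linear[OF open_S bounded_linear_of_real] Reg_chi
          Reg_fixed smooth_metric[OF c])
    then show ?thesis unfolding Dc_def[abs_def] by (intro Reg_det open_S) (simp only: vec_lambda_beta)
  qed
  have cD: "Reg True (range space_dir) (Suc (Suc 0)) (adm K) S (\<lambda>u p. cnj (Dc u p))"
    by (rule Reg_linear[OF open_S bounded_linear_cnj D])
  have "Reg True (range space_dir) (Suc (Suc 0)) (adm K) S (\<lambda>u p. inverse (cnj (Dc u p)))"
  proof (rule Reg_inverse[OF open_S cD])
    show "cnj (Dc u p) \<noteq> 0" if "u \<in> adm K" "p \<in> S" for u p
    proof -
      have "m \<le> norm (Dc u p)" using m(2) that by blast
      then show ?thesis using m(1) by auto
    qed
    show "\<exists>m>0. \<forall>u\<in>adm K. \<forall>p\<in>S. m \<le> norm (cnj (Dc u p))"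
      using m by (intro exI[of _ m]) simp
  qed
  then have q: "Reg True (range space_dir) (Suc (Suc 0)) (adm K) S q"
    unfolding q_def[abs_def] by (intro Reg_mult open_S D)
  have q1: "norm (q u p) = 1" if "u \<in> adm K" "p \<in> S" for u p
    using Dc_norm(2)[OF that] norm_exp_i_times unfolding q_def by metis
  have qi: "Reg True (range space_dir) (Suc 0) (adm K) S (\<lambda>u p. inverse (q u p))"
  proof (rule Reg_inverse[OF open_S Reg_Suc[OF q]])
    show "q u p \<noteq> 0" if "u \<in> adm K" "p \<in> S" for u p
      using q1[OF that] by auto
    show "\<exists>m>0. \<forall>u\<in>adm K. \<forall>p\<in>S. m \<le> norm (q u p)"
      by (intro exI[of _ 1] conjI ballI) (simp_all add: q1)
  qed
  have dq: "Reg True (range space_dir) (Suc 0) (adm K) S (\<lambda>u. dd (space_dir i) (q u))"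
    using q unfolding Reg.simps(2)[of _ _ "Suc 0"] by blast
  \<comment> \<open>A logarithmic derivative: for q = exp (2 i \<theta>) one has dq / q = 2 i
    d\<theta>. No branch of the logarithm has to be chosen.\<close>
  have "Reg True (range space_dir) (Suc 0) (adm K) S (\<lambda>u p. Re (dd (space_dir i) (q u) p * inverse (q u p) * inverse (2 * \<i>)))"
    by (intro Reg_linear[OF open_S bounded_linear_Re] Reg_mult open_S dq qi Reg_const)
  then show ?thesis
  proof (rule Reg_cong[THEN iffD1, OF open_S, rotated])
    fix u p assume u: "u \<in> adm K" and p: "p \<in> S"
    let ?\<theta> = "dd time_dir (fld u)"
    have d: "?\<theta> differentiable at p"
      using smooth_on_differentiable[OF open_W smooth_on_dd[OF open_W adm_smooth[OF u]]] S_W p by blast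
    have "((\<lambda>p. \<i> * complex_of_real (2 * ?\<theta> p)) has_derivative (\<lambda>b. \<i> * complex_of_real (2 * dd b ?\<theta> p))) (at p)"
      by (intro has_derivative_mult_right has_derivative_of_real dd_has_derivative d)
    from has_derivative_compose[OF this DERIV_exp[unfolded has_field_derivative_def]]
    have "((\<lambda>p. exp (\<i> * complex_of_real (2 * ?\<theta> p))) has_derivative
        (\<lambda>b. exp (\<i> * complex_of_real (2 * ?\<theta> p)) * (\<i> * complex_of_real (2 * dd b ?\<theta> p)))) (at p)" .
    from dd_eqI[OF this, of "space_dir i"]
    have "dd (space_dir i) (\<lambda>p. exp (\<i> * complex_of_real (2 * ?\<theta> p))) p =
        q u p * (\<i> * complex_of_real (2 * dd (space_dir i) ?\<theta> p))"
      unfolding Dc_norm(2)[OF u p] q_def .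
    moreover have "dd (space_dir i) (\<lambda>p. exp (\<i> * complex_of_real (2 * ?\<theta> p))) p = dd (space_dir i) (q u) p"
      by (rule dd_cong_open[OF open_S p]) (simp only: Dc_norm(2)[OF u] q_def)
    moreover have "q u p \<noteq> 0" using q1[OF u p] by auto
    ultimately have "dd (space_dir i) (q u) p * inverse (q u p) * inverse (2 * \<i>) = complex_of_real (dd (space_dir i) ?\<theta> p)"
      by (simp add: field_simps)
    then show "Re (dd (space_dir i) (q u) p * inverse (q u p) * inverse (2 * \<i>)) = dd (space_dir i) ?\<theta> p"
      by simp
  qed
qed

text \<open>The form \<xi> does not depend on time, so only d(u_t) remains after exchanging
  derivatives.\<close>

lemma time_om:
  assumes "u \<in> adm K" "p \<in> S"
  shows "dd time_dir (om u j) p = dd (space_dir j) (dd time_dir (fld u)) p"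
proof -
  note sm = adm_smooth[OF assms(1)]
  have p: "p \<in> W" using assms(2) S_W by blast
  have dx: "(\<lambda>y. \<xi> c y $ j) differentiable at (snd p)"
    using closed c p unfolding closed_one_form_def
    by (intro smooth_on_differentiable[OF open_V] smooth_on_vec_nth[OF open_V]) auto
  have x0: "dd time_dir (\<lambda>p. \<xi> c (snd p) $ j) p = 0"
    using dd_snd[OF dx, of time_dir] linear_0[OF linear_dd[OF dx]] by (simp add: time_dir_def)
  have "dd time_dir (om u j) p = dd time_dir (\<lambda>p. \<xi> c (snd p) $ j + dd (space_dir j) (fld u) p) p"
    by (rule dd_cong_open[OF open_W p om_eq[OF sm]])
  also have "\<dots> = dd time_dir (\<lambda>p. \<xi> c (snd p) $ j) p + dd time_dir (dd (space_dir j) (fld u)) p"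
    by (intro dd_add smooth_on_differentiable[OF open_W _ p] smooth_xi smooth_on_dd open_W sm)
  also have "\<dots> = dd (space_dir j) (dd time_dir (fld u)) p"
    unfolding x0 by (simp add: dd_commute[OF open_W sm p])
  finally show ?thesis .
qed

lemma Reg_om_time: "Reg True {time_dir} (Suc 0) (adm K) S (\<lambda>u. om u j)"
proof (rule Reg_smooth_Suc[OF open_S])
  show "smooth_on S (om u j)" if "u \<in> adm K" for u
    by (rule smooth_on_subset[OF smooth_om[OF adm_smooth[OF that]] S_W])
  show "\<exists>M. \<forall>u\<in>adm K. \<forall>p\<in>S. norm (om u j p) \<le> M"
    using Reg_Reg0[OF Reg_om[of K j]] unfolding Reg0_def by blast
  fix b assume b: "b \<in> {time_dir :: real \<times> (real^'n)}"
  have "Reg True {time_dir} 0 (adm K) S (\<lambda>u. dd (space_dir j) (dd time_dir (fld u)))"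
    using Reg_Reg0[OF Reg_angle[of K j]] by simp
  then show "Reg True {time_dir} 0 (adm K) S (\<lambda>u. dd b (om u j))"
    by (rule Reg_cong[THEN iffD1, OF open_S, rotated]) (use b time_om in auto)
qed

text \<open>The leading part of the time derivative of \<chi> is the second spatial derivative of
  u_t, the highest order that \<open>Reg_angle\<close> provides.\<close>

lemma Reg_chi_time: "Reg True {time_dir} (Suc 0) (adm K) S (\<lambda>u. chi u i j)"
proof -
  have "Reg True {time_dir} (Suc 0) (adm K) S (\<lambda>u. dd (space_dir i) (om u j))"
  proof (rule Reg_smooth_Suc[OF open_S])
    show "smooth_on S (dd (space_dir i) (om u j))" if "u \<in> adm K" for u
      by (rule smooth_on_subset[OF smooth_on_dd[OF open_W smooth_om[OF adm_smooth[OF that]]] S_W])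
    show "\<exists>M. \<forall>u\<in>adm K. \<forall>p\<in>S. norm (dd (space_dir i) (om u j) p) \<le> M"
    proof -
      have "Reg True (range space_dir) (Suc (Suc 0)) (adm K) S (\<lambda>u. dd (space_dir i) (om u j))"
        using Reg_om[of K j] unfolding Reg.simps(2)[of _ _ "Suc (Suc 0)"] by blast
      from Reg_Reg0[OF this] show ?thesis unfolding Reg0_def by blast
    qed
    fix b assume b: "b \<in> {time_dir :: real \<times> (real^'n)}"
    have "Reg True (range space_dir) 0 (adm K) S (\<lambda>u. dd (space_dir i) (dd (space_dir j) (dd time_dir (fld u))))"
      using Reg_angle[of K j] unfolding Reg.simps(2) by blast
    then have "Reg True {time_dir} 0 (adm K) S (\<lambda>u. dd (space_dir i) (dd (space_dir j) (dd time_dir (fld u))))"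
      by simp
    then show "Reg True {time_dir} 0 (adm K) S (\<lambda>u. dd b (dd (space_dir i) (om u j)))"
    proof (rule Reg_cong[THEN iffD1, OF open_S, rotated])
      fix u p assume u: "u \<in> adm K" and p: "p \<in> S"
      have "dd b (dd (space_dir i) (om u j)) p = dd (space_dir i) (dd time_dir (om u j)) p"
        using b dd_commute[OF open_W smooth_om[OF adm_smooth[OF u]]] p S_W by blast
      also have "\<dots> = dd (space_dir i) (dd (space_dir j) (dd time_dir (fld u))) p"
        by (rule dd_cong_open[OF open_S p time_om[OF u]])
      finally show "dd (space_dir i) (dd (space_dir j) (dd time_dir (fld u))) p = dd b (dd (space_dir i) (om u j)) p" by simp
    qed
  qed
  then have "Reg True {time_dir} (Suc 0) (adm K) S
      (\<lambda>u p. dd (space_dir i) (om u j) p - (\<Sum>m\<in>UNIV. Gam m i j p * om u m p))"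
    by (intro Reg_diff Reg_sum Reg_mult open_S Reg_Gam Reg_om_time)
  then show ?thesis
    by (rule Reg_cong[THEN iffD1, OF open_S, rotated])
      (simp only: chi_eq[OF adm_smooth[of _ K] SW])
qed

text \<open>The quantifier order is the point: \<open>M\<close> and \<mu> depend on the piece and on
  \<open>K\<close>, not on \<open>u\<close>. Upper bounds on \<eta> are needed as well, to make its
  inverse elliptic.\<close>

lemma coefficients: "\<exists>M>0. \<exists>\<mu>>0. \<forall>u\<in>adm K. \<forall>p\<in>S. bounded_coeffs M \<mu> (ac u) (bc u) p"
proof -
  define Bd where "Bd h \<longleftrightarrow> (\<exists>M. \<forall>u\<in>adm K. \<forall>p\<in>S. norm (h u p) \<le> (M::real))" for h :: "(real \<Rightarrow> 'a \<Rightarrow> real) \<Rightarrow> real \<times> (real^'n) \<Rightarrow> real"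
  have Bd0: "Bd h" if "Reg True B k (adm K) S h" for B k h
    using Reg_Reg0[OF that] unfolding Reg0_def Bd_def by blast
  have fam: "\<exists>M. \<forall>i. \<forall>u\<in>adm K. \<forall>p\<in>S. norm (h i u p) \<le> M" if "\<And>i. Bd (h i)"
    for h :: "'i::finite \<Rightarrow> _"
    using uniform_finite[of "adm K" S h] that unfolding Bd_def by blast
  note a2 = Reg_ac[OF Reg_chi[of K]] and b2 = Reg_bc[OF Reg_chi[of K]]
  note at = Reg_ac[OF Reg_chi_time[of K]] and bt = Reg_bc[OF Reg_chi_time[of K]]
  have a1: "Reg True (range space_dir) (Suc 0) (adm K) S (\<lambda>u. dd (space_dir k) (ac u i j))" for i j k
    using a2[of i j] unfolding Reg.simps(2)[of _ _ "Suc 0"] by blast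
  have "Bd (\<lambda>u. dd (space_dir k) (dd (space_dir l) (ac u i j)))" for i j k l
    using a1[of l i j] unfolding Reg.simps(2)[of _ _ 0] by (intro Bd0[of "range space_dir" 0]) blast
  \<comment> \<open>All indices are packed into one element of a finite product type, so that one
    application of \<open>fam\<close> gives a bound common to all of them.\<close>
  then have "\<exists>M. \<forall>x. \<forall>u\<in>adm K. \<forall>p\<in>S.
      norm (dd (space_dir (fst (snd (snd x)))) (dd (space_dir (snd (snd (snd x)))) (ac u (fst x) (fst (snd x)))) p) \<le> M"
    by (rule fam)
  then obtain M1 where M1': "\<forall>x. \<forall>u\<in>adm K. \<forall>p\<in>S.
      norm (dd (space_dir (fst (snd (snd x)))) (dd (space_dir (snd (snd (snd x)))) (ac u (fst x) (fst (snd x)))) p) \<le> M1" ..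
  have M1: "norm (dd (space_dir k) (dd (space_dir l) (ac u i j)) p) \<le> M1" if "u \<in> adm K" "p \<in> S" for i j k l u p
    using M1'[rule_format, OF that, of "(i, j, k, l)"] by simp
  have "\<exists>M. \<forall>x. \<forall>u\<in>adm K. \<forall>p\<in>S. norm (dd (space_dir (fst x)) (ac u (fst (snd x)) (snd (snd x))) p) \<le> M"
    by (rule fam) (rule Bd0[OF a1])
  then obtain M2 where M2': "\<forall>x. \<forall>u\<in>adm K. \<forall>p\<in>S. norm (dd (space_dir (fst x)) (ac u (fst (snd x)) (snd (snd x))) p) \<le> M2" ..
  have M2: "norm (dd (space_dir k) (ac u i j) p) \<le> M2" if "u \<in> adm K" "p \<in> S" for i j k u p
    using M2'[rule_format, OF that, of "(k, i, j)"] by simp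
  have "\<exists>M. \<forall>x. \<forall>u\<in>adm K. \<forall>p\<in>S. norm (ac u (fst x) (snd x) p) \<le> M"
    by (rule fam) (rule Bd0[OF a2])
  then obtain M3 where M3': "\<forall>x. \<forall>u\<in>adm K. \<forall>p\<in>S. norm (ac u (fst x) (snd x) p) \<le> M3" ..
  have M3: "norm (ac u i j p) \<le> M3" if "u \<in> adm K" "p \<in> S" for i j u p
    using M3'[rule_format, OF that, of "(i, j)"] by simp
  obtain M4 where M4: "\<And>m u p. u \<in> adm K \<Longrightarrow> p \<in> S \<Longrightarrow> norm (bc u m p) \<le> M4"
    using fam[of "\<lambda>m u. bc u m"] Bd0[OF b2] by force
  have B5: "Bd (\<lambda>u. dd (space_dir k) (bc u m))" for m k
    using b2[of m] unfolding Reg.simps(2)[of _ _ "Suc 0"] by (intro Bd0[of "range space_dir" "Suc 0"]) blast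
  have "\<exists>M. \<forall>x. \<forall>u\<in>adm K. \<forall>p\<in>S. norm (dd (space_dir (fst x)) (bc u (snd x)) p) \<le> M"
    by (rule fam) (rule B5)
  then obtain M5 where M5': "\<forall>x. \<forall>u\<in>adm K. \<forall>p\<in>S. norm (dd (space_dir (fst x)) (bc u (snd x)) p) \<le> M5" ..
  have M5: "norm (dd (space_dir k) (bc u m) p) \<le> M5" if "u \<in> adm K" "p \<in> S" for m k u p
    using M5'[rule_format, OF that, of "(k, m)"] by simp
  have B6: "Bd (\<lambda>u. dd time_dir (ac u i j))" for i j
    using at[of i j] unfolding Reg.simps(2)[of _ _ 0] by (intro Bd0[of "{time_dir}" 0]) blast
  have "\<exists>M. \<forall>x. \<forall>u\<in>adm K. \<forall>p\<in>S. norm (dd time_dir (ac u (fst x) (snd x)) p) \<le> M"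
    by (rule fam) (rule B6)
  then obtain M6 where M6': "\<forall>x. \<forall>u\<in>adm K. \<forall>p\<in>S. norm (dd time_dir (ac u (fst x) (snd x)) p) \<le> M6" ..
  have M6: "norm (dd time_dir (ac u i j) p) \<le> M6" if "u \<in> adm K" "p \<in> S" for i j u p
    using M6'[rule_format, OF that, of "(i, j)"] by simp
  have "Bd (\<lambda>u. dd time_dir (bc u m))" for m
    using bt[of m] unfolding Reg.simps(2)[of _ _ 0] by (intro Bd0[of "{time_dir}" 0]) blast
  then obtain M7 where M7: "\<And>m u p. u \<in> adm K \<Longrightarrow> p \<in> S \<Longrightarrow> norm (dd time_dir (bc u m) p) \<le> M7"
    using fam[of "\<lambda>m u. dd time_dir (bc u m)"] by force
  have "\<exists>M. \<forall>x. \<forall>u\<in>adm K. \<forall>p\<in>S. norm (eta u p $ fst x $ snd x) \<le> M"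
    by (rule fam) (rule Bd0[OF Reg_eta[OF Reg_chi]])
  then obtain L where L': "\<forall>x. \<forall>u\<in>adm K. \<forall>p\<in>S. norm (eta u p $ fst x $ snd x) \<le> L" ..
  have L: "norm (eta u p $ i $ j) \<le> L" if "u \<in> adm K" "p \<in> S" for i j u p
    using L'[rule_format, OF that, of "(i, j)"] by simp
  obtain \<mu> where \<mu>: "0 < \<mu>" "\<And>p u. p \<in> S \<Longrightarrow> elliptic (eta u p) \<mu>" using ellipticity by metis
  define A where "A x = \<bar>x\<bar>" for x :: real
  define M where "M = 1 + A M1 + A M2 + A M3 + A M4 + A M5 + A M6 + A M7"
  have A: "x \<le> A x" "0 \<le> A x" for x unfolding A_def by auto
  note A7 = A[of M1] A[of M2] A[of M3] A[of M4] A[of M5] A[of M6] A[of M7]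
  have le: "x \<le> M1 \<Longrightarrow> x \<le> M" "x \<le> M2 \<Longrightarrow> x \<le> M" "x \<le> M3 \<Longrightarrow> x \<le> M" "x \<le> M4 \<Longrightarrow> x \<le> M"
    "x \<le> M5 \<Longrightarrow> x \<le> M" "x \<le> M6 \<Longrightarrow> x \<le> M" "x \<le> M7 \<Longrightarrow> x \<le> M" for x
    unfolding M_def using A7 by linarith+
  let ?\<nu> = "\<mu> / (real CARD('n) * (real CARD('n) * (1 + \<bar>L\<bar>)))\<^sup>2"
  have "bounded_coeffs M ?\<nu> (ac u) (bc u) p" if u: "u \<in> adm K" and p: "p \<in> S" for u p
  proof -
    interpret elliptic "eta u p" \<mu> by (rule \<mu>(2)[OF p])
    have "\<bar>eta u p $ i $ j\<bar> \<le> 1 + \<bar>L\<bar>" for i j using L[OF u p, of i j] by simp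
    then have ell': "?\<nu> * (\<Sum>i\<in>UNIV. w i * w i) \<le> (\<Sum>i\<in>UNIV. \<Sum>j\<in>UNIV. ac u i j p * w i * w j)" for w
      unfolding ac_def by (rule inv_elliptic) simp
    have sym': "ac u i j p = ac u j i p" for i j unfolding ac_def by (rule sym_inv)
    note bd = M1[OF u p, unfolded real_norm_def, THEN le(1)] M2[OF u p, unfolded real_norm_def, THEN le(2)]
        M3[OF u p, unfolded real_norm_def, THEN le(3)] M4[OF u p, unfolded real_norm_def, THEN le(4)]
        M5[OF u p, unfolded real_norm_def, THEN le(5)] M6[OF u p, unfolded real_norm_def, THEN le(6)]
        M7[OF u p, unfolded real_norm_def, THEN le(7)]
    show ?thesis
      unfolding bounded_coeffs_def by (intro conjI allI sym' ell' bd)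
  qed
  moreover have "M > 0" unfolding M_def using A7 by linarith
  moreover have "?\<nu> > 0" using \<mu>(1) by (simp add: add_pos_nonneg)
  ultimately show ?thesis by blast
qed

end

section \<open>The Li--Yau estimate in a chart\<close>

lemma bounded_coeffs_elliptic:
  "bounded_coeffs M \<mu> a b p \<Longrightarrow> \<mu> * (\<Sum>i\<in>UNIV. w i * w i) \<le> (\<Sum>i\<in>UNIV. \<Sum>j\<in>UNIV. a i j p * w i * w j)"
  unfolding bounded_coeffs_def by blast

text \<open>Here \<open>P\<close> and \<open>N\<close> stand for the sizes of the gradient and of the Hessian of \<open>f = ln v\<close>.\<close>

lemma harnack_scalar:
  fixes \<mu> C\<^sub>1 A B :: real
  assumes "0 < \<mu>" "0 < C\<^sub>1" "0 \<le> A" "0 \<le> B"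
  shows "\<exists>C>0. \<forall>P N Q H s. 0 \<le> P \<longrightarrow> 0 \<le> N \<longrightarrow> 0 < s \<longrightarrow> \<mu> * P\<^sup>2 \<le> Q \<longrightarrow>
    2 * \<mu>\<^sup>2 * N\<^sup>2 - C\<^sub>1 * (P * N + P\<^sup>2 + N + P) \<le> H / s \<longrightarrow> (Q + H) / 2 \<le> A * N + B * P \<longrightarrow>
    H \<le> C * (1 + 1 / s)"
proof -
  define D where "D = B\<^sup>2 / \<mu>"
  \<comment> \<open>Young's inequality with this weight charges the product P N with only \<mu>^2 /
    2 times N^2. The linear terms in N cost as much again, so \<mu>^2 N^2 survives out of the
    available 2 \<mu>^2 N^2.\<close>
  define \<delta> where "\<delta> = \<mu>\<^sup>2 / (2 * C\<^sub>1)"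
  define E\<^sub>0 where "E\<^sub>0 = C\<^sub>1 * (1 / (4 * \<delta>) + 2)"
  define E\<^sub>1 where "E\<^sub>1 = E\<^sub>0 * (4 / \<mu>) * A + C\<^sub>1"
  define E where "E = E\<^sub>1\<^sup>2 / (2 * \<mu>\<^sup>2) + E\<^sub>0 * (4 / \<mu>) * D + C\<^sub>1"
  define F where "F = 8 * A\<^sup>2 / \<mu>\<^sup>2"
  define G where "G = F * E + 8 * D\<^sup>2"
  have pos: "D \<ge> 0" "\<delta> > 0" "E\<^sub>0 > 0" "E\<^sub>1 > 0" "E > 0" "F \<ge> 0" "G \<ge> 0"
  proof -
    show 1: "D \<ge> 0" "\<delta> > 0" unfolding D_def \<delta>_def using assms by auto
    show 2: "E\<^sub>0 > 0" unfolding E\<^sub>0_def using assms 1 by (intro mult_pos_pos add_pos_pos) auto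
    show 3: "E\<^sub>1 > 0" unfolding E\<^sub>1_def using assms 2 by (intro add_nonneg_pos) auto
    show 4: "E > 0" unfolding E_def using assms 1 2 3 by (intro add_nonneg_pos add_nonneg_nonneg) auto
    show 5: "F \<ge> 0" unfolding F_def by simp
    show "G \<ge> 0" unfolding G_def using 4 5 by simp
  qed
  have "H \<le> (F + G + 1) * (1 + 1 / s)"
    if P: "0 \<le> P" and N: "0 \<le> N" and s: "0 < s" and Q: "\<mu> * P\<^sup>2 \<le> Q"
      and ineq: "2 * \<mu>\<^sup>2 * N\<^sup>2 - C\<^sub>1 * (P * N + P\<^sup>2 + N + P) \<le> H / s"
      and QH: "(Q + H) / 2 \<le> A * N + B * P" for P N Q H s :: real
  \<comment> \<open>Small H is covered by the summand 1 of the constant; otherwise H > 1 permits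
    dividing by H below.\<close>
  proof (cases "H \<le> 1")
    case True
    have "1 * 1 \<le> (F + G + 1) * (1 + 1 / s)" using pos s by (intro mult_mono) auto
    then show ?thesis using True by simp
  next
    case False
    then have H: "H > 1" by simp
    have sq: "x * y \<le> e * x\<^sup>2 + y\<^sup>2 / (4 * e)" if "e > 0" for x y e :: real
    proof -
      have "0 \<le> (2 * e * x - y)\<^sup>2 / (4 * e)" using that by simp
      also have "\<dots> = e * x\<^sup>2 + y\<^sup>2 / (4 * e) - x * y" using that by (simp add: power2_eq_square field_simps)
      finally show ?thesis by simp
    qed
    have "P * B \<le> \<mu> / 4 * P\<^sup>2 + B\<^sup>2 / (4 * (\<mu> / 4))" using sq[of "\<mu> / 4" P B] assms by simp
    then have BP: "B * P \<le> \<mu> / 4 * P\<^sup>2 + D" unfolding D_def by (simp add: mult.commute)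
    have key: "\<mu> / 4 * P\<^sup>2 + H / 2 \<le> A * N + D"
    \<comment> \<open>Half of Q supplies \<mu> P^2 / 2. One half of that absorbs the term B P, the
      other half stays and bounds P^2 linearly in N.\<close>
    proof -
      have "\<mu> / 4 * P\<^sup>2 = (\<mu> * P\<^sup>2) / 4" by simp
      then show ?thesis using QH Q BP by argo
    qed
    then have PP: "P\<^sup>2 \<le> 4 / \<mu> * (A * N + D)" using H assms by (simp add: field_simps)
    have HN: "H \<le> 2 * (A * N + D)" 
    proof -
      have "0 \<le> \<mu> / 4 * P\<^sup>2" using assms by simp
      moreover have "H \<le> 2 * X" if "0 \<le> x" "x + H / 2 \<le> X" for x X using that by linarith
      ultimately show ?thesis using key by blast
    qed
    have PN: "P * N \<le> \<delta> * N\<^sup>2 + P\<^sup>2 / (4 * \<delta>)" using sq[OF pos(2), of N P] by (simp add: mult.commute)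
    have P1: "P \<le> 1 + P\<^sup>2" using sq[of 1 P 1] by simp
    have "C\<^sub>1 * (P * N + P\<^sup>2 + N + P) \<le> C\<^sub>1 * ((\<delta> * N\<^sup>2 + P\<^sup>2 / (4 * \<delta>)) + P\<^sup>2 + N + (1 + P\<^sup>2))"
      using PN P1 assms by (intro mult_left_mono add_mono) auto
    also have "\<dots> = C\<^sub>1 * \<delta> * N\<^sup>2 + E\<^sub>0 * P\<^sup>2 + C\<^sub>1 * N + C\<^sub>1"
      unfolding E\<^sub>0_def by (simp add: algebra_simps)
    also have "C\<^sub>1 * \<delta> = \<mu>\<^sup>2 / 2" unfolding \<delta>_def using assms by simp
    also have "\<mu>\<^sup>2 / 2 * N\<^sup>2 + E\<^sub>0 * P\<^sup>2 + C\<^sub>1 * N + C\<^sub>1 \<le> \<mu>\<^sup>2 / 2 * N\<^sup>2 + E\<^sub>0 * (4 / \<mu> * (A * N + D)) + C\<^sub>1 * N + C\<^sub>1"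
      by (intro add_mono mult_left_mono PP order_refl) (use pos in auto)
    also have "\<dots> = \<mu>\<^sup>2 / 2 * N\<^sup>2 + N * E\<^sub>1 + (E\<^sub>0 * (4 / \<mu>) * D + C\<^sub>1)"
      unfolding E\<^sub>1_def by (simp add: algebra_simps add_divide_distrib)
    also have "\<dots> \<le> \<mu>\<^sup>2 / 2 * N\<^sup>2 + (\<mu>\<^sup>2 / 2 * N\<^sup>2 + E\<^sub>1\<^sup>2 / (4 * (\<mu>\<^sup>2 / 2))) + (E\<^sub>0 * (4 / \<mu>) * D + C\<^sub>1)"
      using sq[of "\<mu>\<^sup>2 / 2" N E\<^sub>1] assms(1) by (intro add_mono order_refl) simp
    also have "\<dots> = \<mu>\<^sup>2 * N\<^sup>2 + E" unfolding E_def by simp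
    finally have "\<mu>\<^sup>2 * N\<^sup>2 \<le> H / s + E" using ineq by linarith
    then have NN: "N\<^sup>2 \<le> (H / s + E) / \<mu>\<^sup>2" using assms by (simp add: field_simps)
    \<comment> \<open>H is at most linear in N while N^2 is at most linear in H / s; so the square
      of H is at most linear in H.\<close>
    have "H\<^sup>2 \<le> (2 * (A * N + D))\<^sup>2" using HN H by (intro power_mono) auto
    also have "\<dots> \<le> 8 * A\<^sup>2 * N\<^sup>2 + 8 * D\<^sup>2"
      using zero_le_power2[of "A * N - D"] by (simp add: power2_eq_square algebra_simps)
    also have "\<dots> \<le> 8 * A\<^sup>2 * ((H / s + E) / \<mu>\<^sup>2) + 8 * D\<^sup>2"
      using NN by (intro add_mono mult_left_mono) auto
    also have "\<dots> = F * H / s + G" unfolding G_def F_def by (simp add: algebra_simps add_divide_distrib)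
    also have "\<dots> \<le> (F / s + G) * H"
      using mult_left_mono[of 1 H G] H pos by (simp add: algebra_simps)
    finally have "H * H \<le> (F / s + G) * H" by (simp add: power2_eq_square)
    then have "H \<le> F / s + G" using H by simp
    also have "\<dots> \<le> (F + G + 1) * (1 + 1 / s)" using pos s by (simp add: field_simps)
    finally show ?thesis .
  qed
  then show ?thesis using pos by (intro exI[of _ "F + G + 1"]) auto
qed

lemma dd_space_vector:
  fixes H :: "real \<times> (real^'n::finite) \<Rightarrow> real"
  assumes "H differentiable at p"
  shows "dd (0, w) H p = (\<Sum>i\<in>UNIV. w $ i * dd (space_dir i) H p)"
proof -
  interpret linear "\<lambda>b. dd b H p" by (rule linear_dd[OF assms])
  have "(\<Sum>i\<in>UNIV. w $ i *\<^sub>R axis i 1) = w"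
    by (simp add: vec_eq_iff axis_def if_distrib cong: if_cong)
  then have "(0, w) = (\<Sum>i\<in>UNIV. w $ i *\<^sub>R space_dir i)"
    by (intro prod_eqI) (simp_all add: space_dir_def fst_sum snd_sum)
  then have "dd (0, w) H p = dd (\<Sum>i\<in>UNIV. w $ i *\<^sub>R space_dir i) H p" by simp
  then show ?thesis by (simp add: sum scaleR)
qed

text \<open>Maximality along a single line is enough. A positive second derivative at the critical
  point would make the first derivative positive just after it, and the mean value theorem would
  then give a larger value.\<close>

lemma local_max_direction:
  fixes H :: "'e::euclidean_space \<Rightarrow> real"
  assumes W: "open W" "smooth_on W H" "p \<in> W"
    and e: "0 < e" and mx: "\<And>s. \<bar>s\<bar> < e \<Longrightarrow> H (p + s *\<^sub>R w) \<le> H p"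
  shows "dd w H p = 0" "dd w (dd w H) p \<le> 0"
proof -
  note df = smooth_on_differentiable[OF W(1)]
  obtain d where d: "d > 0" "ball p d \<subseteq> W" using W openE by blast
  define e' where "e' = min e (d / (norm w + 1))"
  have nw: "norm w + 1 > 0" by (smt (verit) norm_ge_zero)
  have e': "0 < e'" "e' \<le> e" unfolding e'_def using e d(1) nw by auto
  have inW: "p + s *\<^sub>R w \<in> W" if "\<bar>s\<bar> < e'" for s
  proof -
    have "\<bar>s\<bar> * norm w \<le> \<bar>s\<bar> * (norm w + 1)" by (simp add: algebra_simps)
    also have "\<dots> < d" using that nw unfolding e'_def by (simp add: field_simps)
    finally show ?thesis using d(2) by (auto simp: subset_iff dist_norm)
  qed
  have 1: "((\<lambda>s. H (p + s *\<^sub>R w)) has_real_derivative dd w H (p + s *\<^sub>R w)) (at s)" if "\<bar>s\<bar> < e'" for s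
    by (rule dd_line[OF df[OF W(2) inW[OF that]]])
  have 2: "((\<lambda>s. dd w H (p + s *\<^sub>R w)) has_real_derivative dd w (dd w H) (p + s *\<^sub>R w)) (at s)" if "\<bar>s\<bar> < e'" for s
    by (rule dd_line[OF df[OF smooth_on_dd[OF W(1,2)] inW[OF that]]])
  show z: "dd w H p = 0"
    using DERIV_local_max[OF 1[of 0] e'(1)] mx e' by auto
  show "dd w (dd w H) p \<le> 0"
  proof (rule ccontr)
    assume "\<not> dd w (dd w H) p \<le> 0"
    then have "0 < dd w (dd w H) (p + 0 *\<^sub>R w)" by simp
    from DERIV_pos_inc_right[OF 2[of 0] this] obtain d where
      d: "d > 0" "\<And>h. 0 < h \<Longrightarrow> h < d \<Longrightarrow> dd w H (p + 0 *\<^sub>R w) < dd w H (p + (0 + h) *\<^sub>R w)" using e' by auto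
    define h where "h = min d e' / 2"
    have h: "0 < h" "h < d" "h < e'" unfolding h_def using d e' by auto
    obtain \<zeta> where \<zeta>: "0 < \<zeta>" "\<zeta> < h" "H (p + h *\<^sub>R w) - H (p + 0 *\<^sub>R w) = (h - 0) * dd w H (p + \<zeta> *\<^sub>R w)"
      using MVT2[OF h(1), of "\<lambda>s. H (p + s *\<^sub>R w)", OF 1] h by auto
    have "dd w H (p + \<zeta> *\<^sub>R w) > 0" using d(2)[of \<zeta>] \<zeta> h z by auto
    then have "0 < h * dd w H (p + \<zeta> *\<^sub>R w)" using h(1) by simp
    then have "H (p + h *\<^sub>R w) > H p" using \<zeta>(3) by simp
    then show False using mx[of h] h e' by auto
  qed
qed

section \<open>The Bochner formula for the Li-Yau quantity\<close>

locale parabolic =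
  fixes W :: "(real \<times> (real^'n::finite)) set" and f :: "real \<times> (real^'n) \<Rightarrow> real"
    and a :: "'n \<Rightarrow> 'n \<Rightarrow> real \<times> (real^'n) \<Rightarrow> real" and b :: "'n \<Rightarrow> real \<times> (real^'n) \<Rightarrow> real"
  assumes open_W: "open W" and smooth_f: "smooth_on W f"
    and smooth_a: "\<And>i j. smooth_on W (a i j)" and smooth_b: "\<And>m. smooth_on W (b m)"
    and a_sym: "\<And>i j p. p \<in> W \<Longrightarrow> a i j p = a j i p"
    and pde: "\<And>p. p \<in> W \<Longrightarrow> dd time_dir f p =
      (\<Sum>i\<in>UNIV. \<Sum>j\<in>UNIV. a i j p * dd (space_dir i) (dd (space_dir j) f) p) + (\<Sum>m\<in>UNIV. b m p * dd (space_dir m) f p) +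
      (\<Sum>i\<in>UNIV. \<Sum>j\<in>UNIV. a i j p * dd (space_dir i) f p * dd (space_dir j) f p)"
begin

abbreviation "Dx i \<equiv> dd (space_dir i)"
abbreviation "Dt \<equiv> dd time_dir"

definition L :: "(real \<times> (real^'n) \<Rightarrow> real) \<Rightarrow> real \<times> (real^'n) \<Rightarrow> real" where
  "L \<phi> p = (\<Sum>i\<in>UNIV. \<Sum>j\<in>UNIV. a i j p * Dx i (Dx j \<phi>) p) + (\<Sum>m\<in>UNIV. b m p * Dx m \<phi> p)"

text \<open>The carre du champ operator of \<open>L\<close>: half the defect in the product rule for
  \<open>L\<close>, see \<open>L_mult\<close>.\<close>

definition \<Gamma> :: "(real \<times> (real^'n) \<Rightarrow> real) \<Rightarrow> (real \<times> (real^'n) \<Rightarrow> real) \<Rightarrow> real \<times> (real^'n) \<Rightarrow> real" where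
  "\<Gamma> \<phi> \<psi> p = (\<Sum>i\<in>UNIV. \<Sum>j\<in>UNIV. a i j p * Dx i \<phi> p * Dx j \<psi> p)"

text \<open>The commutator of \<open>dd v\<close> with \<open>L\<close>, in which only the
  coefficients are differentiated along \<open>v\<close>; see \<open>dd_L\<close>.\<close>

definition C :: "real \<times> (real^'n) \<Rightarrow> (real \<times> (real^'n) \<Rightarrow> real) \<Rightarrow> real \<times> (real^'n) \<Rightarrow> real" where
  "C v \<phi> p = (\<Sum>i\<in>UNIV. \<Sum>j\<in>UNIV. dd v (a i j) p * Dx i (Dx j \<phi>) p) + (\<Sum>m\<in>UNIV. dd v (b m) p * Dx m \<phi> p)"

definition "Q = \<Gamma> f f"

text \<open>Since f_t = L f + Q, this equals - Q - 2 L f, so a positive H is controlled by second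
  and first derivatives of f.\<close>

definition "H p = Q p - 2 * Dt f p"

lemmas smooth_dd = smooth_on_dd[OF open_W]
lemmas diff = smooth_on_differentiable[OF open_W]

lemma smooth_\<Gamma>: "smooth_on W \<phi> \<Longrightarrow> smooth_on W \<psi> \<Longrightarrow> smooth_on W (\<Gamma> \<phi> \<psi>)"
  unfolding \<Gamma>_def[abs_def] by (intro smooth_on_sum smooth_on_mult smooth_dd smooth_a open_W)

lemma smooth_L: "smooth_on W \<phi> \<Longrightarrow> smooth_on W (L \<phi>)"
  unfolding L_def[abs_def] by (intro smooth_on_add smooth_on_sum smooth_on_mult smooth_dd smooth_a smooth_b open_W)

lemma smooth_Q: "smooth_on W Q" unfolding Q_def by (intro smooth_\<Gamma> smooth_f)

lemma smooth_H: "smooth_on W H"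
  unfolding H_def[abs_def] by (intro smooth_on_diff smooth_Q smooth_on_mult smooth_on_const smooth_dd smooth_f open_W)

lemma \<Gamma>_commute: "p \<in> W \<Longrightarrow> \<Gamma> \<phi> \<psi> p = \<Gamma> \<psi> \<phi> p"
  unfolding \<Gamma>_def by (subst sum.swap) (simp add: a_sym[of p] mult_ac)

lemma dd2_mult:
  fixes \<phi> \<psi> :: "real \<times> (real^'n) \<Rightarrow> real"
  assumes "smooth_on W \<phi>" "smooth_on W \<psi>" "p \<in> W"
  shows "dd v (dd w (\<lambda>p. \<phi> p * \<psi> p)) p = \<phi> p * dd v (dd w \<psi>) p + \<psi> p * dd v (dd w \<phi>) p +
    dd v \<phi> p * dd w \<psi> p + dd w \<phi> p * dd v \<psi> p"
proof -
  have "dd v (dd w (\<lambda>p. \<phi> p * \<psi> p)) p = dd v (\<lambda>p. \<phi> p * dd w \<psi> p + dd w \<phi> p * \<psi> p) p"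
  proof (rule dd_cong_open[OF open_W assms(3)])
    fix q assume q: "q \<in> W"
    show "dd w (\<lambda>p. \<phi> p * \<psi> p) q = \<phi> q * dd w \<psi> q + dd w \<phi> q * \<psi> q"
      by (rule dd_mult[OF diff[OF assms(1) q] diff[OF assms(2) q]])
  qed
  also have "\<dots> = \<phi> p * dd v (dd w \<psi>) p + dd v \<phi> p * dd w \<psi> p + (dd w \<phi> p * dd v \<psi> p + dd v (dd w \<phi>) p * \<psi> p)"
    by (simp add: dd_add dd_mult differentiable_mult diff[OF _ assms(3)] smooth_dd assms)
  finally show ?thesis by simp
qed

lemma L_mult:
  assumes "smooth_on W \<phi>" "smooth_on W \<psi>" "p \<in> W"
  shows "L (\<lambda>p. \<phi> p * \<psi> p) p = \<phi> p * L \<psi> p + \<psi> p * L \<phi> p + 2 * \<Gamma> \<phi> \<psi> p"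
proof -
  have 1: "dd v (\<lambda>p. \<phi> p * \<psi> p) p = \<phi> p * dd v \<psi> p + dd v \<phi> p * \<psi> p" for v
    by (intro dd_mult diff assms)
  have "L (\<lambda>p. \<phi> p * \<psi> p) p = \<phi> p * L \<psi> p + \<psi> p * L \<phi> p + \<Gamma> \<phi> \<psi> p + \<Gamma> \<psi> \<phi> p"
    unfolding L_def \<Gamma>_def dd2_mult[OF assms] 1
    by (simp add: algebra_simps sum.distrib sum_distrib_left)
  then show ?thesis using \<Gamma>_commute[OF assms(3)] by simp
qed

lemma \<Gamma>_mult:
  assumes "smooth_on W \<phi>" "smooth_on W \<psi>" "p \<in> W"
  shows "\<Gamma> \<omega> (\<lambda>p. \<phi> p * \<psi> p) p = \<phi> p * \<Gamma> \<omega> \<psi> p + \<psi> p * \<Gamma> \<omega> \<phi> p"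
proof -
  have 1: "dd v (\<lambda>p. \<phi> p * \<psi> p) p = \<phi> p * dd v \<psi> p + dd v \<phi> p * \<psi> p" for v
    by (intro dd_mult diff assms)
  show ?thesis unfolding \<Gamma>_def 1 by (simp add: algebra_simps sum.distrib sum_distrib_left)
qed

lemma L_sum:
  assumes "\<And>i. i \<in> I \<Longrightarrow> smooth_on W (\<phi> i)" "p \<in> W"
  shows "L (\<lambda>p. \<Sum>i\<in>I. \<phi> i p) p = (\<Sum>i\<in>I. L (\<phi> i) p)"
proof -
  have 1: "dd v (\<lambda>p. \<Sum>i\<in>I. \<phi> i p) p = (\<Sum>i\<in>I. dd v (\<phi> i) p)" if "p \<in> W" for v p
    by (intro dd_sum diff assms that)
  have 2: "dd v (dd w (\<lambda>p. \<Sum>i\<in>I. \<phi> i p)) p = (\<Sum>i\<in>I. dd v (dd w (\<phi> i)) p)" for v w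
  proof -
    have "dd v (dd w (\<lambda>p. \<Sum>i\<in>I. \<phi> i p)) p = dd v (\<lambda>p. \<Sum>i\<in>I. dd w (\<phi> i) p) p"
      by (rule dd_cong_open[OF open_W assms(2) 1])
    also have "\<dots> = (\<Sum>i\<in>I. dd v (dd w (\<phi> i)) p)"
      by (intro dd_sum diff smooth_dd assms)
    finally show ?thesis .
  qed
  have "L (\<lambda>p. \<Sum>i\<in>I. \<phi> i p) p = (\<Sum>k\<in>UNIV. \<Sum>j\<in>UNIV. \<Sum>i\<in>I. a k j p * Dx k (Dx j (\<phi> i)) p) +
      (\<Sum>m\<in>UNIV. \<Sum>i\<in>I. b m p * Dx m (\<phi> i) p)"
    unfolding L_def 2 1[OF assms(2)] by (simp add: sum_distrib_left)
  also have "(\<Sum>k\<in>UNIV. \<Sum>j\<in>UNIV. \<Sum>i\<in>I. a k j p * Dx k (Dx j (\<phi> i)) p) =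
      (\<Sum>i\<in>I. \<Sum>k\<in>UNIV. \<Sum>j\<in>UNIV. a k j p * Dx k (Dx j (\<phi> i)) p)"
    by (rule sum_rotate[symmetric])
  also have "(\<Sum>m\<in>UNIV. \<Sum>i\<in>I. b m p * Dx m (\<phi> i) p) = (\<Sum>i\<in>I. \<Sum>m\<in>UNIV. b m p * Dx m (\<phi> i) p)"
    by (rule sum.swap)
  finally show ?thesis unfolding L_def by (simp add: sum.distrib)
qed

lemma dd_L:
  assumes "smooth_on W \<phi>" "p \<in> W"
  shows "dd v (L \<phi>) p = L (dd v \<phi>) p + C v \<phi> p"
proof -
  have 1: "dd v (Dx j \<phi>) q = Dx j (dd v \<phi>) q" if "q \<in> W" for j q
    by (rule dd_commute[OF open_W assms(1) that])
  have 2: "dd v (Dx i (Dx j \<phi>)) p = Dx i (Dx j (dd v \<phi>)) p" for i j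
  proof -
    have "dd v (Dx i (Dx j \<phi>)) p = Dx i (dd v (Dx j \<phi>)) p"
      by (rule dd_commute[OF open_W smooth_dd[OF assms(1)] assms(2)])
    also have "\<dots> = Dx i (Dx j (dd v \<phi>)) p" by (rule dd_cong_open[OF open_W assms(2) 1])
    finally show ?thesis .
  qed
  note D = diff[OF _ assms(2)]
  have "dd v (L \<phi>) p = (\<Sum>i\<in>UNIV. \<Sum>j\<in>UNIV. a i j p * dd v (Dx i (Dx j \<phi>)) p + dd v (a i j) p * Dx i (Dx j \<phi>) p) +
      (\<Sum>m\<in>UNIV. b m p * dd v (Dx m \<phi>) p + dd v (b m) p * Dx m \<phi> p)"
    unfolding L_def[abs_def]
    by (simp add: dd_add dd_sum dd_mult differentiable_mult differentiable_sum differentiable_add D smooth_dd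
        smooth_a smooth_b assms(1))
  then show ?thesis unfolding L_def C_def 2 1[OF assms(2)] by (simp add: sum.distrib)
qed

definition "A v p = (\<Sum>i\<in>UNIV. \<Sum>j\<in>UNIV. dd v (a i j) p * Dx i f p * Dx j f p)"

lemma dd_Q:
  assumes "p \<in> W"
  shows "dd v Q p = A v p + 2 * \<Gamma> f (dd v f) p"
proof -
  note D = diff[OF _ assms]
  have 1: "dd v (Dx j f) p = Dx j (dd v f) p" for j
    by (rule dd_commute[OF open_W smooth_f assms])
  have "dd v Q p = (\<Sum>i\<in>UNIV. \<Sum>j\<in>UNIV. a i j p * Dx i f p * dd v (Dx j f) p +
      (a i j p * dd v (Dx i f) p + dd v (a i j) p * Dx i f p) * Dx j f p)"
    unfolding Q_def \<Gamma>_def[abs_def]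
    by (simp add: dd_sum dd_mult differentiable_mult differentiable_sum D smooth_dd smooth_a smooth_f)
  also have "\<dots> = \<Gamma> f (dd v f) p + \<Gamma> (dd v f) f p + A v p"
    unfolding \<Gamma>_def A_def 1 by (simp add: algebra_simps sum.distrib)
  finally show ?thesis using \<Gamma>_commute[OF assms] by simp
qed

text \<open>The equation differentiated along \<open>v\<close>. It trades the third derivatives of f
  hidden in \<open>L\<close> for derivatives of f_t and of Q, which recombine into derivatives of
  H.\<close>

lemma L_dd_f:
  assumes "p \<in> W"
  shows "L (dd v f) p = dd v (Dt f) p - dd v Q p - C v f p"
proof -
  have "dd v (Dt f) p = dd v (\<lambda>p. L f p + Q p) p"
    by (rule dd_cong_open[OF open_W assms]) (simp add: pde L_def Q_def \<Gamma>_def)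
  also have "\<dots> = dd v (L f) p + dd v Q p"
    by (intro dd_add diff[OF _ assms] smooth_L smooth_f smooth_Q)
  finally show ?thesis using dd_L[OF smooth_f assms] by simp
qed

text \<open>All terms in which a coefficient is differentiated. Each is of the form Hessian times
  gradient, gradient squared, Hessian or gradient; none is quadratic in the Hessian.\<close>

definition "Err p = - 2 * (\<Sum>k\<in>UNIV. \<Sum>l\<in>UNIV. a k l p * Dx l f p * C (space_dir k) f p) +
  (\<Sum>k\<in>UNIV. \<Sum>l\<in>UNIV. Dx k f p * Dx l f p * L (a k l) p) +
  2 * (\<Sum>k\<in>UNIV. \<Sum>l\<in>UNIV. Dx k f p * \<Gamma> (a k l) (Dx l f) p + Dx l f p * \<Gamma> (a k l) (Dx k f) p) +
  A time_dir p + 2 * C time_dir f p"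

definition "Hess2 p = (\<Sum>k\<in>UNIV. \<Sum>l\<in>UNIV. a k l p * \<Gamma> (Dx k f) (Dx l f) p)"

lemma L_Q:
  assumes p: "p \<in> W"
  shows "L Q p = 2 * \<Gamma> f (Dt f) p - 2 * \<Gamma> f Q p + 2 * Hess2 p + (Err p - A time_dir p - 2 * C time_dir f p)"
proof -
  note s = smooth_dd[OF smooth_f]
  have Q_eq: "Q = (\<lambda>p. \<Sum>k\<in>UNIV. \<Sum>l\<in>UNIV. a k l p * (Dx k f p * Dx l f p))"
    unfolding Q_def \<Gamma>_def[abs_def] by (simp add: mult.assoc)
  have "L Q p = (\<Sum>k\<in>UNIV. \<Sum>l\<in>UNIV. L (\<lambda>p. a k l p * (Dx k f p * Dx l f p)) p)"
    unfolding Q_eq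
    by (simp add: L_sum[OF _ p] smooth_on_sum smooth_on_mult s smooth_a open_W)
  also have "\<dots> = (\<Sum>k\<in>UNIV. \<Sum>l\<in>UNIV. a k l p * (Dx k f p * L (Dx l f) p + Dx l f p * L (Dx k f) p
      + 2 * \<Gamma> (Dx k f) (Dx l f) p) + Dx k f p * Dx l f p * L (a k l) p
      + 2 * (Dx k f p * \<Gamma> (a k l) (Dx l f) p + Dx l f p * \<Gamma> (a k l) (Dx k f) p))"
    by (intro sum.cong refl)
      (simp add: L_mult[OF _ _ p] \<Gamma>_mult[OF _ _ p] smooth_on_mult[OF open_W] s smooth_a)
  also have "\<dots> = (\<Sum>k\<in>UNIV. \<Sum>l\<in>UNIV. a k l p * Dx k f p * L (Dx l f) p) +
      (\<Sum>k\<in>UNIV. \<Sum>l\<in>UNIV. a k l p * Dx l f p * L (Dx k f) p) + 2 * Hess2 p +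
      (\<Sum>k\<in>UNIV. \<Sum>l\<in>UNIV. Dx k f p * Dx l f p * L (a k l) p) +
      2 * (\<Sum>k\<in>UNIV. \<Sum>l\<in>UNIV. Dx k f p * \<Gamma> (a k l) (Dx l f) p + Dx l f p * \<Gamma> (a k l) (Dx k f) p)"
    unfolding Hess2_def by (simp add: algebra_simps sum.distrib sum_distrib_left)
  also have "(\<Sum>k\<in>UNIV. \<Sum>l\<in>UNIV. a k l p * Dx k f p * L (Dx l f) p) =
      (\<Sum>k\<in>UNIV. \<Sum>l\<in>UNIV. a k l p * Dx l f p * L (Dx k f) p)"
    by (subst sum.swap) (simp add: a_sym[OF p])
  also have "\<dots> = \<Gamma> (Dt f) f p - \<Gamma> Q f p - (\<Sum>k\<in>UNIV. \<Sum>l\<in>UNIV. a k l p * Dx l f p * C (space_dir k) f p)"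
    unfolding L_dd_f[OF p] \<Gamma>_def by (simp add: algebra_simps sum_subtractf sum.distrib)
  finally show ?thesis
    unfolding Err_def using \<Gamma>_commute[OF p, of "Dt f" f] \<Gamma>_commute[OF p, of Q f] by simp
qed

text \<open>In \<open>L_Q\<close> the product rule for \<open>L\<close> yields the square of the
  Hessian, and \<open>L_dd_f\<close> replaces third derivatives. The drift 2 \<Gamma>(f, H) and the
  time derivative then remove \<Gamma>(f, Q), \<Gamma>(f, f_t) and the second time derivative of
  f.\<close>

lemma Bochner:
  assumes p: "p \<in> W"
  shows "L H p - Dt H p + 2 * \<Gamma> f H p = 2 * Hess2 p + Err p"
proof -
  note s = smooth_dd[OF smooth_f] and D = diff[OF _ p]
  have c: "dd v (\<lambda>p. 2 * Dt f p) q = 2 * dd v (Dt f) q" if "q \<in> W" for v q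
    using dd_mult[of "\<lambda>_. 2" q "Dt f" v] diff[OF s that] by simp
  have H1: "dd v H q = dd v Q q - 2 * dd v (Dt f) q" if "q \<in> W" for v q
    unfolding H_def[abs_def] c[OF that, symmetric]
    by (intro dd_diff diff[OF _ that] smooth_Q smooth_on_mult[OF open_W] smooth_on_const[OF open_W] s)
  have H2: "dd v (dd w H) p = dd v (dd w Q) p - 2 * dd v (dd w (Dt f)) p" for v w
  proof -
    have c2: "dd v (\<lambda>p. 2 * dd w (Dt f) p) p = 2 * dd v (dd w (Dt f)) p"
      using dd_mult[of "\<lambda>_. 2" p "dd w (Dt f)" v] D[OF smooth_dd[OF s]] by simp
    have "dd v (dd w H) p = dd v (\<lambda>p. dd w Q p - 2 * dd w (Dt f) p) p"
      by (rule dd_cong_open[OF open_W p H1])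
    also have "\<dots> = dd v (dd w Q) p - dd v (\<lambda>p. 2 * dd w (Dt f) p) p"
      by (intro dd_diff D smooth_dd smooth_Q smooth_on_mult[OF open_W] smooth_on_const[OF open_W] s)
    finally show ?thesis unfolding c2 .
  qed
  have LH: "L H p = L Q p - 2 * L (Dt f) p"
    unfolding L_def H2 H1[OF p] by (simp add: algebra_simps sum_subtractf sum_distrib_left)
  have GH: "\<Gamma> f H p = \<Gamma> f Q p - 2 * \<Gamma> f (Dt f) p"
    unfolding \<Gamma>_def H1[OF p] by (simp add: algebra_simps sum_subtractf sum_distrib_left)
  show ?thesis
    unfolding LH GH L_Q[OF p] L_dd_f[OF p, of time_dir] H1[OF p] using dd_Q[OF p, of time_dir] by simp
qed

text \<open>The Hessian is regarded as a 2-tensor measured by \<open>a\<close> in both slots, so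
  \<open>tensor_form_lower\<close> applies with \<open>k = 2\<close>.\<close>

lemma Hess2_lower:
  assumes "bounded_coeffs M \<mu> a b p" "0 < \<mu>"
  shows "\<mu>\<^sup>2 * (Dx i (Dx j f) p)\<^sup>2 \<le> Hess2 p"
proof -
  define T where "T ks = Dx (ks ! 1) (Dx (ks ! 0) f) p" for ks :: "'n list"
  have "\<mu> ^ 2 * (T [j, i])\<^sup>2 \<le> tensor_form (\<lambda>i j. a i j p) 2 T"
    by (rule tensor_form_lower) (use assms in \<open>auto simp: bounded_coeffs_def\<close>)
  also have "\<dots> = (\<Sum>k\<in>UNIV. \<Sum>i\<in>UNIV. \<Sum>l\<in>UNIV. \<Sum>j\<in>UNIV. a k l p * a i j p * Dx i (Dx k f) p * Dx j (Dx l f) p)"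
    unfolding tensor_form_def numeral_2_eq_2 sum_lists_Suc by (simp add: T_def mult_ac)
  also have "\<dots> = (\<Sum>k\<in>UNIV. \<Sum>l\<in>UNIV. \<Sum>i\<in>UNIV. \<Sum>j\<in>UNIV. a k l p * a i j p * Dx i (Dx k f) p * Dx j (Dx l f) p)"
    by (rule sum.cong[OF refl sum.swap])
  also have "\<dots> = Hess2 p"
    unfolding Hess2_def \<Gamma>_def by (simp add: sum_distrib_left mult_ac)
  finally show ?thesis by (simp add: T_def)
qed

section \<open>Size of the error term\<close>

lemma sum_bound: "(\<And>i. \<bar>h i\<bar> \<le> B) \<Longrightarrow> \<bar>\<Sum>i\<in>(UNIV :: 'n set). h i\<bar> \<le> real CARD('n) * B"
  by (rule order_trans[OF sum_abs]) (rule order_trans[OF sum_mono[of UNIV _ "\<lambda>_. B"]], auto)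

lemma sum2_bound:
  assumes "\<And>i j. \<bar>h i j\<bar> \<le> B"
  shows "\<bar>\<Sum>i\<in>(UNIV :: 'n set). \<Sum>j\<in>(UNIV :: 'n set). h i j\<bar> \<le> (real CARD('n))\<^sup>2 * B"
proof -
  have "\<bar>\<Sum>i\<in>(UNIV :: 'n set). \<Sum>j\<in>(UNIV :: 'n set). h i j\<bar> \<le> real CARD('n) * (real CARD('n) * B)"
    by (intro sum_bound assms)
  then show ?thesis by (simp add: power2_eq_square)
qed

lemma Err_bound:
  fixes n defines "n \<equiv> real CARD('n)"
  assumes bd: "bounded_coeffs M \<mu> a b p" and M: "0 < M"
    and P: "\<And>i. \<bar>Dx i f p\<bar> \<le> P" and N: "\<And>i j. \<bar>Dx i (Dx j f) p\<bar> \<le> N"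
  shows "\<bar>Err p\<bar> \<le> (6 * n ^ 4 * M\<^sup>2 + (3 * n ^ 3 * M\<^sup>2 + n ^ 4 * M\<^sup>2 + n\<^sup>2 * M) + 2 * n\<^sup>2 * M + 2 * n * M) * (P * N + P\<^sup>2 + N + P)"
proof -
  have P0: "0 \<le> P" and N0: "0 \<le> N" using order_trans[OF abs_ge_zero P] order_trans[OF abs_ge_zero N] by auto
  have n0: "0 \<le> n" unfolding n_def by simp
  note b = bd[unfolded bounded_coeffs_def]
  have m2: "\<bar>x * y\<bar> \<le> X * Y" if "\<bar>x\<bar> \<le> X" "\<bar>y\<bar> \<le> Y" for x y X Y :: real
    unfolding abs_mult using that by (intro mult_mono) auto
  \<comment> \<open>A common bound for the commutators in all spatial directions and in
    time.\<close>
  define c where "c = n\<^sup>2 * (M * N) + n * (M * P)"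
  have C: "\<bar>C v f p\<bar> \<le> c" if "\<And>i j. \<bar>dd v (a i j) p\<bar> \<le> M" "\<And>m. \<bar>dd v (b m) p\<bar> \<le> M" for v
    unfolding C_def c_def n_def
    by (rule order_trans[OF abs_triangle_ineq]) (intro add_mono sum_bound sum2_bound m2 that P N)
  have Ck: "\<bar>C (space_dir k) f p\<bar> \<le> c" for k by (rule C) (use b in auto)
  have Ct: "\<bar>C time_dir f p\<bar> \<le> c" by (rule C) (use b in auto)
  have La: "\<bar>L (a k l) p\<bar> \<le> n\<^sup>2 * (M * M) + n * (M * M)" for k l
    unfolding L_def n_def
    by (rule order_trans[OF abs_triangle_ineq]) (intro add_mono sum_bound sum2_bound m2; use b in auto)
  have Ga: "\<bar>\<Gamma> (a k l) (Dx m f) p\<bar> \<le> n\<^sup>2 * (M * M * N)" for k l m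
    unfolding \<Gamma>_def n_def by (intro sum2_bound m2 N) (use b in auto)
  have 1: "\<bar>\<Sum>k\<in>UNIV. \<Sum>l\<in>UNIV. a k l p * Dx l f p * C (space_dir k) f p\<bar> \<le> n\<^sup>2 * (M * P * c)"
    unfolding n_def by (intro sum2_bound m2 P Ck) (use b in auto)
  have 2: "\<bar>\<Sum>k\<in>UNIV. \<Sum>l\<in>UNIV. Dx k f p * Dx l f p * L (a k l) p\<bar> \<le> n\<^sup>2 * (P * P * (n\<^sup>2 * (M * M) + n * (M * M)))"
    using sum2_bound[OF m2[OF m2[OF P P] La]] unfolding n_def .
  have 3: "\<bar>\<Sum>k\<in>UNIV. \<Sum>l\<in>UNIV. Dx k f p * \<Gamma> (a k l) (Dx l f) p + Dx l f p * \<Gamma> (a k l) (Dx k f) p\<bar>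
      \<le> n\<^sup>2 * (P * (n\<^sup>2 * (M * M * N)) + P * (n\<^sup>2 * (M * M * N)))"
    unfolding n_def by (intro sum2_bound order_trans[OF abs_triangle_ineq] add_mono m2 P Ga[unfolded n_def])
  have 4: "\<bar>A time_dir p\<bar> \<le> n\<^sup>2 * (M * P * P)"
    unfolding A_def n_def by (intro sum2_bound m2 P) (use b in auto)
  have t: "\<bar>- 2 * x1 + x2 + 2 * x3 + x4 + 2 * x5\<bar> \<le> 2 * \<bar>x1\<bar> + \<bar>x2\<bar> + 2 * \<bar>x3\<bar> + \<bar>x4\<bar> + 2 * \<bar>x5\<bar>" for x1 x2 x3 x4 x5 :: real
    by linarith
  have "\<bar>Err p\<bar> \<le> 2 * (n\<^sup>2 * (M * P * c)) + n\<^sup>2 * (P * P * (n\<^sup>2 * (M * M) + n * (M * M))) +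
      2 * (n\<^sup>2 * (P * (n\<^sup>2 * (M * M * N)) + P * (n\<^sup>2 * (M * M * N)))) + n\<^sup>2 * (M * P * P) + 2 * c"
    unfolding Err_def by (rule order_trans[OF t]) (intro add_mono mult_left_mono 1 2 3 4 Ct; simp)
  also have "\<dots> = 6 * n ^ 4 * M\<^sup>2 * (P * N) + (3 * n ^ 3 * M\<^sup>2 + n ^ 4 * M\<^sup>2 + n\<^sup>2 * M) * P\<^sup>2 + 2 * n\<^sup>2 * M * N + 2 * n * M * P"
    unfolding c_def by (simp add: power2_eq_square power3_eq_cube power4_eq_xxxx algebra_simps)
  also have "\<dots> \<le> (6 * n ^ 4 * M\<^sup>2 + (3 * n ^ 3 * M\<^sup>2 + n ^ 4 * M\<^sup>2 + n\<^sup>2 * M) + 2 * n\<^sup>2 * M + 2 * n * M) * (P * N + P\<^sup>2 + N + P)"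
  proof -
    have "c1 * x + c2 * y + c3 * z + c4 * w \<le> (c1 + c2 + c3 + c4) * (x + y + z + w)"
      if "0 \<le> c1" "0 \<le> c2" "0 \<le> c3" "0 \<le> c4" "0 \<le> x" "0 \<le> y" "0 \<le> z" "0 \<le> w" for c1 c2 c3 c4 x y z w :: real
    proof -
      have "c1 * x \<le> c1 * (x + y + z + w)" "c2 * y \<le> c2 * (x + y + z + w)"
        "c3 * z \<le> c3 * (x + y + z + w)" "c4 * w \<le> c4 * (x + y + z + w)"
        using that by (auto intro!: mult_left_mono)
      then show ?thesis by (simp add: distrib_right)
    qed
    note gen = this
    show ?thesis by (rule gen) (use n0 M P0 N0 in auto)
  qed
  finally show ?thesis .
qed

end

text \<open>The conditions on \<open>H\<close> are those at a maximum point of \<open>(t - \<epsilon>) H\<close>, with \<open>s = t - \<epsilon>\<close>.\<close>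

lemma li_yau_point:
  fixes M \<mu> :: real
  assumes "0 < M" "0 < \<mu>"
  shows "\<exists>C>0. \<forall>(W :: (real \<times> (real^'n::finite)) set) f a b p s. parabolic W f a b \<longrightarrow> bounded_coeffs M \<mu> a b p \<longrightarrow>
    p \<in> W \<longrightarrow> 0 < s \<longrightarrow> (\<forall>i. dd (space_dir i) (parabolic.H f a) p = 0) \<longrightarrow>
    (\<Sum>i\<in>UNIV. \<Sum>j\<in>UNIV. a i j p * dd (space_dir i) (dd (space_dir j) (parabolic.H f a)) p) \<le> 0 \<longrightarrow>
    0 \<le> parabolic.H f a p + s * dd time_dir (parabolic.H f a) p \<longrightarrow>
    parabolic.H f a p \<le> C * (1 + 1 / s)"
proof -
  define n where "n = real CARD('n)"
  define C\<^sub>1 where "C\<^sub>1 = 6 * n ^ 4 * M\<^sup>2 + (3 * n ^ 3 * M\<^sup>2 + n ^ 4 * M\<^sup>2 + n\<^sup>2 * M) + 2 * n\<^sup>2 * M + 2 * n * M"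
  have n0: "0 < n" unfolding n_def by simp
  have C1: "0 < C\<^sub>1" unfolding C\<^sub>1_def using n0 assms by (intro add_pos_pos mult_pos_pos) auto
  obtain K where K: "K > 0" "\<And>P N Q H s. 0 \<le> P \<Longrightarrow> 0 \<le> N \<Longrightarrow> 0 < s \<Longrightarrow> \<mu> * P\<^sup>2 \<le> Q \<Longrightarrow>
    2 * \<mu>\<^sup>2 * N\<^sup>2 - C\<^sub>1 * (P * N + P\<^sup>2 + N + P) \<le> H / s \<Longrightarrow> (Q + H) / 2 \<le> n\<^sup>2 * M * N + n * M * P \<Longrightarrow>
    H \<le> K * (1 + 1 / s)"
    using harnack_scalar[OF assms(2) C1, of "n\<^sup>2 * M" "n * M"] n0 assms by (auto simp: mult_ac)
  have "parabolic.H f a p \<le> K * (1 + 1 / s)"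
    if par: "parabolic W f a b" and bd: "bounded_coeffs M \<mu> a b p" and p: "p \<in> W" and s: "0 < s"
      and H1: "\<And>i. dd (space_dir i) (parabolic.H f a) p = 0"
      and H2: "(\<Sum>i\<in>UNIV. \<Sum>j\<in>UNIV. a i j p * dd (space_dir i) (dd (space_dir j) (parabolic.H f a)) p) \<le> 0"
      and Ht: "0 \<le> parabolic.H f a p + s * dd time_dir (parabolic.H f a) p"
    for W :: "(real \<times> (real^'n)) set" and f a b p s
  proof -
    interpret parabolic W f a b by (rule par)
    note b = bd[unfolded bounded_coeffs_def]
    \<comment> \<open>The maxima are attained, so lower bounds for one gradient component and one
      Hessian component become bounds for \<open>P\<close> and \<open>N\<close> themselves.\<close>
    define P where "P = Max (range (\<lambda>i. \<bar>Dx i f p\<bar>))"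
    define N where "N = Max (range (\<lambda>(i, j). \<bar>Dx i (Dx j f) p\<bar>))"
    have P: "\<bar>Dx i f p\<bar> \<le> P" for i unfolding P_def by (intro Max_ge) auto
    have N: "\<bar>Dx i (Dx j f) p\<bar> \<le> N" for i j unfolding N_def by (intro Max_ge) (auto intro!: rev_image_eqI[of "(i, j)"])
    have "P \<in> range (\<lambda>i. \<bar>Dx i f p\<bar>)" unfolding P_def by (intro Max_in) auto
    then obtain i\<^sub>0 where i0: "P = \<bar>Dx i\<^sub>0 f p\<bar>" by blast
    have "N \<in> range (\<lambda>(i, j). \<bar>Dx i (Dx j f) p\<bar>)" unfolding N_def by (intro Max_in) auto
    then obtain j\<^sub>0 k\<^sub>0 where jk: "N = \<bar>Dx j\<^sub>0 (Dx k\<^sub>0 f) p\<bar>" by auto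
    have Q: "\<mu> * P\<^sup>2 \<le> Q p"
    proof -
      have "Dx i\<^sub>0 f p * Dx i\<^sub>0 f p \<le> (\<Sum>i\<in>UNIV. Dx i f p * Dx i f p)"
        by (rule member_le_sum) auto
      then have "\<mu> * P\<^sup>2 \<le> \<mu> * (\<Sum>i\<in>UNIV. Dx i f p * Dx i f p)"
        unfolding i0 using assms(2) by (intro mult_left_mono) (auto simp: power2_eq_square)
      also have "\<dots> \<le> Q p" unfolding Q_def \<Gamma>_def by (rule bounded_coeffs_elliptic[OF bd])
      finally show ?thesis .
    qed
    have "L H p \<le> 0" unfolding L_def using H2 H1 by simp
    moreover have "\<Gamma> f H p = 0" unfolding \<Gamma>_def using H1 by simp
    moreover have "- Dt H p \<le> H p / s" using Ht s by (simp add: field_simps)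
    ultimately have "2 * Hess2 p + Err p \<le> H p / s" using Bochner[OF p] by simp
    moreover have "\<bar>Err p\<bar> \<le> C\<^sub>1 * (P * N + P\<^sup>2 + N + P)"
      unfolding C\<^sub>1_def n_def by (rule Err_bound[OF bd assms(1) P N])
    moreover have "\<mu>\<^sup>2 * N\<^sup>2 \<le> Hess2 p" unfolding jk power2_abs by (rule Hess2_lower[OF bd assms(2)])
    ultimately have 1: "2 * \<mu>\<^sup>2 * N\<^sup>2 - C\<^sub>1 * (P * N + P\<^sup>2 + N + P) \<le> H p / s" by linarith
    have m2: "\<bar>x * y\<bar> \<le> X * Y" if "\<bar>x\<bar> \<le> X" "\<bar>y\<bar> \<le> Y" for x y X Y :: real
      unfolding abs_mult using that by (intro mult_mono) auto
    have "\<bar>\<Sum>i\<in>UNIV. \<Sum>j\<in>UNIV. a i j p * Dx i (Dx j f) p\<bar> \<le> n\<^sup>2 * (M * N)"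
      unfolding n_def by (intro sum2_bound m2 N) (use b in auto)
    moreover have "\<bar>\<Sum>m\<in>UNIV. b m p * Dx m f p\<bar> \<le> n * (M * P)"
      unfolding n_def by (intro sum_bound m2 P) (use b in auto)
    moreover have "Dt f p = L f p + Q p" using pde[OF p] unfolding L_def Q_def \<Gamma>_def by simp
    \<comment> \<open>By the equation the left-hand side is exactly - L f at the point.\<close>
    ultimately have 2: "(Q p + H p) / 2 \<le> n\<^sup>2 * M * N + n * M * P"
      unfolding L_def H_def by (simp add: mult.assoc)
    have "0 \<le> P" "0 \<le> N" unfolding i0 jk by auto
    then show ?thesis using K(2)[OF _ _ s Q 1 2] by blast
  qed
  then show ?thesis using K(1) by blast
qed

text \<open>The maximum is required only over earlier times, as it may occur at the final time; this
  yields just a one-sided condition on the time derivative, in the direction the estimate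
  needs.\<close>

lemma li_yau_max:
  fixes M \<mu> :: real
  assumes "0 < M" "0 < \<mu>"
  shows "\<exists>C>0. \<forall>(W :: (real \<times> (real^'n::finite)) set) f a b p \<epsilon> e. parabolic W f a b \<longrightarrow> bounded_coeffs M \<mu> a b p \<longrightarrow>
    p \<in> W \<longrightarrow> \<epsilon> < fst p \<longrightarrow> 0 < e \<longrightarrow> (\<forall>q\<in>ball p e. fst q \<le> fst p \<longrightarrow>
      (fst q - \<epsilon>) * parabolic.H f a q \<le> (fst p - \<epsilon>) * parabolic.H f a p) \<longrightarrow>
    parabolic.H f a p \<le> C * (1 + 1 / (fst p - \<epsilon>))"
proof -
  obtain C where C: "C > 0" "\<And>(W :: (real \<times> (real^'n::finite)) set) f a b p s. parabolic W f a b \<Longrightarrow> bounded_coeffs M \<mu> a b p \<Longrightarrow>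
    p \<in> W \<Longrightarrow> 0 < s \<Longrightarrow> (\<And>i. dd (space_dir i) (parabolic.H f a) p = 0) \<Longrightarrow>
    (\<Sum>i\<in>UNIV. \<Sum>j\<in>UNIV. a i j p * dd (space_dir i) (dd (space_dir j) (parabolic.H f a)) p) \<le> 0 \<Longrightarrow>
    0 \<le> parabolic.H f a p + s * dd time_dir (parabolic.H f a) p \<Longrightarrow>
    parabolic.H f a p \<le> C * (1 + 1 / s)"
    using li_yau_point[OF assms, where 'n = 'n] by blast
  have "parabolic.H f a p \<le> C * (1 + 1 / (fst p - \<epsilon>))"
    if par: "parabolic W f a b" and bd: "bounded_coeffs M \<mu> a b p" and p: "p \<in> W" and s: "\<epsilon> < fst p" and e: "0 < e"
      and mx: "\<And>q. q \<in> ball p e \<Longrightarrow> fst q \<le> fst p \<Longrightarrow> (fst q - \<epsilon>) * parabolic.H f a q \<le> (fst p - \<epsilon>) * parabolic.H f a p"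
    for W :: "(real \<times> (real^'n)) set" and f a b p \<epsilon> e
  proof (rule C(2)[OF par bd p])
    interpret parabolic W f a b by (rule par)
    note b = bd[unfolded bounded_coeffs_def]
    show s0: "0 < fst p - \<epsilon>" using s by simp
    have dir: "dd (0, w) H p = 0 \<and> dd (0, w) (dd (0, w) H) p \<le> 0" for w
    proof -
      have nw: "norm w + 1 > 0" by (smt (verit) norm_ge_zero)
      have "H (p + r *\<^sub>R (0, w)) \<le> H p" if r: "\<bar>r\<bar> < e / (norm w + 1)" for r
      proof -
        have "\<bar>r\<bar> * norm w \<le> \<bar>r\<bar> * (norm w + 1)" by (simp add: algebra_simps)
        also have "\<dots> < e" using r nw by (simp add: field_simps)
        finally have "p + r *\<^sub>R (0, w) \<in> ball p e" by (simp add: dist_norm norm_Pair)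
        from mx[OF this] show ?thesis using s0 by simp
      qed
      then show ?thesis using local_max_direction[OF open_W smooth_H p, of "e / (norm w + 1)" "(0, w)"] e nw by auto
    qed
    show "Dx i H p = 0" for i using dir[of "axis i 1"] unfolding space_dir_def by simp
    have psd: "0 \<le> (\<Sum>i\<in>UNIV. \<Sum>j\<in>UNIV. a i j p * w i * w j)" for w
    proof -
      have "0 \<le> \<mu> * (\<Sum>i\<in>UNIV. w i * w i)" using assms(2) by (simp add: sum_nonneg)
      also have "\<dots> \<le> (\<Sum>i\<in>UNIV. \<Sum>j\<in>UNIV. a i j p * w i * w j)" by (rule bounded_coeffs_elliptic[OF bd])
      finally show ?thesis .
    qed
    \<comment> \<open>Factoring the matrix \<open>a\<close> turns a^ij H_ij into a sum of second
      derivatives along the rows of \<open>Y\<close>, each nonpositive at the maximum.\<close>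
    have "\<exists>Y :: 'n \<Rightarrow> 'n \<Rightarrow> real. \<forall>i j. a i j p = (\<Sum>r\<in>UNIV. Y r i * Y r j)"
      by (rule psd_factor[OF _ psd]) (use b in blast)
    then obtain Y :: "'n \<Rightarrow> 'n \<Rightarrow> real" where Y: "\<forall>i j. a i j p = (\<Sum>r\<in>UNIV. Y r i * Y r j)" by blast
    have second: "dd (0, w) (dd (0, w) H) p = (\<Sum>i\<in>UNIV. \<Sum>j\<in>UNIV. w $ i * w $ j * Dx i (Dx j H) p)" for w :: "real^'n"
    proof -
      have "dd (0, w) (dd (0, w) H) p = dd (0, w) (\<lambda>q. \<Sum>j\<in>UNIV. w $ j * Dx j H q) p"
        by (rule dd_cong_open[OF open_W p]) (rule dd_space_vector[OF diff[OF smooth_H]])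
      also have "\<dots> = (\<Sum>j\<in>UNIV. w $ j * dd (0, w) (Dx j H) p)"
        by (simp add: dd_sum dd_mult diff[OF smooth_dd[OF smooth_H] p])
      also have "\<dots> = (\<Sum>j\<in>UNIV. \<Sum>i\<in>UNIV. w $ i * w $ j * Dx i (Dx j H) p)"
        by (simp add: dd_space_vector[OF diff[OF smooth_dd[OF smooth_H] p]] sum_distrib_left mult_ac)
      finally show ?thesis by (subst sum.swap)
    qed
    have "(\<Sum>i\<in>UNIV. \<Sum>j\<in>UNIV. a i j p * Dx i (Dx j H) p) =
        (\<Sum>i\<in>UNIV. \<Sum>j\<in>UNIV. \<Sum>r\<in>UNIV. Y r i * Y r j * Dx i (Dx j H) p)"
      by (simp add: Y sum_distrib_right)
    also have "\<dots> = (\<Sum>r\<in>UNIV. \<Sum>i\<in>UNIV. \<Sum>j\<in>UNIV. Y r i * Y r j * Dx i (Dx j H) p)"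
      by (rule sum_rotate[symmetric])
    also have "\<dots> = (\<Sum>r\<in>UNIV. dd (0, \<chi> i. Y r i) (dd (0, \<chi> i. Y r i) H) p)"
      unfolding second by simp
    also have "\<dots> \<le> 0" using dir by (intro sum_nonpos) auto
    finally show "(\<Sum>i\<in>UNIV. \<Sum>j\<in>UNIV. a i j p * Dx i (Dx j H) p) \<le> 0" .
    \<comment> \<open>The expression is the time derivative of the weighted function; if it were
      negative, slightly earlier times would give larger values.\<close>
    show "0 \<le> H p + (fst p - \<epsilon>) * Dt H p"
    proof (rule ccontr)
      assume neg: "\<not> 0 \<le> H p + (fst p - \<epsilon>) * Dt H p"
      have dH: "((\<lambda>r. H (p + r *\<^sub>R time_dir)) has_real_derivative Dt H p) (at 0)"
        using dd_line[of H p 0 time_dir] diff[OF smooth_H p] by simp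
      have "((\<lambda>r. (fst p + r - \<epsilon>) * H (p + r *\<^sub>R time_dir)) has_real_derivative H p + (fst p - \<epsilon>) * Dt H p) (at 0)"
        by (rule derivative_eq_intros dH refl | simp)+
      from DERIV_neg_dec_left[OF this] neg obtain d where
        d: "d > 0" "\<And>h. 0 < h \<Longrightarrow> h < d \<Longrightarrow> (fst p + 0 - \<epsilon>) * H (p + 0 *\<^sub>R time_dir) < (fst p + (0 - h) - \<epsilon>) * H (p + (0 - h) *\<^sub>R time_dir)"
        by auto
      define h where "h = min d e / 2"
      have h: "0 < h" "h < d" "h < e" unfolding h_def using d e by auto
      have "p + (0 - h) *\<^sub>R time_dir \<in> ball p e" using h by (simp add: dist_norm time_dir_def norm_Pair)
      from mx[OF this] have "(fst p + (0 - h) - \<epsilon>) * H (p + (0 - h) *\<^sub>R time_dir) \<le> (fst p - \<epsilon>) * H p"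
        using h by (simp add: time_dir_def)
      then show False using d(2)[OF h(1,2)] by simp
    qed
  qed
  then show ?thesis using C(1) by blast
qed

text \<open>Along the segment, df/dt = f_t + w . grad f. Here f_t = (Q - H)/2, where Q / 2 supplies
  a quadratic term in the gradient that absorbs the linear one, and H is bounded by
  hypothesis.\<close>

lemma (in parabolic) harnack_segment:
  assumes S: "{0<..} \<times> ball z r \<subseteq> W" and \<mu>: "0 < \<mu>"
    and bd: "\<And>p. p \<in> {0<..} \<times> ball z r \<Longrightarrow> bounded_coeffs M \<mu> a b p"
    and HC: "\<And>p. p \<in> {0<..} \<times> ball z r \<Longrightarrow> H p \<le> K * (1 + 1 / fst p)"
    and y: "y\<^sub>1 \<in> ball z r" "y\<^sub>2 \<in> ball z r" and s: "0 < s\<^sub>1" "s\<^sub>1 < s\<^sub>2"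
  shows "f (s\<^sub>1, y\<^sub>1) \<le> f (s\<^sub>2, y\<^sub>2) + K / 2 * (s\<^sub>2 - s\<^sub>1 + ln (s\<^sub>2 / s\<^sub>1)) + 2 * r\<^sup>2 / (\<mu> * (s\<^sub>2 - s\<^sub>1))"
proof -
  define \<tau> where "\<tau> = s\<^sub>2 - s\<^sub>1"
  have \<tau>: "0 < \<tau>" unfolding \<tau>_def using s by simp
  define w where "w = (1 / \<tau>) *\<^sub>R (y\<^sub>2 - y\<^sub>1)"
  \<comment> \<open>The line extrapolated to time 0, so that the parameter along it is the
    time.\<close>
  define p\<^sub>0 where "p\<^sub>0 = (0 :: real, y\<^sub>1 - s\<^sub>1 *\<^sub>R w)"
  define v where "v = (1 :: real, w)"
  have path: "p\<^sub>0 + t *\<^sub>R v = (t, y\<^sub>1 + (t - s\<^sub>1) *\<^sub>R w)" for t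
    unfolding p\<^sub>0_def v_def by (simp add: algebra_simps)
  have inS: "p\<^sub>0 + t *\<^sub>R v \<in> {0<..} \<times> ball z r" if t: "s\<^sub>1 \<le> t" "t \<le> s\<^sub>2" for t
  proof -
    define q where "q = (t - s\<^sub>1) / \<tau>"
    have q: "0 \<le> q" "q \<le> 1" unfolding q_def using t \<tau> by (auto simp: \<tau>_def)
    have "y\<^sub>1 + (t - s\<^sub>1) *\<^sub>R w = (1 - q) *\<^sub>R y\<^sub>1 + q *\<^sub>R y\<^sub>2"
      unfolding w_def q_def by (simp add: algebra_simps)
    moreover have "(1 - q) *\<^sub>R y\<^sub>1 + q *\<^sub>R y\<^sub>2 \<in> ball z r"
      using convex_ball[of z r] y q unfolding convex_def by (metis diff_add_cancel diff_ge_0_iff_ge)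
    ultimately show ?thesis unfolding path using t s by auto
  qed
  have wn: "(\<Sum>i\<in>UNIV. w $ i * w $ i) \<le> 4 * r\<^sup>2 / \<tau>\<^sup>2"
  proof -
    have "norm (y\<^sub>2 - y\<^sub>1) \<le> 2 * r"
      using y dist_triangle2[of y\<^sub>2 y\<^sub>1 z] by (simp add: dist_norm[symmetric] dist_commute)
    then have "(norm (y\<^sub>2 - y\<^sub>1))\<^sup>2 \<le> (2 * r)\<^sup>2" by (intro power_mono) auto
    then have "(norm w)\<^sup>2 \<le> 4 * r\<^sup>2 / \<tau>\<^sup>2"
      unfolding w_def using \<tau> by (simp add: power_mult_distrib power_divide divide_right_mono)
    then show ?thesis by (simp add: power2_norm_eq_inner inner_vec_def)
  qed
  \<comment> \<open>The cost |w|^2 / (2 \<mu>) of completing the square, with |w| at most 2 r /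
    \<tau>. Adding D t and the primitive of K/2 (1 + 1/t) makes \<Psi> nondecreasing.\<close>
  define D where "D = 2 * r\<^sup>2 / (\<mu> * \<tau>\<^sup>2)"
  define \<Psi> where "\<Psi> t = f (p\<^sub>0 + t *\<^sub>R v) + K / 2 * (t + ln t) + D * t" for t
  have "\<exists>y. (\<Psi> has_real_derivative y) (at t) \<and> 0 \<le> y" if t: "s\<^sub>1 \<le> t" "t \<le> s\<^sub>2" for t
  proof -
    let ?p = "p\<^sub>0 + t *\<^sub>R v"
    have p: "?p \<in> W" "fst ?p = t" "t > 0" using inS[OF t] S by (auto simp: path)
    have df: "f differentiable at ?p" by (rule diff[OF smooth_f p(1)])
    have deriv: "(\<Psi> has_real_derivative dd v f ?p + K / 2 * (1 + 1 / t) + D) (at t)"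
      unfolding \<Psi>_def[abs_def] using p(3)
      by (auto intro!: derivative_eq_intros dd_line df simp: field_simps)
    interpret lin: linear "\<lambda>b. dd b f ?p" by (rule linear_dd[OF df])
    have "v = time_dir + (0, w)" unfolding v_def time_dir_def by simp
    then have dv: "dd v f ?p = Dt f ?p + (\<Sum>i\<in>UNIV. w $ i * Dx i f ?p)"
      using lin.add[of time_dir "(0, w)"] dd_space_vector[OF df, of w] by simp
    have "\<mu> * (\<Sum>i\<in>UNIV. Dx i f ?p * Dx i f ?p) \<le> Q ?p"
      unfolding Q_def \<Gamma>_def by (rule bounded_coeffs_elliptic[OF bd[OF inS[OF t]]])
    moreover have "2 * Dt f ?p = Q ?p - H ?p" unfolding H_def by simp
    moreover have "H ?p \<le> K * (1 + 1 / t)" using HC[OF inS[OF t]] unfolding p(2) .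
    ultimately have 1: "Dt f ?p \<ge> \<mu> / 2 * (\<Sum>i\<in>UNIV. Dx i f ?p * Dx i f ?p) - K / 2 * (1 + 1 / t)"
      by (simp add: field_simps)
    have "0 \<le> \<mu> / 2 * (Dx i f ?p * Dx i f ?p) + w $ i * Dx i f ?p + (w $ i * w $ i) / (2 * \<mu>)" for i
    proof -
      have "0 \<le> (\<mu> * Dx i f ?p + w $ i)\<^sup>2 / (2 * \<mu>)" using \<mu> by simp
      also have "\<dots> = \<mu> / 2 * (Dx i f ?p * Dx i f ?p) + w $ i * Dx i f ?p + (w $ i * w $ i) / (2 * \<mu>)"
        using \<mu> by (simp add: power2_eq_square field_simps)
      finally show ?thesis .
    qed
    then have "0 \<le> (\<Sum>i\<in>UNIV. \<mu> / 2 * (Dx i f ?p * Dx i f ?p) + w $ i * Dx i f ?p + (w $ i * w $ i) / (2 * \<mu>))"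
      by (intro sum_nonneg) auto
    then have 2: "0 \<le> \<mu> / 2 * (\<Sum>i\<in>UNIV. Dx i f ?p * Dx i f ?p) + (\<Sum>i\<in>UNIV. w $ i * Dx i f ?p) +
        (\<Sum>i\<in>UNIV. w $ i * w $ i) / (2 * \<mu>)"
      by (simp add: sum.distrib sum_distrib_left sum_divide_distrib)
    have 3: "(\<Sum>i\<in>UNIV. w $ i * w $ i) / (2 * \<mu>) \<le> D"
      using divide_right_mono[OF wn, of "2 * \<mu>"] \<mu> unfolding D_def by (simp add: mult_ac)
    have "0 \<le> dd v f ?p + K / 2 * (1 + 1 / t) + D" unfolding dv using 1 2 3 by linarith
    then show ?thesis using deriv by blast
  qed
  then have "\<Psi> s\<^sub>1 \<le> \<Psi> s\<^sub>2"
    using DERIV_nonneg_imp_nondecreasing[of s\<^sub>1 s\<^sub>2 \<Psi>] s by auto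
  moreover have "p\<^sub>0 + s\<^sub>1 *\<^sub>R v = (s\<^sub>1, y\<^sub>1)" "p\<^sub>0 + s\<^sub>2 *\<^sub>R v = (s\<^sub>2, y\<^sub>2)"
    unfolding path w_def \<tau>_def[symmetric] using \<tau> by auto
  moreover have "D * s\<^sub>2 - D * s\<^sub>1 = 2 * r\<^sup>2 / (\<mu> * \<tau>)"
  proof -
    have "D * s\<^sub>2 - D * s\<^sub>1 = D * \<tau>" unfolding \<tau>_def by (simp add: algebra_simps)
    also have "\<dots> = 2 * r\<^sup>2 / (\<mu> * \<tau>)" unfolding D_def using \<tau> by (simp add: power2_eq_square)
    finally show ?thesis .
  qed
  moreover have "K / 2 * (s\<^sub>2 - s\<^sub>1 + ln (s\<^sub>2 / s\<^sub>1)) = K / 2 * (s\<^sub>2 + ln s\<^sub>2) - K / 2 * (s\<^sub>1 + ln s\<^sub>1)"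
    using s by (simp add: ln_div algebra_simps)
  ultimately show ?thesis unfolding \<Psi>_def \<tau>_def[symmetric] by (simp add: diff_divide_distrib)
qed

section \<open>Chart invariance and chains of coordinate balls\<close>

lemma matrix_add_rdistrib: "(A + B) ** C = A ** C + B ** (C :: real^'n^'m::finite)"
  by (vector matrix_matrix_mult_def sum.distrib[symmetric] field_simps)

lemma graph_metric_matrix:
  "graph_metric G \<omega> y = G y + cov_matrix G \<omega> y ** matrix_inv (G y) ** transpose (cov_matrix G \<omega> y)"
proof -
  have "(\<Sum>k\<in>UNIV. \<Sum>l\<in>UNIV. X $ i $ k * Y $ k $ l * X $ j $ l) = (X ** Y ** transpose X) $ i $ j"
    for X Y :: "real^'a^'a" and i j
    by (subst sum.swap) (simp add: matrix_matrix_mult_def transpose_def sum_distrib_right)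
  then show ?thesis by (simp add: vec_eq_iff graph_metric_def)
qed

context coord_change
begin

definition Jm :: "real^'n \<Rightarrow> real^'n^'n" where
  "Jm y = (\<chi> k i. J k i y)"

lemma congruence_iff:
  "N' = transpose (Jm y) ** N ** Jm y \<longleftrightarrow>
    (\<forall>i j. N' $ i $ j = (\<Sum>k\<in>UNIV. \<Sum>l\<in>UNIV. J k i y * J l j y * N $ k $ l))"
proof -
  have "(\<Sum>k\<in>UNIV. \<Sum>l\<in>UNIV. J k i y * J l j y * N $ k $ l) = (transpose (Jm y) ** N ** Jm y) $ i $ j" for i j
    by (subst sum.swap) (simp add: Jm_def matrix_matrix_mult_def transpose_def sum_distrib_right sum_distrib_left mult_ac)
  then show ?thesis by (simp add: vec_eq_iff)
qed

text \<open>The matrix of \<chi> is the pullback of a 2-tensor, and the two Jacobians meeting at the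
  inverse metric merge into the inverse metric of the other chart.\<close>

lemma graph_metric_change:
  assumes y: "y \<in> U"
    and \<omega>: "\<And>y i. y \<in> U \<Longrightarrow> \<omega>' y $ i = (\<Sum>k\<in>UNIV. J k i y * \<omega> (\<Phi> y) $ k)"
    and d\<omega>: "\<And>y i. y \<in> V \<Longrightarrow> (\<lambda>y. \<omega> y $ i) differentiable at y"
  shows "graph_metric G' \<omega>' y = transpose (Jm y) ** graph_metric G \<omega> (\<Phi> y) ** Jm y"
proof -
  have "tensor_related (Suc 0) (\<lambda>ks z. \<omega>' z $ hd ks) (\<lambda>ks z. \<omega> z $ hd ks)"
    unfolding tensor_related_def
  proof (intro ballI allI impI)
    fix y and iss :: "'n list" assume y: "y \<in> U" and "length iss = Suc 0"
    then obtain i where "iss = [i]" by (auto simp: length_Suc_conv)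
    then show "\<omega>' y $ hd iss = (\<Sum>ks | length ks = Suc 0. (\<Prod>a<Suc 0. J (ks ! a) (iss ! a) y) * \<omega> (\<Phi> y) $ hd ks)"
      unfolding sum_lists_Suc by (simp add: \<omega>[OF y])
  qed
  then have rel: "tensor_related (Suc (Suc 0)) (cov_deriv G' (\<lambda>ks z. \<omega>' z $ hd ks)) (cov_deriv G (\<lambda>ks z. \<omega> z $ hd ks))"
    by (rule cov_deriv_related) (rule d\<omega>)
  have "cov_deriv G' (\<lambda>ks z. \<omega>' z $ hd ks) [i, j] y =
      (\<Sum>k\<in>UNIV. \<Sum>l\<in>UNIV. J k i y * J l j y * cov_deriv G (\<lambda>ks z. \<omega> z $ hd ks) [k, l] (\<Phi> y))" for i j
    using tensor_relatedD[OF rel y, of "[i, j]"] unfolding sum_lists_Suc by simp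
  then have X: "cov_matrix G' \<omega>' y = transpose (Jm y) ** cov_matrix G \<omega> (\<Phi> y) ** Jm y"
    unfolding congruence_iff by (simp add: cov_matrix_def del: cov_deriv.simps)
  have g: "G' y = transpose (Jm y) ** G (\<Phi> y) ** Jm y"
    unfolding congruence_iff using metric_change_J[OF y] by blast
  have gi: "Jm y ** (matrix_inv (G' y) ** transpose (Jm y)) = matrix_inv (G (\<Phi> y))"
    using congruence_matrix_inv[OF g det_G'[OF y] det_G[OF \<Phi>_V[OF y]]] by (simp add: matrix_mul_assoc)
  let ?J = "Jm y" and ?X = "cov_matrix G \<omega> (\<Phi> y)"
  have "cov_matrix G' \<omega>' y ** matrix_inv (G' y) ** transpose (cov_matrix G' \<omega>' y) =
      transpose ?J ** (?X ** ((?J ** (matrix_inv (G' y) ** transpose ?J)) ** (transpose ?X ** ?J)))"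
    unfolding X by (simp add: matrix_transpose_mul matrix_mul_assoc)
  also have "\<dots> = transpose ?J ** (?X ** matrix_inv (G (\<Phi> y)) ** transpose ?X) ** ?J"
    unfolding gi by (simp add: matrix_mul_assoc)
  finally show ?thesis
    unfolding graph_metric_matrix g[symmetric]
    by (simp only: g matrix_add_ldistrib matrix_add_rdistrib)
qed

text \<open>A covector measured by an inverse metric; this gives the chart independence of the
  gradient part of H.\<close>

lemma gradient_form_change:
  fixes F F' :: "'n \<Rightarrow> real"
  assumes N: "N' = transpose (Jm y) ** N ** Jm y" "det N' \<noteq> 0" "det N \<noteq> 0"
    and F: "\<And>i. F' i = (\<Sum>k\<in>UNIV. J k i y * F k)"
  shows "(\<Sum>i\<in>UNIV. \<Sum>j\<in>UNIV. matrix_inv N' $ i $ j * F' i * F' j) =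
    (\<Sum>i\<in>UNIV. \<Sum>j\<in>UNIV. matrix_inv N $ i $ j * F i * F j)"
proof -
  let ?v = "\<chi> i. F i" and ?v' = "\<chi> i. F' i" and ?J = "Jm y"
  have v': "?v' = transpose ?J *v ?v"
    by (simp add: vec_eq_iff F Jm_def matrix_vector_mult_def transpose_def)
  have "?v \<bullet> (matrix_inv N *v ?v) = ?v \<bullet> (?J *v (matrix_inv N' *v ?v'))"
    unfolding congruence_matrix_inv[OF N] v' by (simp only: matrix_vector_mul_assoc matrix_mul_assoc)
  also have "\<dots> = ?v' \<bullet> (matrix_inv N' *v ?v')"
    unfolding v' by (simp only: transpose_matrix_vector dot_lmul_matrix)
  finally show ?thesis unfolding inner_matrix_form by simp
qed

end

section \<open>The equation for the logarithm of a solution\<close>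

context chart_piece
begin

definition lnv :: "(real \<Rightarrow> 'a \<Rightarrow> real) \<Rightarrow> real \<times> (real^'n) \<Rightarrow> real" where
  "lnv v p = ln (fld v p)"

lemma solution_pos:
  assumes "positive_solution \<A> g \<xi> u v" "p \<in> W"
  shows "0 < fld v p"
  using assms unfolding positive_solution_def fld_def in_chart_def by auto

lemma smooth_lnv:
  assumes "positive_solution \<A> g \<xi> u v"
  shows "smooth_on W (lnv v)"
  unfolding lnv_def[abs_def]
  by (rule smooth_on_ln[OF open_W smooth_fld solution_pos[OF assms]])
    (use assms positive_solution_def in blast)

lemma fld_time:
  assumes "smooth_on W (fld v)" "p \<in> W"
  shows "((\<lambda>s. v s (chart_inv c (snd p))) has_real_derivative dd time_dir (fld v) p) (at (fst p))"
  using dd_slice_time[of "fld v" "fst p" "snd p"] smooth_on_differentiable[OF open_W assms]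
  by (simp add: time_dir_def fld_def in_chart_def has_real_derivative_iff_has_vector_derivative)

lemma hessian_eq:
  assumes "smooth_on W (fld v)" "p \<in> W"
  shows "iter_cov_deriv (g c) 2 (in_chart c (v (fst p))) [i, j] (snd p) =
    dd (space_dir i) (dd (space_dir j) (fld v)) p - (\<Sum>m\<in>UNIV. Gam m i j p * dd (space_dir m) (fld v) p)"
proof -
  have "dd (space_dir i) (T v (Suc 0) [j]) p = dd (space_dir i) (dd (space_dir j) (fld v)) p"
    by (rule dd_cong_open[OF open_W assms(2) T_1[OF assms(1)]])
  moreover have "T v (Suc (Suc 0)) [i, j] p = dd (space_dir i) (T v (Suc 0) [j]) p -
      (\<Sum>a<Suc 0. \<Sum>m\<in>UNIV. Gam m i ([j] ! a) p * T v (Suc 0) ([j][a := m]) p)"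
    by (rule T_Suc[OF smooth_T[OF assms(1)] _ assms(2)]) simp_all
  ultimately have "T v (Suc (Suc 0)) [i, j] p = dd (space_dir i) (dd (space_dir j) (fld v)) p -
      (\<Sum>m\<in>UNIV. Gam m i j p * dd (space_dir m) (fld v) p)"
    by (simp add: T_1[OF assms])
  then show ?thesis by (simp add: T_def numeral_2_eq_2 del: iter_cov_deriv_Suc)
qed

text \<open>Dividing the equation by v, and d_ij v / v = f_ij + f_i f_j for f = ln v produces the
  quadratic gradient term.\<close>

lemma parabolic_lnv:
  assumes u: "smooth_on W (fld u)" and sol: "positive_solution \<A> g \<xi> u v"
  shows "parabolic W (lnv v) (ac u) (bc u)"
proof
  show "open W" by (rule open_W)
  show "smooth_on W (lnv v)" by (rule smooth_lnv[OF sol])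
  show "smooth_on W (ac u i j)" for i j by (rule smooth_ac[OF u])
  show "smooth_on W (bc u m)" for m by (rule smooth_bc[OF u])
  show "ac u i j p = ac u j i p" if "p \<in> W" for i j p
  proof -
    have y: "snd p \<in> V" using that by auto
    have "transpose (matrix_inv (eta u p)) $ i $ j = matrix_inv (eta u p) $ i $ j"
      using matrix_inv_sym[OF eta_sym[OF y] det_eta_nz[OF y], of u] by simp
    then show ?thesis unfolding ac_def by (simp add: transpose_def)
  qed
  fix p assume p: "p \<in> W"
  have sm: "smooth_on W (fld v)" using sol smooth_fld unfolding positive_solution_def by blast
  note d = smooth_on_differentiable[OF open_W] and sd = smooth_on_dd[OF open_W]
  let ?V = "fld v"
  have pos: "0 < ?V q" if "q \<in> W" for q by (rule solution_pos[OF sol that])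
  have 1: "dd w (lnv v) q = inverse (?V q) * dd w ?V q" if "q \<in> W" for w q
    unfolding lnv_def[abs_def] by (rule dd_ln[OF d[OF sm that] pos[OF that]])
  have 2: "dd w' (dd w (lnv v)) p = inverse (?V p) * dd w' (dd w ?V) p - inverse (?V p) * inverse (?V p) * dd w' ?V p * dd w ?V p" for w w'
  proof -
    have nz: "?V p \<noteq> 0" using pos[OF p] by simp
    have "dd w' (dd w (lnv v)) p = dd w' (\<lambda>q. inverse (?V q) * dd w ?V q) p"
      by (rule dd_cong_open[OF open_W p 1])
    also have "\<dots> = inverse (?V p) * dd w' (dd w ?V) p + dd w' (\<lambda>q. inverse (?V q)) p * dd w ?V p"
      by (rule dd_mult[OF differentiable_inverse[OF d[OF sm p] nz] d[OF sd[OF sm] p]])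
    finally show ?thesis unfolding dd_inverse[OF d[OF sm p] nz] by simp
  qed
  have "((\<lambda>s. in_chart c (v s) (snd p)) has_real_derivative (\<Sum>i\<in>UNIV. \<Sum>j\<in>UNIV. ac u i j p *
      iter_cov_deriv (g c) 2 (in_chart c (v (fst p))) [i, j] (snd p))) (at (fst p))"
    using sol p c unfolding positive_solution_def ac_def eta_def by auto
  then have "dd time_dir ?V p = (\<Sum>i\<in>UNIV. \<Sum>j\<in>UNIV. ac u i j p *
      (dd (space_dir i) (dd (space_dir j) ?V) p - (\<Sum>m\<in>UNIV. Gam m i j p * dd (space_dir m) ?V p)))"
    using DERIV_unique[OF fld_time[OF sm p]] unfolding hessian_eq[OF sm p] in_chart_def by simp
  also have "\<dots> = (\<Sum>i\<in>UNIV. \<Sum>j\<in>UNIV. ac u i j p * dd (space_dir i) (dd (space_dir j) ?V) p) -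
      (\<Sum>i\<in>UNIV. \<Sum>j\<in>UNIV. \<Sum>m\<in>UNIV. ac u i j p * Gam m i j p * dd (space_dir m) ?V p)"
    by (simp add: right_diff_distrib sum_subtractf sum_distrib_left mult.assoc)
  also have "(\<Sum>i\<in>UNIV. \<Sum>j\<in>UNIV. \<Sum>m\<in>UNIV. ac u i j p * Gam m i j p * dd (space_dir m) ?V p) =
      (\<Sum>m\<in>UNIV. \<Sum>i\<in>UNIV. \<Sum>j\<in>UNIV. ac u i j p * Gam m i j p * dd (space_dir m) ?V p)"
    by (rule sum_rotate[symmetric])
  also have "\<dots> = - (\<Sum>m\<in>UNIV. bc u m p * dd (space_dir m) ?V p)"
    unfolding bc_def by (simp add: sum_distrib_right sum_negf)
  finally have Vt: "dd time_dir ?V p = (\<Sum>i\<in>UNIV. \<Sum>j\<in>UNIV. ac u i j p * dd (space_dir i) (dd (space_dir j) ?V) p) +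
      (\<Sum>m\<in>UNIV. bc u m p * dd (space_dir m) ?V p)" by simp
  show "dd time_dir (lnv v) p = (\<Sum>i\<in>UNIV. \<Sum>j\<in>UNIV. ac u i j p * dd (space_dir i) (dd (space_dir j) (lnv v)) p) +
      (\<Sum>m\<in>UNIV. bc u m p * dd (space_dir m) (lnv v) p) +
      (\<Sum>i\<in>UNIV. \<Sum>j\<in>UNIV. ac u i j p * dd (space_dir i) (lnv v) p * dd (space_dir j) (lnv v) p)"
  proof -
    let ?i = "inverse (?V p)"
    have "(\<Sum>i\<in>UNIV. \<Sum>j\<in>UNIV. ac u i j p * (?i * dd (space_dir i) (dd (space_dir j) ?V) p -
          ?i * ?i * dd (space_dir i) ?V p * dd (space_dir j) ?V p)) =
        ?i * (\<Sum>i\<in>UNIV. \<Sum>j\<in>UNIV. ac u i j p * dd (space_dir i) (dd (space_dir j) ?V) p) -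
        (\<Sum>i\<in>UNIV. \<Sum>j\<in>UNIV. ac u i j p * (?i * dd (space_dir i) ?V p) * (?i * dd (space_dir j) ?V p))"
    proof -
      have "x * (?i * y - ?i * ?i * s * t) = ?i * (x * y) - x * (?i * s) * (?i * t)" for x y s t
        by (simp add: algebra_simps)
      then show ?thesis by (simp only: sum_subtractf sum_distrib_left)
    qed
    moreover have "(\<Sum>m\<in>UNIV. bc u m p * (?i * dd (space_dir m) ?V p)) = ?i * (\<Sum>m\<in>UNIV. bc u m p * dd (space_dir m) ?V p)"
      by (simp add: sum_distrib_left mult_ac)
    ultimately show ?thesis unfolding 1[OF p] 2 Vt distrib_left by linarith
  qed
qed

end

text \<open>The points reachable from x form an open set with open complement, so every pair is
  joined by a chain. A common length comes from the finitely many pairs of sets, with one more link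
  at each end to reach a chosen representative.\<close>

lemma connected_chain:
  fixes \<U> :: "'a::topological_space set set"
  assumes conn: "connected (UNIV :: 'a set)" and fin: "finite \<U>" and op: "\<And>U. U \<in> \<U> \<Longrightarrow> open U"
    and cover: "\<Union>\<U> = UNIV"
  obtains N where "0 < N" "\<And>x y. (x, y) \<in> {(x, y). \<exists>U\<in>\<U>. x \<in> U \<and> y \<in> U} ^^ N"
proof -
  define E where "E = {(x, y). \<exists>U\<in>\<U>. x \<in> U \<and> y \<in> U}"
  have EI: "(x, y) \<in> E" if "U \<in> \<U>" "x \<in> U" "y \<in> U" for x y U
    unfolding E_def using that by blast
  have cov: "\<exists>U. U \<in> \<U> \<and> x \<in> U" for x
  proof -
    have "x \<in> \<Union>\<U>" unfolding cover by simp
    then show ?thesis by blast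
  qed
  have refl: "(x, x) \<in> E" for x using cov[of x] EI by blast
  have reach: "(x, y) \<in> E\<^sup>*" for x y
  proof -
    let ?R = "{y. (x, y) \<in> E\<^sup>*}"
    have "open ?R"
    proof (subst open_subopen, intro ballI)
      fix y assume y: "y \<in> ?R"
      obtain U where U: "U \<in> \<U>" "y \<in> U" using cov[of y] by blast
      have "U \<subseteq> ?R"
      proof
        fix w assume "w \<in> U"
        then have "(y, w) \<in> E" using U EI by blast
        moreover have "(x, y) \<in> E\<^sup>*" using y by blast
        ultimately have "(x, w) \<in> E\<^sup>*" by (rule rtrancl_into_rtrancl[rotated])
        then show "w \<in> ?R" by blast
      qed
      then show "\<exists>T. open T \<and> y \<in> T \<and> T \<subseteq> ?R" using op U by blast
    qed
    moreover have "open (- ?R)"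
    proof (subst open_subopen, intro ballI)
      fix y assume y: "y \<in> - ?R"
      obtain U where U: "U \<in> \<U>" "y \<in> U" using cov[of y] by blast
      have "U \<subseteq> - ?R"
      proof
        fix w assume w: "w \<in> U"
        show "w \<in> - ?R"
        proof
          assume "w \<in> ?R"
          then have "(x, w) \<in> E\<^sup>*" by blast
          moreover have "(w, y) \<in> E" using U w EI by blast
          ultimately have "(x, y) \<in> E\<^sup>*" by (rule rtrancl_into_rtrancl)
          then show False using y by blast
        qed
      qed
      then show "\<exists>T. open T \<and> y \<in> T \<and> T \<subseteq> - ?R" using op U by blast
    qed
    moreover have "x \<in> ?R" by simp
    ultimately have "- ?R = {}"
      using connectedD[OF conn, of ?R "- ?R"] by auto
    then show ?thesis by blast
  qed
  \<comment> \<open>Chains may be lengthened by repeating a point.\<close>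
  have mono: "(x, y) \<in> E ^^ m" if "(x, y) \<in> E ^^ n" "n \<le> m" for x y n m
    using that(2) by (induction m rule: dec_induct) (use that(1) refl in \<open>auto intro: relcompI\<close>)
  \<comment> \<open>The value at an empty set is arbitrary; membership is used only for sets known
    to contain a point.\<close>
  define rep where "rep U = (SOME x. x \<in> U)" for U :: "'a set"
  have rep: "rep U \<in> U" if "x \<in> U" for x U unfolding rep_def using that by (rule someI)
  have "\<exists>n. (rep (fst q), rep (snd q)) \<in> E ^^ n" for q
    using reach rtrancl_imp_relpow by blast
  then have "\<exists>n. \<forall>q. (rep (fst q), rep (snd q)) \<in> E ^^ n q" by (intro choice allI)
  then obtain n where n: "\<And>q. (rep (fst q), rep (snd q)) \<in> E ^^ n q" by blast
  define N where "N = Max (insert 0 (n ` (\<U> \<times> \<U>)))"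
  have "(x, y) \<in> E ^^ (Suc (Suc N))" for x y
  proof -
    obtain U V where UV: "U \<in> \<U>" "x \<in> U" "V \<in> \<U>" "y \<in> V" using cov[of x] cov[of y] by blast
    have "n (U, V) \<le> N" unfolding N_def using fin UV by (intro Max_ge) auto
    then have "(rep U, rep V) \<in> E ^^ N" using mono n[of "(U, V)"] by simp
    moreover have "(x, rep U) \<in> E" by (rule EI[OF UV(1,2) rep[OF UV(2)]])
    moreover have "(rep V, y) \<in> E" by (rule EI[OF UV(3) rep[OF UV(4)] UV(4)])
    ultimately have "(x, rep V) \<in> E ^^ Suc N" using relpow_Suc_I2 by metis
    then show ?thesis using \<open>(rep V, y) \<in> E\<close> by (rule relpow_Suc_I)
  qed
  then show ?thesis unfolding E_def by (intro that[of "Suc (Suc N)"]) auto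
qed

section \<open>The Harnack inequality\<close>

lemma finite_uniform_constants:
  assumes "finite F" "\<And>x. x \<in> F \<Longrightarrow> \<exists>M>0. \<exists>\<mu>>0. P M \<mu> x"
    and mono: "\<And>M \<mu> M' \<mu>' x. P M \<mu> x \<Longrightarrow> M \<le> M' \<Longrightarrow> \<mu>' \<le> \<mu> \<Longrightarrow> P M' \<mu>' x"
  shows "\<exists>M>0::real. \<exists>\<mu>>0::real. \<forall>x\<in>F. P M \<mu> x"
  using assms(1,2)
proof (induction F rule: finite_induct)
  case empty
  then show ?case by (auto intro: exI[of _ 1])
next
  case (insert x F)
  then obtain M \<mu> where 1: "M > 0" "\<mu> > 0" "\<forall>x\<in>F. P M \<mu> x" by auto
  obtain M' \<mu>' where 2: "M' > 0" "\<mu>' > 0" "P M' \<mu>' x" using insert.prems by blast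
  have "P (max M M') (min \<mu> \<mu>') y" if y: "y \<in> insert x F" for y
  proof (cases "y = x")
    case True
    then show ?thesis using mono[OF 2(3)] by simp
  next
    case False
    then have "P M \<mu> y" using 1(3) y by blast
    from mono[OF this] show ?thesis by simp
  qed
  moreover have "max M M' > 0" "min \<mu> \<mu>' > 0" using 1 2 by auto
  ultimately show ?case by blast
qed

lemma tensor_norm_sq_cong:
  assumes "\<And>is. length is = k \<Longrightarrow> T is = T' is"
  shows "tensor_norm_sq G k T y = tensor_norm_sq G k T' y"
  unfolding tensor_norm_sq_def using assms by (intro sum.cong refl) simp

locale flow = riemannian \<A> g for \<A> :: "('a::t2_space, 'n::finite) chart set" and g +
  fixes \<xi> :: "('a, 'n) one_form"
  assumes closed: "closed_one_form \<A> \<xi>"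
begin

text \<open>These repeat the functions of \<open>chart_piece\<close> depending on the chart only,
  not on a ball, so that different pieces can be compared.\<close>

definition log_sol :: "('a, 'n) chart \<Rightarrow> (real \<Rightarrow> 'a \<Rightarrow> real) \<Rightarrow> real \<times> (real^'n) \<Rightarrow> real" where
  "log_sol c v p = ln (in_chart c (v (fst p)) (snd p))"

definition acoef :: "('a, 'n) chart \<Rightarrow> (real \<Rightarrow> 'a \<Rightarrow> real) \<Rightarrow> 'n \<Rightarrow> 'n \<Rightarrow> real \<times> (real^'n) \<Rightarrow> real" where
  "acoef c u i j p = matrix_inv (graph_metric (g c) (add_differential \<xi> (u (fst p)) c) (snd p)) $ i $ j"

definition bcoef :: "('a, 'n) chart \<Rightarrow> (real \<Rightarrow> 'a \<Rightarrow> real) \<Rightarrow> 'n \<Rightarrow> real \<times> (real^'n) \<Rightarrow> real" where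
  "bcoef c u m p = - (\<Sum>i\<in>UNIV. \<Sum>j\<in>UNIV. acoef c u i j p * christoffel (g c) m i j (snd p))"

definition LY :: "('a, 'n) chart \<Rightarrow> (real \<Rightarrow> 'a \<Rightarrow> real) \<Rightarrow> (real \<Rightarrow> 'a \<Rightarrow> real) \<Rightarrow> real \<times> (real^'n) \<Rightarrow> real" where
  "LY c u v = parabolic.H (log_sol c v) (acoef c u)"

text \<open>Combines local derivative bounds on one ball with the global flow equation;
  \<open>adm\<close> is its expression in the chart of that ball.\<close>

definition admissible :: "('a, 'n) chart \<Rightarrow> real^'n \<Rightarrow> real \<Rightarrow> real \<Rightarrow> (real \<Rightarrow> 'a \<Rightarrow> real) \<Rightarrow> bool" where
  "admissible c z r K u \<longleftrightarrow> smooth_spacetime \<A> {0<..} u \<and>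
     (\<forall>t>0. \<forall>k\<in>{1..4}. \<forall>y\<in>ball z r. tensor_norm_sq (g c) k (iter_cov_deriv (g c) k (in_chart c (u t))) y \<le> K) \<and>
     (\<exists>\<theta>. \<forall>t>0. lagrangian_angle \<A> g (add_differential \<xi> (u t)) (\<theta> t) \<and>
        (\<forall>x. ((\<lambda>s. u s x) has_real_derivative \<theta> t x) (at t)))"

lemma chart_pieceI: "piece c z r \<Longrightarrow> chart_piece \<A> g \<xi> c z r"
  using closed by unfold_locales

lemma parabolic_log_sol:
  assumes p: "piece c z r" and u: "smooth_spacetime \<A> {0<..} u" and sol: "positive_solution \<A> g \<xi> u v"
  shows "parabolic ({0<..} \<times> chart_img c) (log_sol c v) (acoef c u) (bcoef c u)"
proof -
  interpret C: chart_piece \<A> g \<xi> c z r by (rule chart_pieceI[OF p])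
  have "parabolic C.W (C.lnv v) (C.ac u) (C.bc u)"
    by (rule C.parabolic_lnv[OF C.smooth_fld[OF u] sol])
  moreover have "C.lnv v = log_sol c v" unfolding C.lnv_def[abs_def] C.fld_def log_sol_def[abs_def] ..
  moreover have a: "C.ac u = acoef c u" unfolding C.ac_def[abs_def] C.eta_def acoef_def[abs_def] ..
  moreover have "C.bc u = bcoef c u" unfolding C.bc_def[abs_def] C.Gam_def bcoef_def[abs_def] a ..
  ultimately show ?thesis by simp
qed

lemma piece_coefficients:
  assumes p: "piece c z r"
  shows "\<exists>M>0. \<exists>\<mu>>0. \<forall>u. admissible c z r K u \<longrightarrow>
    (\<forall>p\<in>{0<..} \<times> ball z r. bounded_coeffs M \<mu> (acoef c u) (bcoef c u) p)"
proof -
  interpret C: chart_piece \<A> g \<xi> c z r by (rule chart_pieceI[OF p])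
  have a: "C.ac u = acoef c u" for u unfolding C.ac_def[abs_def] C.eta_def acoef_def[abs_def] ..
  have b: "C.bc u = bcoef c u" for u unfolding C.bc_def[abs_def] C.Gam_def bcoef_def[abs_def] a ..
  have "u \<in> C.adm K" if ad: "admissible c z r K u" for u
    unfolding C.adm_def
  proof (intro CollectI conjI ballI)
    show sm: "smooth_on C.W (C.fld u)" using ad C.smooth_fld unfolding admissible_def by blast
    show "\<forall>t>0. \<forall>k\<in>{1..4}. \<forall>y\<in>ball z r. tensor_norm_sq (g c) k (iter_cov_deriv (g c) k (in_chart c (u t))) y \<le> K"
      using ad unfolding admissible_def by blast
    fix p assume p: "p \<in> C.S"
    then have pW: "p \<in> C.W" and t: "fst p > 0" and y: "snd p \<in> chart_img c" using C.SW by auto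
    obtain \<theta> where \<theta>: "lagrangian_angle \<A> g (add_differential \<xi> (u (fst p))) (\<theta> (fst p))"
      "((\<lambda>s. u s (chart_inv c (snd p))) has_real_derivative \<theta> (fst p) (chart_inv c (snd p))) (at (fst p))"
      using ad t unfolding admissible_def by blast
    have "dd time_dir (C.fld u) p = \<theta> (fst p) (chart_inv c (snd p))"
      by (rule DERIV_unique[OF C.fld_time[OF sm pW] \<theta>(2)])
    moreover have "exp (\<i> * complex_of_real (in_chart c (\<theta> (fst p)) (snd p))) =
          det (\<chi> i j. complex_of_real (g c (snd p) $ i $ j)
                     + \<i> * complex_of_real (cov_matrix (g c) (add_differential \<xi> (u (fst p)) c) (snd p) $ i $ j)) /
          complex_of_real (sqrt (det (g c (snd p))) * sqrt (det (graph_metric (g c) (add_differential \<xi> (u (fst p)) c) (snd p))))"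
      using \<theta>(1) C.c y unfolding lagrangian_angle_def by blast
    ultimately show "exp (\<i> * complex_of_real (dd time_dir (C.fld u) p)) =
        C.Dc u p / complex_of_real (sqrt (det (g c (snd p))) * sqrt (det (C.eta u p)))"
      unfolding C.Dc_def C.eta_def C.chi_def in_chart_def by simp
  qed
  then show ?thesis using C.coefficients[of K] unfolding a b by blast
qed

text \<open>The time derivative is taken at a fixed point of X, and the gradient term is the norm of
  the differential of ln v in the metric \<eta>.\<close>

lemma LY_invariant:
  assumes pc: "piece c z r" and pd: "piece d z' r'" and u: "smooth_spacetime \<A> {0<..} u"
    and sol: "positive_solution \<A> g \<xi> u v" and t: "0 < t" and y: "y \<in> overlap c d"
  shows "LY c u v (t, y) = LY d u v (t, transition c d y)"
proof -
  interpret C: chart_piece \<A> g \<xi> c z r by (rule chart_pieceI[OF pc])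
  interpret D: chart_piece \<A> g \<xi> d z' r' by (rule chart_pieceI[OF pd])
  interpret X: coord_change "overlap c d" "chart_img d" "transition c d" "g d" "g c"
    by (rule change[OF C.c D.c])
  interpret PC: parabolic C.W "log_sol c v" "acoef c u" "bcoef c u" by (rule parabolic_log_sol[OF pc u sol])
  interpret PD: parabolic D.W "log_sol d v" "acoef d u" "bcoef d u" by (rule parabolic_log_sol[OF pd u sol])
  let ?y = "transition c d y"
  have ov: "w \<in> chart_img c" "chart_inv c w \<in> chart_dom d" "transition c d w \<in> chart_img d" if "w \<in> overlap c d" for w
    using that overlap_iff[OF C.c, of w d] X.\<Phi>_V by auto
  have pW: "(t, y) \<in> C.W" "(t, ?y) \<in> D.W" using t ov[OF y] by auto
  have smd: "smooth_on D.W (D.fld u)" by (rule D.smooth_fld[OF u])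
  have ll: "log_sol c v (s, w) = log_sol d v (s, transition c d w)" if "w \<in> overlap c d" for s w
    unfolding log_sol_def using in_chart_change[OF C.c D.c that, of "v s"] by simp
  have dspace: "dd (space_dir i) (log_sol c v) (t, y) = (\<Sum>k\<in>UNIV. X.J k i y * dd (space_dir k) (log_sol d v) (t, ?y))" for i
  proof -
    have "dd (space_dir i) (log_sol c v) (t, y) = pderiv_at i (\<lambda>w. log_sol c v (t, w)) y"
      using C.slice_pderiv[OF PC.smooth_f pW(1), of "\<lambda>w. log_sol c v (t, w)" i] by simp
    also have "\<dots> = pderiv_at i (\<lambda>w. log_sol d v (t, transition c d w)) y"
      unfolding pderiv_at_dd by (rule dd_cong_open[OF X.open_U y ll])
    also have "\<dots> = (\<Sum>k\<in>UNIV. X.J k i y * pderiv_at k (\<lambda>w. log_sol d v (t, w)) ?y)"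
      by (rule X.chain(2)[OF y]) (rule dd_slice(1)[OF PD.diff[OF PD.smooth_f pW(2)]])
    also have "\<dots> = (\<Sum>k\<in>UNIV. X.J k i y * dd (space_dir k) (log_sol d v) (t, ?y))"
      using D.slice_pderiv[OF PD.smooth_f pW(2), of "\<lambda>w. log_sol d v (t, w)"] by simp
    finally show ?thesis .
  qed
  have dtime: "dd time_dir (log_sol c v) (t, y) = dd time_dir (log_sol d v) (t, ?y)"
  proof -
    have "((\<lambda>s. log_sol c v (s, y)) has_vector_derivative dd (1, 0) (log_sol c v) (t, y)) (at t)"
      by (rule dd_slice_time[OF PC.diff[OF PC.smooth_f pW(1)]])
    moreover have "((\<lambda>s. log_sol d v (s, ?y)) has_vector_derivative dd (1, 0) (log_sol d v) (t, ?y)) (at t)"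
      by (rule dd_slice_time[OF PD.diff[OF PD.smooth_f pW(2)]])
    ultimately show ?thesis
      unfolding ll[OF y] time_dir_def by (rule vector_derivative_unique_at)
  qed
  have form: "add_differential \<xi> (u t) c w $ i = (\<Sum>k\<in>UNIV. X.J k i w * add_differential \<xi> (u t) d (transition c d w) $ k)"
    if w: "w \<in> overlap c d" for w i
  proof -
    obtain x where x: "x \<in> chart_dom c \<inter> chart_dom d" "w = coord c x" using w unfolding overlap_def by blast
    have tx: "transition c d w = coord d x" using x inv_coord[OF C.c] unfolding transition_def by auto
    have "\<xi> c (coord c x) $ i = (\<Sum>k\<in>UNIV. jacobian c d (coord c x) $ k $ i * \<xi> d (coord d x) $ k)"
      using closed C.c D.c x(1) unfolding closed_one_form_def by blast
    then have 1: "\<xi> c w $ i = (\<Sum>k\<in>UNIV. X.J k i w * \<xi> d (transition c d w) $ k)"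
      unfolding tx unfolding x(2) by (simp add: jacobian_def X.J_def)
    have "pderiv_at i (in_chart c (u t)) w = pderiv_at i (\<lambda>w. in_chart d (u t) (transition c d w)) w"
      unfolding pderiv_at_dd by (rule dd_cong_open[OF X.open_U w]) (rule in_chart_change[OF C.c D.c])
    also have "\<dots> = (\<Sum>k\<in>UNIV. X.J k i w * pderiv_at k (in_chart d (u t)) (transition c d w))"
    proof (rule X.chain(2)[OF w])
      have "(t, transition c d w) \<in> D.W" using t ov[OF w] by auto
      from dd_slice(1)[OF smooth_on_differentiable[OF D.open_W smd this]]
      show "in_chart d (u t) differentiable at (transition c d w)" by (simp add: D.fld_def)
    qed
    finally show ?thesis unfolding add_differential_def using 1 by (simp add: distrib_left sum.distrib)
  qed
  have eta: "C.eta u (t, y) = transpose (X.Jm y) ** D.eta u (t, ?y) ** X.Jm y"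
    unfolding C.eta_def D.eta_def fst_conv snd_conv
  proof (rule X.graph_metric_change[OF y form])
    fix w i assume "w \<in> chart_img d"
    then have "(t, w) \<in> D.W" using t by auto
    from dd_slice(1)[OF smooth_on_differentiable[OF D.open_W D.smooth_om[OF smd] this]]
    show "(\<lambda>w. add_differential \<xi> (u t) d w $ i) differentiable at w" by (simp add: D.om_def)
  qed
  have "PC.Q (t, y) = PD.Q (t, ?y)"
    unfolding PC.Q_def PD.Q_def PC.\<Gamma>_def PD.\<Gamma>_def acoef_def fst_conv snd_conv
    using X.gradient_form_change[OF eta C.det_eta_nz D.det_eta_nz dspace] ov[OF y]
    unfolding C.eta_def D.eta_def by simp
  then show ?thesis unfolding LY_def PC.H_def PD.H_def dtime by simp
qed

text \<open>The maximum principle for (t - \<epsilon>) H on [\<epsilon>, T], where T is the time of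
  the point being estimated. All pieces are treated together, since X has no boundary but each ball
  has.\<close>

lemma li_yau:
  assumes F: "finite F" "\<And>c z r. (c, z, r) \<in> F \<Longrightarrow> piece c z r" "(\<Union>(c, z, r)\<in>F. chart_inv c ` ball z r) = UNIV"
  shows "\<exists>C>0. \<exists>M>0. \<exists>\<mu>>0. \<forall>u v. (\<forall>(c, z, r)\<in>F. admissible c z r K u) \<longrightarrow> smooth_spacetime \<A> {0<..} u \<longrightarrow>
    positive_solution \<A> g \<xi> u v \<longrightarrow> (\<forall>(c, z, r)\<in>F. \<forall>p\<in>{0<..} \<times> ball z r.
      bounded_coeffs M \<mu> (acoef c u) (bcoef c u) p \<and> LY c u v p \<le> C * (1 + 1 / fst p))"
proof -
  let ?P = "\<lambda>M \<mu> (c, z, r). \<forall>u. admissible c z r K u \<longrightarrow>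
    (\<forall>p\<in>{0<..} \<times> ball z r. bounded_coeffs M \<mu> (acoef c u) (bcoef c u) p)"
  have "\<exists>M>0. \<exists>\<mu>>0. \<forall>x\<in>F. ?P M \<mu> x"
  proof (rule finite_uniform_constants[OF F(1)])
    show "\<exists>M>0. \<exists>\<mu>>0. ?P M \<mu> x" if "x \<in> F" for x
      using piece_coefficients F(2) that by (cases x) auto
    show "?P M' \<mu>' x" if "?P M \<mu> x" "M \<le> M'" "\<mu>' \<le> \<mu>" for M \<mu> M' \<mu>' x
      using that bounded_coeffs_mono by (cases x) (simp, blast)
  qed
  then obtain M \<mu> where M: "M > 0" "\<mu> > 0" and bd': "\<forall>x\<in>F. ?P M \<mu> x" by blast
  have bd: "bounded_coeffs M \<mu> (acoef c u) (bcoef c u) p"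
    if "(c, z, r) \<in> F" "admissible c z r K u" "p \<in> {0<..} \<times> ball z r" for c z r u p
    using bspec[OF bd' that(1)] that(2,3) by auto
  obtain C where C: "C > 0" and LYC: "\<And>(W :: (real \<times> (real^'n)) set) f a b p \<epsilon> e. parabolic W f a b \<Longrightarrow>
    bounded_coeffs M \<mu> a b p \<Longrightarrow> p \<in> W \<Longrightarrow> \<epsilon> < fst p \<Longrightarrow> 0 < e \<Longrightarrow>
    (\<And>q. q \<in> ball p e \<Longrightarrow> fst q \<le> fst p \<Longrightarrow>
      (fst q - \<epsilon>) * parabolic.H f a q \<le> (fst p - \<epsilon>) * parabolic.H f a p) \<Longrightarrow>
    parabolic.H f a p \<le> C * (1 + 1 / (fst p - \<epsilon>))"
    using li_yau_max[OF M, where 'n = 'n] by blast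
  have main: "LY c u v p \<le> C * (1 + 1 / fst p)"
    if adm: "\<And>c z r. (c, z, r) \<in> F \<Longrightarrow> admissible c z r K u" and u: "smooth_spacetime \<A> {0<..} u"
      and sol: "positive_solution \<A> g \<xi> u v" and cF: "(c, z, r) \<in> F" and p: "p \<in> {0<..} \<times> ball z r"
    for u v c z r p
  proof -
    define T where "T = fst p"
    have T: "0 < T" unfolding T_def using p by auto
    have cont: "continuous_on ({\<epsilon>..T} \<times> cball z r) (\<lambda>p. (fst p - \<epsilon>) * LY c u v p)"
      if "(c, z, r) \<in> F" "0 < \<epsilon>" for c z r \<epsilon>
    proof -
      interpret P: parabolic "{0<..} \<times> chart_img c" "log_sol c v" "acoef c u" "bcoef c u"
        by (rule parabolic_log_sol[OF F(2)[OF that(1)] u sol])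
      have "{\<epsilon>..T} \<times> cball z r \<subseteq> {0<..} \<times> chart_img c"
        using F(2)[OF that(1)] that(2) unfolding piece_def by auto
      then have "continuous_on ({\<epsilon>..T} \<times> cball z r) (LY c u v)"
        unfolding LY_def using continuous_on_subset smooth_on_continuous[OF P.smooth_H] by blast
      then show ?thesis by (intro continuous_intros)
    qed
    have eps: "LY c u v p \<le> C * (1 + 1 / (T - \<epsilon>))" if \<epsilon>: "0 < \<epsilon>" "\<epsilon> < T" for \<epsilon>
    proof -
      let ?h = "\<lambda>c p. (fst p - \<epsilon>) * LY c u v p"
      define \<K> where "\<K> = (\<Union>(c, z, r)\<in>F. ?h c ` ({\<epsilon>..T} \<times> cball z r))"
      have "compact (?h c ` ({\<epsilon>..T} \<times> cball z r))" if "(c, z, r) \<in> F" for c z r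
        by (intro compact_continuous_image cont[OF that \<epsilon>(1)] compact_Times) auto
      then have comp: "compact \<K>" unfolding \<K>_def using F(1) by (intro compact_UN) auto
      have inK: "?h c q \<in> \<K>" if "(c, z, r) \<in> F" "q \<in> {\<epsilon>..T} \<times> cball z r" for c z r q
        unfolding \<K>_def using that by (intro UN_I[of "(c, z, r)"]) auto
      have pK: "?h c p \<in> \<K>"
        using p \<epsilon> by (intro inK[OF cF]) (auto simp: T_def)
      obtain m where m: "m \<in> \<K>" "\<And>k. k \<in> \<K> \<Longrightarrow> k \<le> m"
        using compact_attains_sup[OF comp] pK by blast
      then obtain c\<^sub>0 z\<^sub>0 r\<^sub>0 p\<^sub>0 where c0: "(c\<^sub>0, z\<^sub>0, r\<^sub>0) \<in> F" "p\<^sub>0 \<in> {\<epsilon>..T} \<times> cball z\<^sub>0 r\<^sub>0" "m = ?h c\<^sub>0 p\<^sub>0"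
        unfolding \<K>_def by auto
      obtain t\<^sub>0 y\<^sub>0 where p0: "p\<^sub>0 = (t\<^sub>0, y\<^sub>0)" by (cases p\<^sub>0)
      have t0: "\<epsilon> \<le> t\<^sub>0" "t\<^sub>0 \<le> T" using c0(2) p0 by auto
      have mb: "m \<le> C * (T - \<epsilon> + 1)"
      \<comment> \<open>At the initial time the weight vanishes, so the maximum is 0 there.\<close>
      proof (cases "t\<^sub>0 = \<epsilon>")
        case True
        then have "m = 0" using c0(3) p0 by simp
        then show ?thesis using C \<epsilon> by simp
      next
        case False
        then have t0': "\<epsilon> < t\<^sub>0" using t0 by simp
        have pc: "piece c\<^sub>0 z\<^sub>0 r\<^sub>0" by (rule F(2)[OF c0(1)])
        have cA: "c\<^sub>0 \<in> \<A>" and y0: "y\<^sub>0 \<in> chart_img c\<^sub>0" using pc c0(2) p0 unfolding piece_def by auto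
        \<comment> \<open>The maximum may sit on the sphere bounding its ball; the same point of X
          is interior to the ball of some piece \<open>d\<close>.\<close>
        have "chart_inv c\<^sub>0 y\<^sub>0 \<in> (\<Union>(c, z, r)\<in>F. chart_inv c ` ball z r)" using F(3) by simp
        then obtain d z' r' y' where d: "(d, z', r') \<in> F" "y' \<in> ball z' r'" "chart_inv c\<^sub>0 y\<^sub>0 = chart_inv d y'" by auto
        have pd: "piece d z' r'" by (rule F(2)[OF d(1)])
        have dA: "d \<in> \<A>" and y': "y' \<in> chart_img d" using pd d(2) unfolding piece_def by (auto simp: subset_iff)
        have ov: "y\<^sub>0 \<in> overlap c\<^sub>0 d" unfolding overlap_iff[OF cA] using y0 d(3) inv_in[OF dA y'] by simp
        have tr: "transition c\<^sub>0 d y\<^sub>0 = y'" unfolding transition_def using d(3) coord_inv[OF dA y'] by simp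
        have tpos: "0 < t\<^sub>0" using t0' \<epsilon> by simp
        have inv: "LY c\<^sub>0 u v (t\<^sub>0, y\<^sub>0) = LY d u v (t\<^sub>0, y')"
          using LY_invariant[OF pc pd u sol tpos ov] unfolding tr .
        \<comment> \<open>Near the point and not later than it, both the time interval and the ball
          are respected, so all such values compete for the maximum.\<close>
        define e where "e = min (t\<^sub>0 - \<epsilon>) (r' - dist z' y')"
        have e: "0 < e" unfolding e_def using t0' d(2) by auto
        have "LY d u v (t\<^sub>0, y') \<le> C * (1 + 1 / (fst (t\<^sub>0, y') - \<epsilon>))"
          unfolding LY_def
        proof (rule LYC[OF parabolic_log_sol[OF pd u sol] bd[OF d(1) adm[OF d(1)]] _ _ e])
          show "(t\<^sub>0, y') \<in> {0<..} \<times> ball z' r'" "(t\<^sub>0, y') \<in> {0<..} \<times> chart_img d" using tpos d(2) y' by auto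
          show "\<epsilon> < fst (t\<^sub>0, y')" using t0' by simp
          fix q :: "real \<times> (real^'n)" assume q: "q \<in> ball (t\<^sub>0, y') e" "fst q \<le> fst (t\<^sub>0, y')"
          have "dist t\<^sub>0 (fst q) < e" "dist y' (snd q) < e"
            using q(1) dist_fst_le[of "(t\<^sub>0, y')" q] dist_snd_le[of "(t\<^sub>0, y')" q] by auto
          then have "fst q \<in> {\<epsilon>..T}" "snd q \<in> cball z' r'"
            using q(2) t0 dist_triangle[of z' "snd q" y'] unfolding e_def by (auto simp: dist_real_def)
          then have "?h d q \<le> m" by (intro m(2) inK[OF d(1)]) (auto simp: mem_Times_iff)
          then show "(fst q - \<epsilon>) * parabolic.H (log_sol d v) (acoef d u) q \<le>
              (fst (t\<^sub>0, y') - \<epsilon>) * parabolic.H (log_sol d v) (acoef d u) (t\<^sub>0, y')"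
            using inv c0(3) unfolding p0 LY_def by simp
        qed
        then have "m \<le> (t\<^sub>0 - \<epsilon>) * (C * (1 + 1 / (t\<^sub>0 - \<epsilon>)))"
          using c0(3) t0' unfolding p0 inv by (simp add: inv mult_left_mono)
        also have "\<dots> = C * (t\<^sub>0 - \<epsilon> + 1)" using t0' by (simp add: field_simps)
        also have "\<dots> \<le> C * (T - \<epsilon> + 1)" using C t0 by simp
        finally show ?thesis .
      qed
      have "(T - \<epsilon>) * LY c u v p \<le> m" using m(2)[OF pK] by (simp add: T_def)
      then have "(T - \<epsilon>) * LY c u v p \<le> (T - \<epsilon>) * (C * (1 + 1 / (T - \<epsilon>)))"
      proof -
        have "(T - \<epsilon>) * (C * (1 + 1 / (T - \<epsilon>))) = C * (T - \<epsilon> + 1)" using \<epsilon> by (simp add: field_simps)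
        then show ?thesis using mb \<open>(T - \<epsilon>) * LY c u v p \<le> m\<close> by linarith
      qed
      then show ?thesis using \<epsilon> by simp
    qed
    \<comment> \<open>The bound holds for every small \<epsilon> with the same constant, so
      \<epsilon> may tend to 0 at the fixed point \<open>p\<close>.\<close>
    have lim: "((\<lambda>\<epsilon>. C * (1 + 1 / (T - \<epsilon>))) \<longlongrightarrow> C * (1 + 1 / (T - 0))) (at_right 0)"
      using T by (intro tendsto_intros) auto
    have "\<forall>\<^sub>F \<epsilon> in at_right 0. LY c u v p \<le> C * (1 + 1 / (T - \<epsilon>))"
      using eventually_at_right_less[of 0] eventually_at_right_real[OF T] by eventually_elim (use eps in auto)
    from tendsto_lowerbound[OF lim this] show ?thesis by (simp add: T_def)
  qed
  have "\<forall>u v. (\<forall>(c, z, r)\<in>F. admissible c z r K u) \<longrightarrow> smooth_spacetime \<A> {0<..} u \<longrightarrow>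
    positive_solution \<A> g \<xi> u v \<longrightarrow> (\<forall>(c, z, r)\<in>F. \<forall>p\<in>{0<..} \<times> ball z r.
      bounded_coeffs M \<mu> (acoef c u) (bcoef c u) p \<and> LY c u v p \<le> C * (1 + 1 / fst p))"
  proof (intro allI impI)
    fix u v assume a: "\<forall>(c, z, r)\<in>F. admissible c z r K u" "smooth_spacetime \<A> {0<..} u" "positive_solution \<A> g \<xi> u v"
    have adm: "admissible c z r K u" if "(c, z, r) \<in> F" for c z r using a(1) that by auto
    have "bounded_coeffs M \<mu> (acoef c u) (bcoef c u) p \<and> LY c u v p \<le> C * (1 + 1 / fst p)"
      if cF: "(c, z, r) \<in> F" and p: "p \<in> {0<..} \<times> ball z r" for c z r p
      using bd[OF cF adm[OF cF] p] main[OF adm a(2,3) cF p] by blast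
    then show "\<forall>(c, z, r)\<in>F. \<forall>p\<in>{0<..} \<times> ball z r.
      bounded_coeffs M \<mu> (acoef c u) (bcoef c u) p \<and> LY c u v p \<le> C * (1 + 1 / fst p)"
      by (intro ballI) (clarify, blast)
  qed
  then show ?thesis using C M by blast
qed

text \<open>Two points of X are joined by a chain of exactly \<open>N\<close> balls; the time
  interval is divided equally, and \<open>harnack_segment\<close> is applied once per ball.\<close>

lemma harnack:
  assumes conn: "connected (UNIV :: 'a set)"
    and F: "finite F" "\<And>c z r. (c, z, r) \<in> F \<Longrightarrow> piece c z r" "(\<Union>(c, z, r)\<in>F. chart_inv c ` ball z r) = UNIV"
  shows "\<exists>C>0. \<forall>u v. (\<forall>(c, z, r)\<in>F. admissible c z r K u) \<longrightarrow> smooth_spacetime \<A> {0<..} u \<longrightarrow>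
    positive_solution \<A> g \<xi> u v \<longrightarrow> (\<forall>t\<^sub>1 t\<^sub>2 x y. 0 < t\<^sub>1 \<longrightarrow> t\<^sub>1 < t\<^sub>2 \<longrightarrow>
      ln (v t\<^sub>1 x) \<le> ln (v t\<^sub>2 y) + C * (t\<^sub>2 - t\<^sub>1) + C * ln (t\<^sub>2 / t\<^sub>1) + C / (t\<^sub>2 - t\<^sub>1))"
proof -
  let ?Q = "\<lambda>C M \<mu>. \<forall>u v. (\<forall>(c, z, r)\<in>F. admissible c z r K u) \<longrightarrow> smooth_spacetime \<A> {0<..} u \<longrightarrow>
    positive_solution \<A> g \<xi> u v \<longrightarrow> (\<forall>(c, z, r)\<in>F. \<forall>p\<in>{0<..} \<times> ball z r.
      bounded_coeffs M \<mu> (acoef c u) (bcoef c u) p \<and> LY c u v p \<le> C * (1 + 1 / fst p))"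
  have "\<exists>C>0. \<exists>M>0. \<exists>\<mu>>0. ?Q C M \<mu>" by (rule li_yau[OF F])
  then obtain B M \<mu> where B: "B > 0" "M > 0" "\<mu> > 0" and Q: "?Q B M \<mu>" by blast
  have LYB: "bounded_coeffs M \<mu> (acoef c u) (bcoef c u) p \<and> LY c u v p \<le> B * (1 + 1 / fst p)"
    if a: "\<forall>(c, z, r)\<in>F. admissible c z r K u" "smooth_spacetime \<A> {0<..} u" "positive_solution \<A> g \<xi> u v"
      and cF: "(c, z, r) \<in> F" and p: "p \<in> {0<..} \<times> ball z r" for u v c z r p
    using bspec[OF Q[THEN spec, THEN spec, THEN mp, THEN mp, THEN mp, OF a] cF] p unfolding prod.case by blast
  define R where "R = (\<Sum>(c, z, r)\<in>F. r\<^sup>2)"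
  define E where "E = 2 * R / \<mu>"
  let ?\<U> = "(\<lambda>(c, z, r). chart_inv c ` ball z r) ` F"
  let ?E = "{(x, y). \<exists>U\<in>?\<U>. x \<in> U \<and> y \<in> U}"
  obtain N where N: "0 < N" "\<And>x y. (x, y) \<in> ?E ^^ N"
    using connected_chain[OF conn, of ?\<U>] F open_piece by (smt (verit, best) finite_imageI imageE split_def surjective_pairing)
  have R: "r\<^sup>2 \<le> R" if "(c, z, r) \<in> F" for c z r
    unfolding R_def using member_le_sum[OF that, of "\<lambda>(c, z, r). r\<^sup>2"] F(1) by auto
  have R0: "0 \<le> R" unfolding R_def by (intro sum_nonneg) auto
  have E0: "0 \<le> E" unfolding E_def using R0 B by simp
  \<comment> \<open>B / 2 comes from integrating the Li-Yau bound. Each of the \<open>N\<close>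
    steps lasts (t_2 - t_1) / N and costs E N / (t_2 - t_1), hence the factor N squared.\<close>
  define C where "C = B / 2 + (real N)\<^sup>2 * E"
  have C: "C > 0" unfolding C_def using B E0 by (intro add_pos_nonneg) auto
  have "ln (v t\<^sub>1 x) \<le> ln (v t\<^sub>2 y) + C * (t\<^sub>2 - t\<^sub>1) + C * ln (t\<^sub>2 / t\<^sub>1) + C / (t\<^sub>2 - t\<^sub>1)"
    if adm: "\<forall>(c, z, r)\<in>F. admissible c z r K u" and u: "smooth_spacetime \<A> {0<..} u"
      and sol: "positive_solution \<A> g \<xi> u v" and t: "0 < t\<^sub>1" "t\<^sub>1 < t\<^sub>2" for u v t\<^sub>1 t\<^sub>2 x y
  proof -
    have step: "ln (v s\<^sub>1 x) \<le> ln (v s\<^sub>2 y) + B / 2 * (s\<^sub>2 - s\<^sub>1 + ln (s\<^sub>2 / s\<^sub>1)) + E / (s\<^sub>2 - s\<^sub>1)"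
      if xy: "(x, y) \<in> ?E" and s: "0 < s\<^sub>1" "s\<^sub>1 < s\<^sub>2" for x y s\<^sub>1 s\<^sub>2
    proof -
      obtain c z r y\<^sub>1 y\<^sub>2 where cF: "(c, z, r) \<in> F" and y: "y\<^sub>1 \<in> ball z r" "x = chart_inv c y\<^sub>1" "y\<^sub>2 \<in> ball z r" "y = chart_inv c y\<^sub>2"
        using xy by auto
      have p: "piece c z r" by (rule F(2)[OF cF])
      interpret P: parabolic "{0<..} \<times> chart_img c" "log_sol c v" "acoef c u" "bcoef c u"
        by (rule parabolic_log_sol[OF p u sol])
      have S: "{0<..} \<times> ball z r \<subseteq> {0<..} \<times> chart_img c"
        using p ball_subset_cball[of z r] unfolding piece_def by blast
      have "log_sol c v (s\<^sub>1, y\<^sub>1) \<le> log_sol c v (s\<^sub>2, y\<^sub>2) + B / 2 * (s\<^sub>2 - s\<^sub>1 + ln (s\<^sub>2 / s\<^sub>1)) + 2 * r\<^sup>2 / (\<mu> * (s\<^sub>2 - s\<^sub>1))"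
      proof (rule P.harnack_segment[OF S B(3) _ _ y(1,3) s])
        show "bounded_coeffs M \<mu> (acoef c u) (bcoef c u) p" if "p \<in> {0<..} \<times> ball z r" for p
          using LYB[OF adm u sol cF that] by blast
        show "P.H p \<le> B * (1 + 1 / fst p)" if "p \<in> {0<..} \<times> ball z r" for p
          using LYB[OF adm u sol cF that] unfolding LY_def by blast
      qed
      also have "2 * r\<^sup>2 / (\<mu> * (s\<^sub>2 - s\<^sub>1)) \<le> E / (s\<^sub>2 - s\<^sub>1)"
      proof -
        have "2 * r\<^sup>2 / (\<mu> * (s\<^sub>2 - s\<^sub>1)) = 2 * r\<^sup>2 / \<mu> / (s\<^sub>2 - s\<^sub>1)" by simp
        also have "\<dots> \<le> E / (s\<^sub>2 - s\<^sub>1)"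
          unfolding E_def using R[OF cF] s B by (intro divide_right_mono) auto
        finally show ?thesis .
      qed
      finally show ?thesis unfolding log_sol_def in_chart_def y by simp
    qed
    define h where "h = (t\<^sub>2 - t\<^sub>1) / real N"
    have h: "h > 0" unfolding h_def using t N by simp
    have chain: "ln (v t\<^sub>1 x) \<le> ln (v (t\<^sub>1 + real n * h) y) + B / 2 * (real n * h + ln ((t\<^sub>1 + real n * h) / t\<^sub>1)) + real n * (E / h)"
      if "(x, y) \<in> ?E ^^ n" for n x y
      using that
    proof (induction n arbitrary: y)
      case 0
      then show ?case using t by simp
    next
      case (Suc n)
      obtain w where w: "(x, w) \<in> ?E ^^ n" "(w, y) \<in> ?E" by (rule relpow_Suc_E[OF Suc.prems])
      have pos: "0 < t\<^sub>1 + real n * h" using t h by (simp add: add_pos_nonneg)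
      let ?s = "t\<^sub>1 + real n * h" and ?s' = "t\<^sub>1 + real (Suc n) * h"
      have ss: "?s' - ?s = h" "?s < ?s'" using h by (auto simp: algebra_simps)
      have "ln (v t\<^sub>1 x) \<le> ln (v ?s w) + B / 2 * (real n * h + ln (?s / t\<^sub>1)) + real n * (E / h)"
        by (rule Suc.IH[OF w(1)])
      also have "ln (v ?s w) \<le> ln (v ?s' y) + B / 2 * (h + ln (?s' / ?s)) + E / h"
        using step[OF w(2) pos ss(2)] unfolding ss(1) .
      \<comment> \<open>Logarithms of time quotients telescope along the chain.\<close>
      also have "ln (?s' / ?s) = ln (?s' / t\<^sub>1) - ln (?s / t\<^sub>1)"
        using pos ss(2) t by (simp add: ln_div)
      finally show ?case by (simp add: algebra_simps add_divide_distrib)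
    qed
    have Nh: "real N * h = t\<^sub>2 - t\<^sub>1" unfolding h_def using N by simp
    have "ln (v t\<^sub>1 x) \<le> ln (v t\<^sub>2 y) + B / 2 * (t\<^sub>2 - t\<^sub>1 + ln (t\<^sub>2 / t\<^sub>1)) + real N * (E / h)"
      using chain[OF N(2)] unfolding Nh by simp
    also have "real N * (E / h) = (real N)\<^sup>2 * E / (t\<^sub>2 - t\<^sub>1)"
      unfolding h_def using N by (simp add: power2_eq_square)
    also have "\<dots> \<le> C / (t\<^sub>2 - t\<^sub>1)" unfolding C_def using t B by (intro divide_right_mono) auto
    also have "B / 2 * (t\<^sub>2 - t\<^sub>1 + ln (t\<^sub>2 / t\<^sub>1)) \<le> C * (t\<^sub>2 - t\<^sub>1 + ln (t\<^sub>2 / t\<^sub>1))"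
      unfolding C_def using t E0 by (intro mult_right_mono add_nonneg_nonneg) auto
    finally show ?thesis by (simp add: distrib_left)
  qed
  then show ?thesis using C by blast
qed

section \<open>From the flow to the Harnack inequality\<close>

lemma gLMCF_admissible:
  assumes p: "piece c z r" and flow: "gLMCF \<A> g \<xi> u" and K: "\<And>t. 0 \<le> t \<Longrightarrow> Cm_norm \<A> g 4 (\<lambda>x. u t x - b t) \<le> K"
  shows "admissible c z r (K\<^sup>2) u"
  unfolding admissible_def
proof (intro conjI allI impI ballI)
  have c: "c \<in> \<A>" and ball: "ball z r \<subseteq> chart_img c"
    using p ball_subset_cball[of z r] unfolding piece_def by auto
  have "smooth_on ({0<..} \<times> chart_img c) (\<lambda>(t, y). in_chart c (u t) y)" if "c \<in> \<A>" for c
    by (rule smooth_on_subset[of "{0..} \<times> chart_img c"])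
      (use flow that in \<open>auto simp: gLMCF_def smooth_spacetime_def\<close>)
  then show sm: "smooth_spacetime \<A> {0<..} u" unfolding smooth_spacetime_def by blast
  show "tensor_norm_sq (g c) k (iter_cov_deriv (g c) k (in_chart c (u t))) y \<le> K\<^sup>2"
    if t: "0 < t" and k: "k \<in> {1..4}" and y: "y \<in> ball z r" for t k y
  proof -
    let ?f = "\<lambda>x. u t x - b t"
    have f: "smooth_fun \<A> ?f"
      unfolding smooth_fun_def
    proof
      fix c assume "c \<in> \<A>"
      then have "smooth_on (chart_img c) (\<lambda>y. (\<lambda>(t, y). in_chart c (u t) y) (t, y))"
        using sm t open_img unfolding smooth_spacetime_def by (intro smooth_on_slice[of "{0<..}"]) auto
      then show "smooth_on (chart_img c) (in_chart c ?f)"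
        unfolding in_chart_def[abs_def] using open_img[OF \<open>c \<in> \<A>\<close>] by (intro smooth_on_diff smooth_on_const) auto
    qed
    \<comment> \<open>The order is at least one, so subtracting \<open>b t\<close> leaves the
      covariant derivative unchanged.\<close>
    obtain k' where k': "k = Suc k'" using k by (cases k) auto
    have "tensor_norm_sq (g c) k (iter_cov_deriv (g c) k (in_chart c (u t))) y =
        tensor_norm_sq (g c) k (iter_cov_deriv (g c) k (in_chart c ?f)) y"
    proof (rule tensor_norm_sq_cong)
      fix "is" :: "'n list" assume "length is = k"
      then have "iter_cov_deriv (g c) k (\<lambda>y. in_chart c (u t) y - b t) is = iter_cov_deriv (g c) k (in_chart c (u t)) is"
        unfolding k' by (rule iter_cov_deriv_minus_const)
      then show "iter_cov_deriv (g c) k (in_chart c (u t)) is = iter_cov_deriv (g c) k (in_chart c ?f) is"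
        unfolding in_chart_def[abs_def] by simp
    qed
    also have "\<dots> \<le> K\<^sup>2"
    proof -
      have yc: "y \<in> chart_img c" using y ball by blast
      have "sqrt (tensor_norm_sq (g c) k (iter_cov_deriv (g c) k (in_chart c ?f)) y) \<le> K"
        using Cm_norm_ge[OF f c yc, of k 4] k K[of t] t by auto
      then show ?thesis by (rule sqrt_le_D)
    qed
    finally show ?thesis .
  qed
  obtain \<theta> where \<theta>: "\<forall>t\<ge>0. lagrangian_angle \<A> g (add_differential \<xi> (u t)) (\<theta> t) \<and>
        (\<forall>x. ((\<lambda>s. u s x) has_real_derivative \<theta> t x) (at t within {0..}))"
    using flow unfolding gLMCF_def by blast
  \<comment> \<open>The flow has one-sided derivatives at t = 0; at positive times they are
    two-sided, as \<open>admissible\<close> asks.\<close>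
  have "at t within {0..} = at t" if "0 < t" for t :: real
    by (rule at_within_interior) (use that in auto)
  then show "\<exists>\<theta>. \<forall>t>0. lagrangian_angle \<A> g (add_differential \<xi> (u t)) (\<theta> t) \<and>
        (\<forall>x. ((\<lambda>s. u s x) has_real_derivative \<theta> t x) (at t))"
    using \<theta> by (intro exI[of _ \<theta>]) (metis less_imp_le)
qed

end

theorem theorem5p3:
  fixes \<A> :: "('a::t2_space, 'n::finite) chart set"
    and g :: "('a, 'n) metric_field"
    and \<xi> :: "('a, 'n) one_form"
    and \<delta>\<^sub>0 :: real
  assumes "compact (UNIV :: 'a set)" and "connected (UNIV :: 'a set)"
    and "smooth_atlas \<A>"
    and "riemannian_metric \<A> g"
    and "closed_one_form \<A> \<xi>"
    and "special_lagrangian \<A> g \<xi>"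
    and "0 < \<delta>\<^sub>0"
    and "\<And>u\<^sub>0. smooth_fun \<A> u\<^sub>0 \<Longrightarrow> hessian_sq_le \<A> g u\<^sub>0 \<delta>\<^sub>0 \<Longrightarrow> \<exists>u. gLMCF \<A> g \<xi> u \<and> u 0 = u\<^sub>0"
  shows "\<forall>K::real. \<exists>C>0.
    \<forall>(u :: real \<Rightarrow> 'a \<Rightarrow> real) (b :: real \<Rightarrow> real) (v :: real \<Rightarrow> 'a \<Rightarrow> real).
      gLMCF \<A> g \<xi> u \<longrightarrow> hessian_sq_le \<A> g (u 0) \<delta>\<^sub>0 \<longrightarrow>
      (\<forall>t\<ge>0. Cm_norm \<A> g 4 (\<lambda>x. u t x - b t) \<le> K) \<longrightarrow>
      positive_solution \<A> g \<xi> u v \<longrightarrow>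
      (\<forall>t\<^sub>1 t\<^sub>2. 0 < t\<^sub>1 \<longrightarrow> t\<^sub>1 < t\<^sub>2 \<longrightarrow>
        (SUP x. v t\<^sub>1 x) \<le>
          (INF x. v t\<^sub>2 x) * (t\<^sub>2 / t\<^sub>1) powr C * exp (C / (t\<^sub>2 - t\<^sub>1) + C * (t\<^sub>2 - t\<^sub>1)))"
proof
  fix K :: real
  interpret flow \<A> g \<xi> using assms(1,3,4,5) by unfold_locales
  obtain F where F: "finite F" "\<And>c z r. (c, z, r) \<in> F \<Longrightarrow> piece c z r"
    "(\<Union>(c, z, r)\<in>F. chart_inv c ` ball z r) = UNIV" using finite_pieces by blast
  obtain C where C: "C > 0" and harnackC: "\<And>u v t\<^sub>1 t\<^sub>2 x y. (\<forall>(c, z, r)\<in>F. admissible c z r (K\<^sup>2) u) \<Longrightarrow>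
      smooth_spacetime \<A> {0<..} u \<Longrightarrow> positive_solution \<A> g \<xi> u v \<Longrightarrow> 0 < t\<^sub>1 \<Longrightarrow> t\<^sub>1 < t\<^sub>2 \<Longrightarrow>
      ln (v t\<^sub>1 x) \<le> ln (v t\<^sub>2 y) + C * (t\<^sub>2 - t\<^sub>1) + C * ln (t\<^sub>2 / t\<^sub>1) + C / (t\<^sub>2 - t\<^sub>1)"
    using harnack[OF assms(2) F, of "K\<^sup>2"] by blast
  have main: "(SUP x. v t\<^sub>1 x) \<le> (INF x. v t\<^sub>2 x) * (t\<^sub>2 / t\<^sub>1) powr C * exp (C / (t\<^sub>2 - t\<^sub>1) + C * (t\<^sub>2 - t\<^sub>1))"
    if flow: "gLMCF \<A> g \<xi> u" and K: "\<forall>t\<ge>0. Cm_norm \<A> g 4 (\<lambda>x. u t x - b t) \<le> K"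
      and sol: "positive_solution \<A> g \<xi> u v" and t: "0 < t\<^sub>1" "t\<^sub>1 < t\<^sub>2" for u b v t\<^sub>1 t\<^sub>2
  proof -
    have adm: "admissible c z r (K\<^sup>2) u" if "(c, z, r) \<in> F" for c z r
      by (rule gLMCF_admissible[OF F(2)[OF that] flow, of b]) (use K in blast)
    have adm': "\<forall>(c, z, r)\<in>F. admissible c z r (K\<^sup>2) u"
    proof
      fix x assume "x \<in> F"
      then show "case x of (c, z, r) \<Rightarrow> admissible c z r (K\<^sup>2) u" using adm by (cases x) (simp only: prod.case)
    qed
    have "F \<noteq> {}" using F(3) by auto
    then obtain c z r where "(c, z, r) \<in> F" by auto
    then have u: "smooth_spacetime \<A> {0<..} u" using adm unfolding admissible_def by blast
    let ?R = "(t\<^sub>2 / t\<^sub>1) powr C * exp (C / (t\<^sub>2 - t\<^sub>1) + C * (t\<^sub>2 - t\<^sub>1))"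
    have Rpos: "0 < ?R" using t by simp
    have le: "v t\<^sub>1 x \<le> v t\<^sub>2 y * ?R" for x y
    proof -
      have pos: "0 < v t\<^sub>1 x" "0 < v t\<^sub>2 y" using sol t unfolding positive_solution_def by auto
      have "v t\<^sub>1 x = exp (ln (v t\<^sub>1 x))" using pos by simp
      also have "\<dots> \<le> exp (ln (v t\<^sub>2 y) + C * (t\<^sub>2 - t\<^sub>1) + C * ln (t\<^sub>2 / t\<^sub>1) + C / (t\<^sub>2 - t\<^sub>1))"
        using harnackC[OF adm' u sol t, of x y] by simp
      also have "\<dots> = v t\<^sub>2 y * ?R"
        using pos t by (simp add: exp_add powr_def mult_ac)
      finally show ?thesis .
    qed
    \<comment> \<open>The bound holds for every pair of points, so the infimum is taken first, after
      dividing by the positive factor, and then the supremum.\<close>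
    have "(SUP x. v t\<^sub>1 x) \<le> (INF x. v t\<^sub>2 x) * ?R"
    proof (rule cSUP_least)
      fix x
      have "v t\<^sub>1 x / ?R \<le> (INF y. v t\<^sub>2 y)"
      proof (rule cINF_greatest)
        show "v t\<^sub>1 x / ?R \<le> v t\<^sub>2 y" for y
          unfolding pos_divide_le_eq[OF Rpos] by (rule le)
      qed simp
      then show "v t\<^sub>1 x \<le> (INF x. v t\<^sub>2 x) * ?R" unfolding pos_divide_le_eq[OF Rpos] .
    qed simp
    then show ?thesis by (simp only: mult.assoc)
  qed
  show "\<exists>C>0. \<forall>(u :: real \<Rightarrow> 'a \<Rightarrow> real) (b :: real \<Rightarrow> real) (v :: real \<Rightarrow> 'a \<Rightarrow> real).
      gLMCF \<A> g \<xi> u \<longrightarrow> hessian_sq_le \<A> g (u 0) \<delta>\<^sub>0 \<longrightarrow>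
      (\<forall>t\<ge>0. Cm_norm \<A> g 4 (\<lambda>x. u t x - b t) \<le> K) \<longrightarrow>
      positive_solution \<A> g \<xi> u v \<longrightarrow>
      (\<forall>t\<^sub>1 t\<^sub>2. 0 < t\<^sub>1 \<longrightarrow> t\<^sub>1 < t\<^sub>2 \<longrightarrow>
        (SUP x. v t\<^sub>1 x) \<le>
          (INF x. v t\<^sub>2 x) * (t\<^sub>2 / t\<^sub>1) powr C * exp (C / (t\<^sub>2 - t\<^sub>1) + C * (t\<^sub>2 - t\<^sub>1)))"
    by (intro exI[of _ C] conjI C allI impI, rule main, assumption+)
qed

end
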